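(* Let $A=\langle \boldsymbol{\alpha},\mathbf{A},\boldsymbol{\beta}\rangle$ be a minimal WFA with $n$ states over a one-letter alphabet, in SVA form, with spectral radius $\rho(\mathbf{A})<1$ (and with the symmetry conventions stated in the context), and let $\phi(z)=\boldsymbol{\alpha}^{\top}(z\mathbf{1}-\mathbf{A})^{-1}\boldsymbol{\beta}$ be a symbol for its Hankel operator $H$. Let $\sigma_k$ be a singular number of multiplicity $r$ for $H$, with $\sigma_0\ge\dots>\sigma_k=\dots=\sigma_{k+r-1}>\sigma_{k+r}\ge\dots\ge\sigma_{n-1}>0$. Partition the Gramian matrices as $$\mathbf{P}=\mathbf{Q}=\begin{pmatrix}\mathbf{\Sigma}&\mathbf{0}\\ \mathbf{0}&\sigma_k\mathbf{1}_r\end{pmatrix},$$ where $\mathbf{\Sigma}\in\mathbb{R}^{(n-r)\times(n-r)}$ is the diagonal matrix containing the remaining singular numbers, and partition $\mathbf{A}$, $\boldsymbol{\alpha}$, $\boldsymbol{\beta}$ conformally to the Gramians: $$\mathbf{A}=\begin{pmatrix}\mathbf{A}_{11}&\mathbf{A}_{12}\\ \mathbf{A}_{12}^{\top}&\mathbf{A}_{22}\end{pmatrix},\quad \boldsymbol{\alpha}=\begin{pmatrix}\boldsymbol{\alpha}_1\\ \boldsymbol{\alpha}_2\end{pmatrix},\quad \boldsymbol{\beta}=\begin{pmatrix}\boldsymbol{\beta}_1\\ \boldsymbol{\beta}_2\end{pmatrix}.$$ Let $\mathbf{R}=\sigma_k^2\mathbf{1}_{n-r}-\mathbf{\Sigma}^2$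 and denote by $(\cdot)^{+}$ the Moore–Penrose pseudo-inverse. Let $\widehat{A}=\langle\widehat{\boldsymbol{\alpha}},\widehat{\mathbf{A}},\widehat{\boldsymbol{\beta}}\rangle$ be an admissible auxiliary WFA (see context) and $C$ a constant. If the function $\psi(z)=\widehat{\boldsymbol{\alpha}}^{\top}(z\mathbf{1}-\widehat{\mathbf{A}})^{-1}\widehat{\boldsymbol{\beta}}+C$ is the best approximation of $\phi(z)$ (i.e. $\psi\in\mathcal{H}^\infty_k$ and $\|\phi-\psi\|_\infty=\sigma_k$), then: (1) if $\boldsymbol{\alpha}_2\neq\mathbf{0}$: $$\widehat{\boldsymbol{\beta}}=-\widehat{\mathbf{A}}\mathbf{A}_{12}(\boldsymbol{\beta}_2^{\top})^{+},\qquad \widehat{\boldsymbol{\alpha}}=\widehat{\mathbf{A}}^{\top}\mathbf{R}\mathbf{A}_{12}(\boldsymbol{\alpha}_2^{\top})^{+},\qquad \widehat{\mathbf{A}}\bigl(\mathbf{A}_{11}-\mathbf{A}_{12}(\boldsymbol{\beta}_2^{\top})^{+}\boldsymbol{\beta}_1^{\top}\bigr)=\mathbf{1};$$ (2) if $\boldsymbol{\alpha}_2=\mathbf{0}$: $$\widehat{\boldsymbol{\beta}}=(\mathbf{1}-\widehat{\mathbf{A}}\mathbf{A}_{11})(\boldsymbol{\beta}_1^{\top})^{+},\qquad \widehat{\boldsymbol{\alpha}}=-(\mathbf{R}-\widehat{\mathbf{A}}^{\top}\mathbf{R}\mathbf{A}_{11})(\boldsymbol{\alpha}_1^{\top})^{+},\qquad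 \widehat{\mathbf{A}}\mathbf{A}_{12}=\mathbf{0}.$$
   Context: A weighted finite automaton (WFA) with $n$ states over a one-letter alphabet is a triple $A=\langle\boldsymbol{\alpha},\mathbf{A},\boldsymbol{\beta}\rangle$ with $\boldsymbol{\alpha},\boldsymbol{\beta}\in\mathbb{R}^n$, $\mathbf{A}\in\mathbb{R}^{n\times n}$. It computes $f:\mathbb{N}\to\mathbb{R}$, $f(x)=\boldsymbol{\alpha}^{\top}\mathbf{A}^x\boldsymbol{\beta}$ (strings over one letter are identified with their lengths). Its Hankel matrix is the infinite matrix $\mathbf{H}(i,j)=f(i+j)$, $i,j\ge0$, viewed as an operator $H$ on $\ell^2$; it is bounded and of finite rank when $\rho(\mathbf{A})<1$. The forward matrix $\mathbf{F}$ has rows $\boldsymbol{\alpha}^{\top}\mathbf{A}^p$ and the backward matrix $\mathbf{B}$ has rows $(\mathbf{A}^s\boldsymbol{\beta})^{\top}$, $p,s\ge0$, so $\mathbf{H}=\mathbf{F}\mathbf{B}^{\top}$. The WFA is reachable if $\operatorname{rank}\mathbf{F}=n$, observable if $\operatorname{rank}\mathbf{B}=n$, and minimal if both. The Gramians are $\mathbf{P}=\mathbf{F}^{\top}\mathbf{F}$ and $\mathbf{Q}=\mathbf{B}^{\top}\mathbf{B}$. The singular numbers of $H$ are $\sigma_0\ge\dots\ge\sigma_{n-1}>0$, and $0\le k<n$. A minimal WFA is in SVA (singular value automaton) form if $\mathbf{F}=\mathbf{U}\mathbf{D}^{1/2}$ and $\mathbf{B}=\mathbf{V}\mathbf{D}^{1/2}$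 for a compact SVD $\mathbf{H}=\mathbf{U}\mathbf{D}\mathbf{V}^{\top}$; then $\mathbf{P}=\mathbf{Q}=\mathbf{D}$ is the diagonal matrix of singular numbers (coordinates being ordered so that $\sigma_k$ occupies the last $r$ diagonal places). Standing conventions for the SVA form (since $\mathbf{H}$ is symmetric): $\mathbf{A}=\mathbf{A}^{\top}$, and the $i$-th coordinates of $\boldsymbol{\alpha}$ and $\boldsymbol{\beta}$ satisfy $\boldsymbol{\alpha}_i=\operatorname{sgn}(\lambda_i)\boldsymbol{\beta}_i$, where $\lambda_i$ is the $i$-th nonzero eigenvalue of $\mathbf{H}$. Let $\mathbb{T}$ be the unit circle, $\mathcal{H}^\infty=\{\phi\in\mathcal{L}^\infty(\mathbb{T}):\widehat\phi(n)=0,\ n<0\}$ and $\mathcal{H}^\infty_-=\{\phi\in\mathcal{L}^\infty(\mathbb{T}):\widehat\phi(n)=0,\ n\ge0\}$, with $\widehat\phi(n)$ the Fourier coefficients. A function $\phi$ is a symbol of $H$ if $\mathbf{H}(j,k)=\widehat\phi(-j-k-1)$ for all $j,k\ge0$. $\mathcal{R}_k\subset\mathcal{H}^\infty_-$ is the set of strictly proper rational functions of rank $k$ (rank = the maximum of the degrees of numerator and denominator), and $\mathcal{H}^\infty_k=\{g+l\in\mathcal{L}^\infty(\mathbb{T}): g\in\mathcal{R}_k,\ l\in\mathcal{H}^\infty\}$. A WFA $\widehat{A}=\langle\widehat{\boldsymbol{\alpha}},\widehat{\mathbf{A}},\widehat{\boldsymbol{\beta}}\rangle$ with $j\ge k$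 states is called admissible (relative to $A$) if $\widehat{\mathbf{A}}$ has no eigenvalue of modulus $1$ and the WFA $E=\langle\boldsymbol{\alpha}_e,\mathbf{A}_e,\boldsymbol{\beta}_e\rangle$ given by $\mathbf{A}_e=\begin{pmatrix}\mathbf{A}&\mathbf{0}\\ \mathbf{0}&\widehat{\mathbf{A}}\end{pmatrix}$, $\boldsymbol{\alpha}_e=\begin{pmatrix}\boldsymbol{\alpha}\\-\widehat{\boldsymbol{\alpha}}\end{pmatrix}$, $\boldsymbol{\beta}_e=\begin{pmatrix}\boldsymbol{\beta}\\ \widehat{\boldsymbol{\beta}}\end{pmatrix}$ is minimal.
   Formalization: The formulas in (1) and (2) are proved for the auxiliary WFA after some invertible change of state coordinates, since rescaling its weights to tα̂ and β̂/t keeps ψ and admissibility but breaks the printed formulas; that it has exactly n−r states is also proved. *)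

theory Defs
  imports
    "HOL-Probability.Essential_Supremum"
    "HOL-Computational_Algebra.Polynomial"
    "HOL-Library.Multiset"
    "Jordan_Normal_Form.DL_Rank"
    "Jordan_Normal_Form.Gauss_Jordan_Elimination"
    "Jordan_Normal_Form.Spectral_Radius"
begin

(* The vector and matrix notation below is that of Jordan_Normal_Form. *)
no_notation vec_nth (infixl \<open>$\<close> 90)
no_notation inner (infix \<open>\<bullet>\<close> 70)

section \<open>Weighted finite automata over a one-letter alphabet\<close>

datatype wfa = WFA (initial: "real vec") (trans_mat: "real mat") (final: "real vec")

definition is_wfa :: "nat \<Rightarrow> wfa \<Rightarrow> bool" where
  "is_wfa n W \<longleftrightarrow>
     initial W \<in> carrier_vec n \<and> trans_mat W \<in> carrier_mat n n \<and> final W \<in> carrier_vec n"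

definition wfa_fun :: "wfa \<Rightarrow> nat \<Rightarrow> real" where
  "wfa_fun W x = initial W \<bullet> (trans_mat W ^\<^sub>m x *\<^sub>v final W)"

definition hankel :: "wfa \<Rightarrow> nat \<Rightarrow> nat \<Rightarrow> real" where
  "hankel W i j = wfa_fun W (i + j)"

(* A matrix with infinitely many rows and n columns is given by its sequence of rows.
   Row p of the forward matrix is written as the column vector (A^p)^T alpha. *)

definition forward_mat :: "wfa \<Rightarrow> nat \<Rightarrow> real vec" where
  "forward_mat W p = (trans_mat W ^\<^sub>m p)\<^sup>T *\<^sub>v initial W"

definition backward_mat :: "wfa \<Rightarrow> nat \<Rightarrow> real vec" where
  "backward_mat W s = trans_mat W ^\<^sub>m s *\<^sub>v final W"

definition (in vec_space) row_rank :: "(nat \<Rightarrow> 'a vec) \<Rightarrow> nat" where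
  "row_rank M = vectorspace.dim class_ring (span_vs (range M))"

definition reachable :: "nat \<Rightarrow> wfa \<Rightarrow> bool" where
  "reachable n W \<longleftrightarrow> vec_space.row_rank n (forward_mat W) = n"

definition observable :: "nat \<Rightarrow> wfa \<Rightarrow> bool" where
  "observable n W \<longleftrightarrow> vec_space.row_rank n (backward_mat W) = n"

definition minimal_wfa :: "nat \<Rightarrow> wfa \<Rightarrow> bool" where
  "minimal_wfa n W \<longleftrightarrow> is_wfa n W \<and> reachable n W \<and> observable n W"

(* M^T M for a matrix M with infinitely many rows; the series converge for the forward
   and backward matrices when the spectral radius of the transition matrix is below 1. *)
definition gram :: "nat \<Rightarrow> (nat \<Rightarrow> real vec) \<Rightarrow> real mat" where
  "gram n M = mat n n (\<lambda>(i, j). \<Sum>p. M p $ i * M p $ j)"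

section \<open>Singular value decomposition of the Hankel operator and the SVA form\<close>

definition orthonormal_columns :: "nat \<Rightarrow> (nat \<Rightarrow> nat \<Rightarrow> real) \<Rightarrow> bool" where
  "orthonormal_columns n U \<longleftrightarrow>
     (\<forall>i<n. \<forall>j<n. (\<lambda>p. U p i * U p j) sums (if i = j then 1 else 0))"

(* H = U D V^T of rank n, where D = diag (d 0, ..., d (n-1)) is not assumed to be sorted. *)
definition compact_svd ::
  "nat \<Rightarrow> (nat \<Rightarrow> nat \<Rightarrow> real) \<Rightarrow> (nat \<Rightarrow> nat \<Rightarrow> real) \<Rightarrow> (nat \<Rightarrow> real) \<Rightarrow> (nat \<Rightarrow> nat \<Rightarrow> real) \<Rightarrow> bool"
where
  "compact_svd n H U d V \<longleftrightarrow>
     orthonormal_columns n U \<and> orthonormal_columns n V \<and> (\<forall>i<n. 0 < d i) \<and>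
     (\<forall>p q. H p q = (\<Sum>i<n. U p i * d i * V q i))"

(* The nonzero singular numbers, repeated according to multiplicity, in decreasing order. *)
definition singular_numbers :: "nat \<Rightarrow> (nat \<Rightarrow> nat \<Rightarrow> real) \<Rightarrow> (nat \<Rightarrow> real) \<Rightarrow> bool" where
  "singular_numbers n H \<sigma> \<longleftrightarrow>
     (\<forall>i j. i \<le> j \<longrightarrow> j < n \<longrightarrow> \<sigma> j \<le> \<sigma> i) \<and> (\<exists>U V. compact_svd n H U \<sigma> V)"

definition sva_form :: "nat \<Rightarrow> wfa \<Rightarrow> bool" where
  "sva_form n W \<longleftrightarrow> minimal_wfa n W \<and>
     (\<exists>U d V. compact_svd n (hankel W) U d V \<and>
        (\<forall>p. \<forall>i<n. forward_mat W p $ i = U p i * sqrt (d i) \<and>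
                     backward_mat W p $ i = V p i * sqrt (d i)))"

(* lam lists n nonzero eigenvalues of H, with orthonormal eigenvectors in l^2; if H has
   rank n, these are all the nonzero eigenvalues, with multiplicity. *)
definition nonzero_eigenvalues :: "nat \<Rightarrow> (nat \<Rightarrow> nat \<Rightarrow> real) \<Rightarrow> (nat \<Rightarrow> real) \<Rightarrow> bool" where
  "nonzero_eigenvalues n H lam \<longleftrightarrow> (\<forall>i<n. lam i \<noteq> 0) \<and>
     (\<exists>w. orthonormal_columns n w \<and> (\<forall>i<n. \<forall>p. (\<lambda>q. H p q * w q i) sums (lam i * w p i)))"

(* The eigenvalues are numbered like the coordinates of the SVA form: the i-th one has the
   i-th diagonal entry of the Gramian, a singular number, as its absolute value. *)
definition sva_conventions :: "nat \<Rightarrow> wfa \<Rightarrow> bool" where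
  "sva_conventions n W \<longleftrightarrow> trans_mat W = (trans_mat W)\<^sup>T \<and>
     (\<exists>lam. nonzero_eigenvalues n (hankel W) lam \<and>
        (\<forall>i<n. \<bar>lam i\<bar> = gram n (forward_mat W) $$ (i, i) \<and>
               initial W $ i = sgn (lam i) * final W $ i))"

section \<open>Functions on the unit circle\<close>

(* normalised Lebesgue measure on the unit circle *)
definition circle :: "complex measure" where
  "circle = distr (uniform_measure lborel {0..<2 * pi}) (restrict_space borel (sphere 0 1)) cis"

definition Linf_norm :: "(complex \<Rightarrow> complex) \<Rightarrow> ereal" where
  "Linf_norm f = esssup circle (\<lambda>z. ereal (norm (f z)))"

(* Elements of these spaces are functions, not classes modulo null sets. *)
definition Linf :: "(complex \<Rightarrow> complex) set" where
  "Linf = {f. f \<in> borel_measurable circle \<and> Linf_norm f < \<infinity>}"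

definition fourier_coeff :: "(complex \<Rightarrow> complex) \<Rightarrow> int \<Rightarrow> complex" where
  "fourier_coeff f m = (\<integral>z. f z * z powi (- m) \<partial>circle)"

definition Hinf :: "(complex \<Rightarrow> complex) set" where
  "Hinf = {f \<in> Linf. \<forall>m<0. fourier_coeff f m = 0}"

definition Hinf_minus :: "(complex \<Rightarrow> complex) set" where
  "Hinf_minus = {f \<in> Linf. \<forall>m\<ge>0. fourier_coeff f m = 0}"

definition is_symbol :: "(complex \<Rightarrow> complex) \<Rightarrow> (nat \<Rightarrow> nat \<Rightarrow> real) \<Rightarrow> bool" where
  "is_symbol \<phi> H \<longleftrightarrow> \<phi> \<in> Linf \<and>
     (\<forall>i j. complex_of_real (H i j) = fourier_coeff \<phi> (- int i - int j - 1))"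

(* The case p = 0 (rank 0) is singled out because degree 0 = 0 for the zero polynomial. *)
definition rational_rank :: "nat \<Rightarrow> (complex \<Rightarrow> complex) set" where
  "rational_rank k = {g \<in> Hinf_minus. \<exists>p q :: complex poly. q \<noteq> 0 \<and> coprime p q \<and>
      (p = 0 \<or> degree p < degree q) \<and> max (degree p) (degree q) = k \<and>
      (AE z in circle. g z = poly p z / poly q z)}"

definition Hinf_k :: "nat \<Rightarrow> (complex \<Rightarrow> complex) set" where
  "Hinf_k k = {f \<in> Linf. \<exists>g \<in> rational_rank k. \<exists>l \<in> Hinf. AE z in circle. f z = g z + l z}"

section \<open>Approximating automata\<close>

abbreviation cmat :: "real mat \<Rightarrow> complex mat" where
  "cmat \<equiv> map_mat complex_of_real"

abbreviation cvec :: "real vec \<Rightarrow> complex vec" where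
  "cvec \<equiv> map_vec complex_of_real"

(* alpha^T (z 1 - A)^(-1) beta; unspecified when z is an eigenvalue of A *)
definition wfa_transfer :: "wfa \<Rightarrow> complex \<Rightarrow> complex" where
  "wfa_transfer W z = cvec (initial W) \<bullet>
     (the (mat_inverse (z \<cdot>\<^sub>m 1\<^sub>m (dim_row (trans_mat W)) - cmat (trans_mat W))) *\<^sub>v cvec (final W))"

definition error_wfa :: "wfa \<Rightarrow> wfa \<Rightarrow> wfa" where
  "error_wfa W W' = WFA
     (initial W @\<^sub>v (- initial W'))
     (four_block_mat (trans_mat W) (0\<^sub>m (dim_row (trans_mat W)) (dim_col (trans_mat W')))
        (0\<^sub>m (dim_row (trans_mat W')) (dim_col (trans_mat W))) (trans_mat W'))
     (final W @\<^sub>v final W')"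

(* W has n states, W' has j states *)
definition admissible :: "nat \<Rightarrow> wfa \<Rightarrow> nat \<Rightarrow> nat \<Rightarrow> wfa \<Rightarrow> bool" where
  "admissible n W k j W' \<longleftrightarrow> is_wfa j W' \<and> k \<le> j \<and>
     (\<forall>z. eigenvalue (cmat (trans_mat W')) z \<longrightarrow> cmod z \<noteq> 1) \<and>
     minimal_wfa (n + j) (error_wfa W W')"

(* W' is obtained from W by an invertible change T of state coordinates:
   alpha' = T^T alpha, A' = T^(-1) A T, beta' = T^(-1) beta. *)
definition change_of_basis :: "wfa \<Rightarrow> wfa \<Rightarrow> bool" where
  "change_of_basis W W' \<longleftrightarrow> (\<exists>T S. similar_mat_wit (trans_mat W') (trans_mat W) S T \<and>
     initial W' = T\<^sup>T *\<^sub>v initial W \<and> final W' = S *\<^sub>v final W)"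

section \<open>Moore--Penrose pseudo-inverse\<close>

definition is_pseudo_inverse :: "real mat \<Rightarrow> real mat \<Rightarrow> bool" where
  "is_pseudo_inverse M X \<longleftrightarrow> X \<in> carrier_mat (dim_col M) (dim_row M) \<and>
     M * X * M = M \<and> X * M * X = X \<and> (M * X)\<^sup>T = M * X \<and> (X * M)\<^sup>T = X * M"

definition pseudo_inverse :: "real mat \<Rightarrow> real mat" where
  "pseudo_inverse M = (THE X. is_pseudo_inverse M X)"

(* v as a matrix with one column; v^T is mat_of_row v *)
definition mat_of_col :: "real vec \<Rightarrow> real mat" where
  "mat_of_col v = mat_of_cols (dim_vec v) [v]"

end

theory Submission
  imports Defs "HOL-Probability.Probability_Measure"
begin

no_notation vec_nth (infixl \<open>$\<close> 90)
no_notation inner (infix \<open>\<bullet>\<close> 70)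

text \<open>By the argument of Adamyan, Arov and Krein, the error \<open>\<phi> - \<psi>\<close> intertwines the two Schmidt vectors of
  every singular number equal to \<open>\<sigma>\<^sub>k\<close>. All functions involved are rational, so \<open>(\<phi> - \<psi>)(z) (\<phi> - \<psi>)(1/z) = \<sigma>\<^sub>k\<^sup>2\<close>
  on the whole circle: the error is all-pass. It is realised, up to the constant \<open>C\<close>, by the minimal error
  automaton \<open>(a, M, b)\<close>. Multiplication by an all-pass function maps the state space of the transposed
  automaton onto that of the automaton itself; this gives matrices \<open>P\<close> and \<open>Q\<close> with
  \<open>P = M P M\<^sup>T + b b\<^sup>T\<close>, \<open>Q = M\<^sup>T Q M + a a\<^sup>T\<close> and \<open>Q P = \<sigma>\<^sub>k\<^sup>2\<close>. The leading blocks of \<open>P\<close> and \<open>Q\<close> are the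
  Gramians of \<open>A\<close>, and the columns of \<open>P\<close> that belong to \<open>\<sigma>\<^sub>k\<close> are multiples of unit vectors. Hence the
  off-diagonal blocks vanish in the last \<open>r\<close> coordinates and are inverse to each other up to \<open>R\<close> in the
  other ones. In the state coordinates that they define, the off-diagonal blocks of the two matrix
  equations are the asserted formulas.\<close>

subsection \<open>Normalised measure on the circle\<close>

text \<open>The obstacle is that the auxiliary matrix is only regular on the circle: it may have
  eigenvalues on both sides. The series for the Gramians of the error automaton can then diverge,
  and a Stein equation need not have a unique solution. Hence \<open>P\<close> and \<open>Q\<close>
  are built from functions on the circle, and a comparison with genuine Gramians is possible only in
  the leading blocks, which involve the stable \<open>A\<close> alone. For the off-diagonal blocks
  \<open>Q P\<close> replaces the missing uniqueness. It supplies one-sided inverses only; that the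
  block of \<open>P\<close> belonging to the other singular numbers is square, which fixes the
  number of states of the auxiliary automaton, rests on minimality of the error automaton and on a
  product of rational functions that vanishes identically.\<close>

lemma cis_measurable_circle [measurable]:
  "cis \<in> measurable (uniform_measure lborel {0..<2 * pi}) (restrict_space borel (sphere 0 1))"
proof -
  have "cis \<in> borel_measurable borel"
    by (intro borel_measurable_continuous_onI continuous_intros)
  then show ?thesis
    by (intro measurable_restrict_space2) (auto simp: measurable_def)
qed

lemma space_circle [simp]: "space circle = sphere 0 1"
  by (simp add: circle_def space_restrict_space)

lemma sets_circle [measurable_cong]: "sets circle = sets (restrict_space borel (sphere 0 1))"
  by (simp add: circle_def)

lemma prob_space_circle: "prob_space circle"
  unfolding circle_def
  by (intro prob_space.prob_space_distr prob_space_uniform_measure cis_measurable_circle) auto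

interpretation circle: prob_space circle
  by (rule prob_space_circle)

lemma cis_inj_on: "inj_on cis {0..<2 * pi}"
proof (rule inj_onI)
  fix x y :: real
  assume xy: "x \<in> {0..<2 * pi}" "y \<in> {0..<2 * pi}" and "cis x = cis y"
  then have "cis (x - y) = 1"
    by (simp flip: cis_divide)
  then have "cos (x - y) = 1"
    by (simp add: complex_eq_iff)
  then obtain n :: int where n: "x - y = of_int n * 2 * pi"
    by (auto simp: cos_one_2pi_int)
  have "\<bar>of_int n * 2 * pi\<bar> < 1 * (2 * pi)"
    using xy unfolding n[symmetric] by (simp add: abs_less_iff)
  then have "\<bar>real_of_int n\<bar> < 1"
    by (simp add: abs_mult)
  then have "n = 0"
    by linarith
  then show "x = y"
    using n by simp
qed

lemma AE_circle_notin_finite: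
  assumes "finite F"
  shows "AE z in circle. z \<notin> F"
proof -
  have "finite {t \<in> {0..<2 * pi}. cis t \<in> F}"
    using finite_vimage_IntI[OF assms cis_inj_on] by (simp add: vimage_def Int_def conj_commute)
  then have "AE t in lborel. t \<notin> {t \<in> {0..<2 * pi}. cis t \<in> F}"
    by (intro AE_not_in finite_imp_null_set_lborel)
  then have "AE t in uniform_measure lborel {0..<2 * pi}. cis t \<notin> F"
    by (intro AE_uniform_measureI) auto
  moreover have "{z \<in> space (restrict_space borel (sphere 0 1)). z \<notin> F}
      \<in> sets (restrict_space borel (sphere (0::complex) 1))"
    using assms finite_imp_closed[OF assms]
    by (auto simp: sets_restrict_space space_restrict_space image_iff intro!: bexI[of _ "-F"])
  ultimately show ?thesis
    unfolding circle_def by (subst AE_distr_iff[OF cis_measurable_circle]) auto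
qed

text \<open>The bridge from measure theory to algebra: a rational function that vanishes almost
  everywhere on the circle vanishes at infinitely many points, hence identically there.\<close>

lemma AE_circle_imp_infinite:
  assumes "AE z in circle. P z"
  shows "infinite {z \<in> sphere 0 1. P z}"
proof
  assume "finite {z \<in> sphere 0 1. P z}"
  then have "AE z in circle. z \<notin> {z \<in> sphere 0 1. P z}"
    by (rule AE_circle_notin_finite)
  with assms AE_space have "AE z in circle. False"
    by eventually_elim auto
  then show False
    by (simp add: circle.AE_False)
qed

lemma borel_measurable_circleI:
  assumes "continuous_on (sphere 0 1) (f :: complex \<Rightarrow> 'b :: topological_space)"
  shows "f \<in> borel_measurable circle"
proof -
  have "f \<in> borel_measurable (restrict_space borel (sphere 0 1))"
    using assms by (rule borel_measurable_continuous_on_restrict)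
  then show ?thesis
    by (simp cong: measurable_cong_sets add: sets_circle)
qed

lemma borel_measurable_powi [measurable]: "(\<lambda>z::complex. z powi k) \<in> borel_measurable circle"
  by (intro borel_measurable_circleI continuous_intros) auto

lemma norm_powi_circle: "norm z = 1 \<Longrightarrow> norm (z powi k) = (1::real)" for z :: complex
  by (simp add: norm_power_int)

lemma integral_circle_powi: "(\<integral>z. z powi k \<partial>circle) = (if k = 0 then 1 else 0)"
proof (cases "k = 0")
  case False
  let ?U = "uniform_measure lborel {0..<2 * pi}"
  have U: "?U = density lborel (\<lambda>x. ennreal (indicator {0..<2 * pi} x / (2 * pi)))"
    unfolding uniform_measure_def
    by (intro arg_cong2[where f = density] refl ext)
      (auto simp: indicator_def divide_ennreal ennreal_1[symmetric] simp del: ennreal_1)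
  have deriv: "((\<lambda>t. cis (of_int k * t) / (of_int k * \<i>)) has_vector_derivative cis (of_int k * t)) (at t within S)"
    for t S
    unfolding has_vector_derivative_def
    by (rule has_derivative_eq_rhs, (rule derivative_intros | use False in force)+) (use False in \<open>auto simp: scaleR_conv_of_real field_simps\<close>)
  have "(\<integral>z. z powi k \<partial>circle) = (\<integral>t. cis t powi k \<partial>?U)"
    unfolding circle_def
    by (intro integral_distr cis_measurable_circle)
      (use borel_measurable_powi[of k] in \<open>simp cong: measurable_cong_sets add: sets_circle\<close>)
  also have "\<dots> = (\<integral>t. (indicator {0..<2 * pi} t / (2 * pi)) *\<^sub>R cis (of_int k * t) \<partial>lborel)"
    unfolding U by (subst integral_density) (auto simp: cis_power_int intro!: borel_measurable_continuous_onI continuous_intros)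
  also have "\<dots> = (1 / (2 * pi)) *\<^sub>R (\<integral>t. indicator {0..<2 * pi} t *\<^sub>R cis (of_int k * t) \<partial>lborel)"
    by (subst integral_scaleR_right[symmetric]) (auto simp: scaleR_scaleR)
  \<comment> \<open>The fundamental theorem of calculus is applied on the closed interval; the added
    endpoint is a null set.\<close>
  also have "(\<integral>t. indicator {0..<2 * pi} t *\<^sub>R cis (of_int k * t) \<partial>lborel)
      = (\<integral>t. indicator {0..2 * pi} t *\<^sub>R cis (of_int k * t) \<partial>lborel)"
  proof (rule integral_cong_AE)
    have "AE t in lborel. t \<noteq> 2 * pi"
      by (rule AE_lborel_singleton)
    then show "AE t in lborel. indicator {0..<2 * pi} t *\<^sub>R cis (of_int k * t)
        = indicator {0..2 * pi} t *\<^sub>R cis (of_int k * t)"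
      by eventually_elim (auto simp: indicator_def)
  qed (auto intro!: borel_measurable_scaleR borel_measurable_indicator
      borel_measurable_continuous_onI[of "\<lambda>t. cis (of_int k * t)"] continuous_intros)
  also have "\<dots> = cis (of_int k * (2 * pi)) / (of_int k * \<i>) - cis (of_int k * 0) / (of_int k * \<i>)"
    by (intro integral_FTC_atLeastAtMost deriv continuous_intros) auto
  also have "cis (of_int k * (2 * pi)) = 1"
    by (metis cis_multiple_2pi Ints_of_int mult.commute)
  finally show ?thesis
    using False by simp
qed (use circle.prob_space in simp)

subsection \<open>Fourier coefficients\<close>

lemma Linf_measurable [measurable_dest]: "f \<in> Linf \<Longrightarrow> f \<in> borel_measurable circle"
  by (simp add: Linf_def)

lemma AE_norm_le_Linf_norm: "Linf_norm f = ereal B \<Longrightarrow> AE z in circle. norm (f z) \<le> B"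
  using esssup_AE[of "\<lambda>z. ereal (norm (f z))" circle] by (simp add: Linf_norm_def)

lemma LinfE:
  assumes "f \<in> Linf"
  obtains B where "B > 0" "AE z in circle. norm (f z) \<le> B"
proof -
  have "AE z in circle. ereal (norm (f z)) \<le> Linf_norm f"
    unfolding Linf_norm_def by (rule esssup_AE)
  \<comment> \<open>The maximum with 1 makes the bound strictly positive, which the product of two
    bounds relies on.\<close>
  moreover have "Linf_norm f \<le> ereal (max 1 (real_of_ereal (Linf_norm f)))"
    using assms by (cases "Linf_norm f") (auto simp: Linf_def)
  ultimately have "AE z in circle. norm (f z) \<le> max 1 (real_of_ereal (Linf_norm f))"
    by (auto elim!: eventually_mono simp flip: ereal_less_eq(3) intro: order_trans)
  then show thesis
    by (rule that[rotated]) simp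
qed

lemma LinfI:
  assumes "f \<in> borel_measurable circle" "AE z in circle. norm (f z) \<le> B"
  shows "f \<in> Linf"
proof -
  have "Linf_norm f \<le> ereal B"
    unfolding Linf_norm_def using assms by (intro esssup_I) auto
  then show ?thesis
    using assms(1) by (auto simp: Linf_def)
qed

lemma Linf_mult: "f \<in> Linf \<Longrightarrow> g \<in> Linf \<Longrightarrow> (\<lambda>z. f z * g z) \<in> Linf"
proof -
  assume fg: "f \<in> Linf" "g \<in> Linf"
  obtain B where B: "B > 0" "AE z in circle. norm (f z) \<le> B" using fg(1) by (rule LinfE)
  obtain C where C: "C > 0" "AE z in circle. norm (g z) \<le> C" using fg(2) by (rule LinfE)
  show ?thesis
  proof (rule LinfI)
    show "AE z in circle. norm (f z * g z) \<le> B * C"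
      using B(2) C(2) by eventually_elim (use B(1) C(1) in \<open>auto simp: norm_mult intro: mult_mono\<close>)
  qed (use fg in measurable)
qed

lemma Linf_add: "f \<in> Linf \<Longrightarrow> g \<in> Linf \<Longrightarrow> (\<lambda>z. f z + g z) \<in> Linf"
proof -
  assume fg: "f \<in> Linf" "g \<in> Linf"
  obtain B where B: "AE z in circle. norm (f z) \<le> B" using fg(1) by (rule LinfE)
  obtain C where C: "AE z in circle. norm (g z) \<le> C" using fg(2) by (rule LinfE)
  show ?thesis
  proof (rule LinfI)
    show "AE z in circle. norm (f z + g z) \<le> B + C"
      using B C by eventually_elim (auto intro: norm_triangle_mono)
  qed (use fg in measurable)
qed

lemma Linf_const: "(\<lambda>_. c) \<in> Linf"
  by (rule LinfI[where B = "norm c"]) auto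

lemma Linf_diff: "f \<in> Linf \<Longrightarrow> g \<in> Linf \<Longrightarrow> (\<lambda>z. f z - g z) \<in> Linf"
  using Linf_add[of f "\<lambda>z. (-1) * g z"] Linf_mult[OF Linf_const[of "-1"]] by simp

lemma Linf_sum: "(\<And>i. i \<in> I \<Longrightarrow> f i \<in> Linf) \<Longrightarrow> (\<lambda>z. \<Sum>i\<in>I. f i z) \<in> Linf"
  by (induction I rule: infinite_finite_induct) (auto intro: Linf_add Linf_const)

lemma Linf_powi: "(\<lambda>z. z powi k) \<in> Linf"
  by (rule LinfI[where B = 1]) (auto intro!: AE_I2 simp: norm_powi_circle)

lemma Linf_poly: "(\<lambda>z. poly p z) \<in> Linf"
  unfolding poly_altdef using Linf_sum[of "{..degree p}" "\<lambda>i z. coeff p i * z ^ i"]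
    Linf_mult[OF Linf_const Linf_powi[of "int i" for i]] by simp

lemma Linf_cnj: "f \<in> Linf \<Longrightarrow> (\<lambda>z. cnj (f z)) \<in> Linf"
proof -
  assume f: "f \<in> Linf"
  obtain B where "AE z in circle. norm (f z) \<le> B" using f by (rule LinfE)
  then show ?thesis
    by (intro LinfI[where B = B])
      (use f in \<open>auto intro!: measurable_compose[OF _ borel_measurable_continuous_onI[of cnj]] continuous_intros\<close>)
qed

lemma Linf_integrable: "f \<in> Linf \<Longrightarrow> integrable circle f"
proof -
  assume f: "f \<in> Linf"
  obtain B where "AE z in circle. norm (f z) \<le> B" using f by (rule LinfE)
  then show ?thesis
    using f by (intro circle.integrable_const_bound[of _ B]) auto
qed

text \<open>The exponents \<open>e\<close> stay arbitrary because two kinds of series occur: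
  \<open>int\<close> gives functions analytic in the disc, \<open>\<lambda>u. - int u - 1\<close>
  gives strictly proper ones.\<close>

lemma Linf_series:
  assumes "summable (\<lambda>s. norm (a s))"
  shows "(\<lambda>z. \<Sum>s. a s * z powi e s) \<in> Linf"
proof (rule LinfI)
  have "norm (\<Sum>s. a s * z powi e s) \<le> (\<Sum>s. norm (a s))" if "norm z = 1" for z
    using summable_norm[of "\<lambda>s. a s * z powi e s"] assms that
    by (simp add: norm_mult norm_powi_circle)
  then show "AE z in circle. norm (\<Sum>s. a s * z powi e s) \<le> (\<Sum>s. norm (a s))"
    by (intro AE_I2) auto
qed measurable

text \<open>Powers have modulus 1 on the circle, so the terms are dominated by a bound of
  \<open>f\<close> times \<open>norm (a s)\<close>, and sum and integral may be exchanged.\<close>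

lemma integral_mult_series_sums:
  assumes f: "f \<in> Linf" and a: "summable (\<lambda>s. norm (a s))"
  shows "(\<lambda>s. a s * (\<integral>z. f z * z powi e s \<partial>circle)) sums (\<integral>z. f z * (\<Sum>s. a s * z powi e s) \<partial>circle)"
proof -
  let ?g = "\<lambda>s z. f z * (a s * z powi e s)"
  have int: "integrable circle (?g s)" for s
    by (intro Linf_integrable Linf_mult f Linf_const Linf_powi)
  obtain B where B: "B > 0" "AE z in circle. norm (f z) \<le> B" using f by (rule LinfE)
  have sum: "summable (\<lambda>s. norm (?g s z))" if "norm z = 1" for z
    using that a by (auto simp: norm_mult norm_powi_circle intro: summable_mult)
  have bound: "norm (\<integral>z. norm (?g s z) \<partial>circle) \<le> B * norm (a s)" for s
  proof -
    have "(\<integral>z. norm (?g s z) \<partial>circle) \<le> (\<integral>z. B * norm (a s) \<partial>circle)"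
    proof (rule integral_mono_AE)
      show "AE z in circle. norm (?g s z) \<le> B * norm (a s)"
        using B(2) AE_space
        by eventually_elim (auto simp: norm_mult norm_powi_circle intro: mult_right_mono)
    qed (use int in auto)
    then show ?thesis
      using circle.prob_space by simp
  qed
  have "(\<lambda>s. integral\<^sup>L circle (?g s)) sums (\<integral>z. (\<Sum>s. ?g s z) \<partial>circle)"
  proof (rule sums_integral)
    show "AE z in circle. summable (\<lambda>s. norm (?g s z))"
      using sum by (intro AE_I2) auto
    show "summable (\<lambda>s. \<integral>z. norm (?g s z) \<partial>circle)"
      by (rule summable_comparison_test[OF _ summable_mult[OF a, of B]]) (use bound in auto)
  qed (rule int)
  also have "(\<integral>z. (\<Sum>s. ?g s z) \<partial>circle) = (\<integral>z. f z * (\<Sum>s. a s * z powi e s) \<partial>circle)"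
  proof (rule Bochner_Integration.integral_cong)
    fix z assume "z \<in> space circle"
    then have "summable (\<lambda>s. a s * z powi e s)"
      using a by (intro summable_norm_cancel[of "\<lambda>s. a s * z powi e s"]) (auto simp: norm_mult norm_powi_circle)
    then show "(\<Sum>s. ?g s z) = f z * (\<Sum>s. a s * z powi e s)"
      by (rule suminf_mult)
  qed simp
  also have "(\<lambda>s. integral\<^sup>L circle (?g s)) = (\<lambda>s. a s * (\<integral>z. f z * z powi e s \<partial>circle))"
    by (subst integral_mult_right_zero[symmetric]) (simp add: mult_ac)
  finally show ?thesis .
qed

lemma fourier_coeff_add:
  "f \<in> Linf \<Longrightarrow> g \<in> Linf \<Longrightarrow> fourier_coeff (\<lambda>z. f z + g z) m = fourier_coeff f m + fourier_coeff g m"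
  unfolding fourier_coeff_def ring_distribs
  by (intro Bochner_Integration.integral_add Linf_integrable Linf_mult Linf_powi)

lemma fourier_coeff_diff:
  "f \<in> Linf \<Longrightarrow> g \<in> Linf \<Longrightarrow> fourier_coeff (\<lambda>z. f z - g z) m = fourier_coeff f m - fourier_coeff g m"
  unfolding fourier_coeff_def ring_distribs
  by (intro Bochner_Integration.integral_diff Linf_integrable Linf_mult Linf_powi)

lemma fourier_coeff_cmult: "fourier_coeff (\<lambda>z. c * f z) m = c * fourier_coeff f m"
  unfolding fourier_coeff_def by (simp add: mult.assoc)

lemma fourier_coeff_sum:
  "(\<And>i. i \<in> I \<Longrightarrow> f i \<in> Linf) \<Longrightarrow>
    fourier_coeff (\<lambda>z. \<Sum>i\<in>I. f i z) m = (\<Sum>i\<in>I. fourier_coeff (f i) m)"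
  unfolding fourier_coeff_def sum_distrib_right
  by (intro Bochner_Integration.integral_sum Linf_integrable Linf_mult Linf_powi)

lemma fourier_coeff_cong_AE:
  assumes "f \<in> Linf" "g \<in> Linf" "AE z in circle. f z = g z"
  shows "fourier_coeff f m = fourier_coeff g m"
  unfolding fourier_coeff_def
  by (rule integral_cong_AE) (use assms in \<open>auto elim: eventually_mono\<close>)

lemma fourier_coeff_mult_powi:
  "fourier_coeff (\<lambda>z. f z * z powi k) m = fourier_coeff f (m - k)"
  unfolding fourier_coeff_def
proof (rule Bochner_Integration.integral_cong)
  fix z assume "z \<in> space circle"
  then have "z \<noteq> 0" by auto
  then show "f z * z powi k * z powi (- m) = f z * z powi (- (m - k))"
    by (simp add: mult.assoc flip: power_int_add)
qed simp

lemma fourier_coeff_mult_poly: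
  assumes "f \<in> Linf"
  shows "fourier_coeff (\<lambda>z. poly p z * f z) m = (\<Sum>i\<le>degree p. coeff p i * fourier_coeff f (m - int i))"
proof -
  have "fourier_coeff (\<lambda>z. poly p z * f z) m
      = fourier_coeff (\<lambda>z. \<Sum>i\<le>degree p. coeff p i * (f z * z powi int i)) m"
    by (simp add: poly_altdef sum_distrib_left sum_distrib_right mult_ac)
  also have "\<dots> = (\<Sum>i\<le>degree p. coeff p i * fourier_coeff f (m - int i))"
    by (subst fourier_coeff_sum) (intro Linf_mult Linf_const Linf_powi assms,
        simp add: fourier_coeff_cmult fourier_coeff_mult_powi del: power_int_of_nat)
  finally show ?thesis .
qed

text \<open>With \<open>e = int\<close> and \<open>m = - int u - 1\<close> the series on the left is
  row \<open>u\<close> of the Hankel matrix of \<open>f\<close> applied to the sequence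
  \<open>a\<close>.\<close>

lemma fourier_coeff_mult_series:
  assumes "f \<in> Linf" "summable (\<lambda>s. norm (a s))"
  shows "(\<lambda>s. a s * fourier_coeff f (m - e s)) sums fourier_coeff (\<lambda>z. f z * (\<Sum>s. a s * z powi e s)) m"
proof -
  have "(\<lambda>s. a s * (\<integral>z. (f z * z powi (- m)) * z powi e s \<partial>circle)) sums
     (\<integral>z. (f z * z powi (- m)) * (\<Sum>s. a s * z powi e s) \<partial>circle)"
    by (intro integral_mult_series_sums Linf_mult Linf_powi assms)
  moreover have "(\<integral>z. (f z * z powi (- m)) * z powi e s \<partial>circle) = fourier_coeff f (m - e s)" for s
    by (subst fourier_coeff_mult_powi[symmetric]) (simp add: fourier_coeff_def mult_ac)
  ultimately show ?thesis
    by (simp add: fourier_coeff_def mult_ac)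
qed

lemma fourier_coeff_one: "fourier_coeff (\<lambda>z. 1) m = (if m = 0 then 1 else 0)"
  using integral_circle_powi[of "-m"] by (simp add: fourier_coeff_def)

lemma fourier_coeff_series:
  assumes "summable (\<lambda>s. norm (a s))" "inj e"
  shows "fourier_coeff (\<lambda>z. \<Sum>s. a s * z powi e s) (e t) = a t"
    "m \<notin> range e \<Longrightarrow> fourier_coeff (\<lambda>z. \<Sum>s. a s * z powi e s) m = 0"
proof -
  have *: "(\<lambda>s. a s * (if m - e s = 0 then 1 else 0)) sums fourier_coeff (\<lambda>z. \<Sum>s. a s * z powi e s) m" for m
    using fourier_coeff_mult_series[OF Linf_const[of 1] assms(1), of m e] by (simp add: fourier_coeff_one)
  have "(\<lambda>s. a s * (if e t - e s = 0 then 1 else 0)) = (\<lambda>s. if s = t then a s else 0)"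
    using assms(2) by (auto simp: fun_eq_iff inj_eq)
  then show "fourier_coeff (\<lambda>z. \<Sum>s. a s * z powi e s) (e t) = a t"
    using *[of "e t"] sums_unique2[OF sums_single[of t a]] by simp
  assume "m \<notin> range e"
  then have "(\<lambda>s. a s * (if m - e s = 0 then 1 else 0)) = (\<lambda>s. 0)"
    by (auto simp: fun_eq_iff)
  then show "fourier_coeff (\<lambda>z. \<Sum>s. a s * z powi e s) m = 0"
    using *[of m] sums_unique2[OF sums_zero] by simp
qed

text \<open>A Parseval formula in which only one factor is a series and the other is merely bounded
  and measurable; the error times a series will be of this kind.\<close>

lemma integral_mult_cnj_series_sums:
  assumes "f \<in> Linf" "summable (\<lambda>s. norm (a s))"
  shows "(\<lambda>s. cnj (a s) * fourier_coeff f (e s)) sums (\<integral>z. f z * cnj (\<Sum>s. a s * z powi e s) \<partial>circle)"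
proof -
  have "(\<lambda>s. cnj (a s) * fourier_coeff f (0 - (- e s))) sums
      fourier_coeff (\<lambda>z. f z * (\<Sum>s. cnj (a s) * z powi (- e s))) 0"
    by (intro fourier_coeff_mult_series assms) (use assms in simp)
  also have "fourier_coeff (\<lambda>z. f z * (\<Sum>s. cnj (a s) * z powi (- e s))) 0
      = (\<integral>z. f z * cnj (\<Sum>s. a s * z powi e s) \<partial>circle)"
    unfolding fourier_coeff_def
  proof (rule Bochner_Integration.integral_cong)
    fix z assume "z \<in> space circle"
    then have z: "norm z = 1" by simp
    then have "cnj z = inverse z"
      by (intro inverse_unique[symmetric]) (metis complex_norm_square of_real_1 power_one)
    moreover have "summable (\<lambda>s. a s * z powi e s)"
      using assms(2) z by (intro summable_norm_cancel[of "\<lambda>s. a s * z powi e s"]) (auto simp: norm_mult norm_powi_circle)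
    then have "cnj (\<Sum>s. a s * z powi e s) = (\<Sum>s. cnj (a s * z powi e s))"
      by (subst sums_unique[OF iffD2[OF sums_cnj summable_sums]]) auto
    ultimately show "f z * (\<Sum>s. cnj (a s) * z powi - e s) * z powi - 0 = f z * cnj (\<Sum>s. a s * z powi e s)"
      by (simp add: complex_cnj_power_int power_int_inverse power_int_minus)
  qed simp
  finally show ?thesis by simp
qed

text \<open>Gaussian elimination: if the last equation has a nonzero coefficient at
  \<open>p\<close>, the unknown \<open>c p\<close> is eliminated from the others, which leaves
  \<open>k\<close> equations in at least \<open>k + 1\<close> unknowns. It serves both for the
  combination of singular vectors that is annihilated and for a linear relation between powers of a
  matrix.\<close>

lemma underdetermined_system:
  fixes L :: "nat \<Rightarrow> 'i \<Rightarrow> 'a :: field"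
  assumes "finite I" "card I > k"
  shows "\<exists>c. (\<exists>i\<in>I. c i \<noteq> 0) \<and> (\<forall>u<k. (\<Sum>i\<in>I. L u i * c i) = 0)"
  using assms
proof (induction k arbitrary: I L)
  case 0
  then show ?case by (intro exI[of _ "\<lambda>_. 1"]) (auto simp: card_gt_0_iff)
next
  case (Suc k)
  show ?case
  proof (cases "\<forall>i\<in>I. L k i = 0")
    case True
    then show ?thesis
      using Suc.IH[of I L] Suc.prems by (auto simp: less_Suc_eq)
  next
    case False
    then obtain p where p: "p \<in> I" "L k p \<noteq> 0" by blast
    define J where "J = I - {p}"
    have J: "finite J" "card J > k" "I = insert p J" "p \<notin> J"
      using Suc.prems p by (auto simp: J_def)
    obtain c where c: "\<exists>i\<in>J. c i \<noteq> 0"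
        "\<forall>u<k. (\<Sum>i\<in>J. (L u i - L u p * L k i / L k p) * c i) = 0"
      using Suc.IH[OF J(1,2), of "\<lambda>u i. L u i - L u p * L k i / L k p"] by blast
    \<comment> \<open>The value at the pivot is the one that solves equation
      \<open>k\<close>.\<close>
    define c' where "c' = c(p := - (\<Sum>i\<in>J. L k i * c i) / L k p)"
    have sum: "(\<Sum>i\<in>I. L u i * c' i) = (\<Sum>i\<in>J. L u i * c i) - L u p * (\<Sum>i\<in>J. L k i * c i) / L k p" for u
    proof -
      have "(\<Sum>i\<in>I. L u i * c' i) = L u p * c' p + (\<Sum>i\<in>J. L u i * c' i)"
        using J by simp
      also have "(\<Sum>i\<in>J. L u i * c' i) = (\<Sum>i\<in>J. L u i * c i)"
        using J by (intro sum.cong) (auto simp: c'_def)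
      finally show ?thesis
        by (simp add: c'_def)
    qed
    have "(\<Sum>i\<in>I. L u i * c' i) = 0" if "u < Suc k" for u
    proof (cases "u = k")
      case True
      then show ?thesis using p by (simp add: sum)
    next
      case False
      with that have "u < k" by simp
      with c(2) have "(\<Sum>i\<in>J. (L u i - L u p * L k i / L k p) * c i) = 0" by blast
      then show ?thesis
        unfolding sum by (simp add: ring_distribs sum_subtractf sum_distrib_left sum_divide_distrib mult_ac)
    qed
    moreover have "\<exists>i\<in>I. c' i \<noteq> 0"
      using c(1) J by (auto simp: c'_def)
    ultimately show ?thesis by blast
  qed
qed

subsection \<open>Schmidt vectors and best approximation\<close>

text \<open>The columns of \<open>M\<close> are orthogonal with squared lengths \<open>d\<close>.
  The pairing is bilinear; conjugates, when wanted, are put into the coefficients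
  \<open>c\<close>.\<close>

lemma sums_gram:
  fixes c e :: "nat \<Rightarrow> complex" and M :: "nat \<Rightarrow> nat \<Rightarrow> real"
  assumes "\<forall>i<n. \<forall>l<n. (\<lambda>s. M s i * M s l) sums (if i = l then d i else 0)"
  shows "(\<lambda>s. (\<Sum>i<n. c i * of_real (M s i)) * (\<Sum>l<n. e l * of_real (M s l))) sums
    (\<Sum>i<n. c i * e i * of_real (d i))"
proof -
  have "(\<lambda>s. \<Sum>i<n. \<Sum>l<n. c i * e l * of_real (M s i * M s l)) sums
      (\<Sum>i<n. \<Sum>l<n. c i * e l * of_real (if i = l then d i else 0))"
    using assms by (intro sums_sum sums_mult sums_of_real) auto
  also have "(\<Sum>i<n. \<Sum>l<n. c i * e l * of_real (if i = l then d i else 0)) = (\<Sum>i<n. c i * e i * of_real (d i))"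
    by (intro sum.cong refl) (simp add: if_distrib[of of_real] if_distrib[of "\<lambda>x. _ * x"] cong: if_cong)
  finally show ?thesis
    by (simp add: sum_product mult_ac)
qed

text \<open>Kronecker's theorem in the form of a recurrence: multiplied by the denominator,
  \<open>g * W\<close> becomes a polynomial times \<open>W\<close> and has no negative Fourier
  coefficients. Hence the coefficients of \<open>g * W\<close> at negative indices obey a linear
  recurrence of order \<open>degree q \<le> k\<close>, and \<open>k\<close> initial zeros
  propagate.\<close>

lemma fourier_coeff_rational_mult_eq_0:
  assumes g: "g \<in> rational_rank k" and W: "W \<in> Linf" "\<And>m. m < 0 \<Longrightarrow> fourier_coeff W m = 0"
    and init: "\<And>u. u < k \<Longrightarrow> fourier_coeff (\<lambda>z. g z * W z) (- int u - 1) = 0"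
  shows "fourier_coeff (\<lambda>z. g z * W z) (- int u - 1) = 0"
proof -
  obtain p q where q: "q \<noteq> 0" and deg: "max (degree p) (degree q) = k"
      and pq: "AE z in circle. g z = poly p z / poly q z"
    using g unfolding rational_rank_def by blast
  have gL: "g \<in> Linf"
    using g by (simp add: rational_rank_def Hinf_minus_def)
  have rec: "(\<Sum>i\<le>degree q. coeff q i * fourier_coeff (\<lambda>z. g z * W z) (m - int i)) = 0" if "m < 0" for m
  proof -
    have "AE z in circle. poly q z * (g z * W z) = poly p z * W z"
      using AE_circle_notin_finite[OF poly_roots_finite[OF q]] pq
      by eventually_elim auto
    then have "fourier_coeff (\<lambda>z. poly q z * (g z * W z)) m = fourier_coeff (\<lambda>z. poly p z * W z) m"
      by (intro fourier_coeff_cong_AE Linf_mult Linf_poly gL W)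
    moreover have "fourier_coeff (\<lambda>z. poly p z * W z) m = 0"
      using that by (subst fourier_coeff_mult_poly) (auto intro!: W sum.neutral)
    ultimately show ?thesis
      by (subst (asm) fourier_coeff_mult_poly) (auto intro: Linf_mult gL W)
  qed
  show ?thesis
  proof (induction u rule: less_induct)
    case (less u)
    show ?case
    proof (cases "u < k")
      case False
      define e where "e = degree q"
      have e: "e \<le> u" using False deg by (simp add: e_def)
      \<comment> \<open>The index is chosen so that the leading coefficient of \<open>q\<close>
        meets the new coefficient at \<open>- int u - 1\<close>; all other terms vanish by
        induction.\<close>
      have "0 = (\<Sum>i\<le>e. coeff q i * fourier_coeff (\<lambda>z. g z * W z) ((- int (u - e) - 1) - int i))"
        using rec[of "- int (u - e) - 1"] by (simp add: e_def)
      also have "\<dots> = (\<Sum>i\<in>{e}. coeff q i * fourier_coeff (\<lambda>z. g z * W z) ((- int (u - e) - 1) - int i))"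
      proof (rule sum.mono_neutral_right)
        show "\<forall>i\<in>{..e} - {e}. coeff q i * fourier_coeff (\<lambda>z. g z * W z) (- int (u - e) - 1 - int i) = 0"
        proof
          fix i assume "i \<in> {..e} - {e}"
          then have "u - e + i < u" "- int (u - e) - 1 - int i = - int (u - e + i) - 1"
            using e by auto
          then show "coeff q i * fourier_coeff (\<lambda>z. g z * W z) (- int (u - e) - 1 - int i) = 0"
            using less.IH by (metis mult_zero_right)
        qed
      qed auto
      also have "\<dots> = coeff q e * fourier_coeff (\<lambda>z. g z * W z) (- int u - 1)"
      proof -
        have "- int (u - e) - 1 - int e = - int u - 1" using e by simp
        then show ?thesis by simp
      qed
      finally show ?thesis
        using q by (simp add: e_def)
    qed (rule init)
  qed
qed

text \<open>The uniqueness argument of Adamyan, Arov and Krein: the strictly proper part of a function in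
  \<open>Hinf_k k\<close> has a Hankel matrix of rank at most \<open>k\<close>, so this matrix annihilates some combination
  of \<open>k + 1\<close> given singular vectors. On this combination the Hankel operators of \<open>\<phi>\<close> and of
  \<open>\<phi> - \<psi>\<close> agree, and all the norm inequalities between them become equalities.\<close>

lemma best_approximation_Schmidt_pair:
  fixes F B :: "nat \<Rightarrow> nat \<Rightarrow> real" and d :: "nat \<Rightarrow> real"
  assumes phi: "\<phi> \<in> Linf"
    and hankel: "\<And>u s. fourier_coeff \<phi> (- int u - int s - 1) = of_real (\<Sum>l<n. F u l * B s l)"
    and F: "\<forall>i<n. \<forall>l<n. (\<lambda>s. F s i * F s l) sums (if i = l then d i else 0)"
      "\<And>i. i < n \<Longrightarrow> summable (\<lambda>s. \<bar>F s i\<bar>)"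
    and B: "\<forall>i<n. \<forall>l<n. (\<lambda>s. B s i * B s l) sums (if i = l then d i else 0)"
      "\<And>i. i < n \<Longrightarrow> summable (\<lambda>s. \<bar>B s i\<bar>)"
    and pos: "\<And>i. i < n \<Longrightarrow> d i > 0"
    and psi: "\<psi> \<in> Hinf_k k" "Linf_norm (\<lambda>z. \<phi> z - \<psi> z) = ereal \<sigma>"
    and card: "k \<le> card {i. i < n \<and> d i > \<sigma>}"
    and i0: "i0 < n" "d i0 = \<sigma>"
  shows "AE z in circle. (\<phi> z - \<psi> z) * (\<Sum>s. of_real (B s i0) * z powi int s)
    = of_real \<sigma> * (\<Sum>u. of_real (F u i0) * z powi (- int u - 1))"
proof -
  have psiL: "\<psi> \<in> Linf"
    using psi(1) by (simp add: Hinf_k_def)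
  obtain g l where g: "g \<in> rational_rank k" and l: "l \<in> Hinf"
      and psi_eq: "AE z in circle. \<psi> z = g z + l z"
    using psi(1) by (auto simp: Hinf_k_def)
  have gL: "g \<in> Linf" and lL: "l \<in> Linf" and l0: "\<And>m. m < 0 \<Longrightarrow> fourier_coeff l m = 0"
    using g l by (simp_all add: rational_rank_def Hinf_minus_def Hinf_def)
  have \<sigma>: "\<sigma> > 0"
    using pos i0 by auto
  define I where "I = insert i0 {i. i < n \<and> d i > \<sigma>}"
  have I: "finite I" "card I > k" "I \<subseteq> {..<n}" "\<And>i. i \<in> I \<Longrightarrow> d i \<ge> \<sigma>"
    using card i0 by (auto simp: I_def card_insert_if)
  define L where "L = (\<lambda>u i. fourier_coeff (\<lambda>z. g z * (\<Sum>s. of_real (B s i) * z powi int s)) (- int u - 1))"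
  obtain c0 where c0: "\<exists>i\<in>I. c0 i \<noteq> 0" "\<forall>u<k. (\<Sum>i\<in>I. L u i * c0 i) = 0"
    using underdetermined_system[OF I(1,2), of L] by blast
  define c where "c = (\<lambda>i. if i \<in> I then c0 i else 0)"
  define w where "w = (\<lambda>s. \<Sum>i<n. c i * of_real (B s i))"
  \<comment> \<open>The Hankel matrix applied to \<open>w\<close> gives \<open>y\<close>, since the
    columns of \<open>B\<close> have squared lengths \<open>d\<close>. \<open>W\<close> and
    \<open>Y\<close> are the corresponding functions, \<open>W\<close> with nonnegative and
    \<open>Y\<close> with negative frequencies.\<close>
  define y where "y = (\<lambda>u. \<Sum>i<n. c i * of_real (d i) * of_real (F u i))"
  define W where "W = (\<lambda>z. \<Sum>s. w s * z powi int s)"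
  define Y where "Y = (\<lambda>z. \<Sum>u. y u * z powi (- int u - 1))"
  have sum_w: "summable (\<lambda>s. norm (w s))"
  proof (rule summable_comparison_test)
    show "summable (\<lambda>s. \<Sum>i<n. norm (c i) * \<bar>B s i\<bar>)"
      by (intro summable_sum summable_mult B(2)) auto
  qed (auto simp: w_def norm_mult intro!: exI[of _ 0] order_trans[OF norm_sum])
  have sum_y: "summable (\<lambda>s. norm (y s))"
  proof (rule summable_comparison_test)
    show "summable (\<lambda>s. \<Sum>i<n. norm (c i * of_real (d i)) * \<bar>F s i\<bar>)"
      by (intro summable_sum summable_mult F(2)) auto
  qed (auto simp: y_def norm_mult intro!: exI[of _ 0] order_trans[OF norm_sum])
  have WL: "W \<in> Linf" and YL: "Y \<in> Linf"
    unfolding W_def Y_def by (intro Linf_series sum_w sum_y)+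
  have inj: "inj int" "inj (\<lambda>u. - int u - 1)"
    by (auto simp: inj_def)
  have W0: "fourier_coeff W m = 0" if "m < 0" for m
    unfolding W_def using that by (intro fourier_coeff_series(2) sum_w inj) auto
  have FW: "fourier_coeff W (int s) = w s" for s
    unfolding W_def by (rule fourier_coeff_series(1)[OF sum_w inj(1)])
  have FY: "fourier_coeff Y (- int u - 1) = y u" for u
    unfolding Y_def by (rule fourier_coeff_series(1)[OF sum_y inj(2)])
  have gW: "fourier_coeff (\<lambda>z. g z * W z) (- int u - 1) = 0" for u
  proof (rule fourier_coeff_rational_mult_eq_0[OF g WL W0])
    fix u assume u: "u < k"
    let ?m = "- int u - 1"
    have "(\<lambda>s. \<Sum>i<n. c i * (of_real (B s i) * fourier_coeff g (?m - int s))) sums (\<Sum>i<n. c i * L u i)"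
      unfolding L_def using B(2) by (intro sums_sum sums_mult fourier_coeff_mult_series gL) auto
    then have "(\<lambda>s. w s * fourier_coeff g (?m - int s)) sums (\<Sum>i<n. c i * L u i)"
      by (simp add: w_def sum_distrib_left mult_ac)
    moreover have "(\<lambda>s. w s * fourier_coeff g (?m - int s)) sums fourier_coeff (\<lambda>z. g z * W z) ?m"
      unfolding W_def by (intro fourier_coeff_mult_series gL sum_w)
    ultimately have "fourier_coeff (\<lambda>z. g z * W z) ?m = (\<Sum>i<n. c i * L u i)"
      by (rule sums_unique2[symmetric])
    also have "\<dots> = (\<Sum>i\<in>I. L u i * c0 i)"
      using I(3) by (intro sum.mono_neutral_cong_right) (auto simp: c_def)
    finally show "fourier_coeff (\<lambda>z. g z * W z) ?m = 0"
      using c0(2) u by simp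
  qed auto
  have lW: "fourier_coeff (\<lambda>z. l z * W z) (- int u - 1) = 0" for u
  proof -
    have "(\<lambda>s. w s * fourier_coeff l ((- int u - 1) - int s)) sums fourier_coeff (\<lambda>z. l z * W z) (- int u - 1)"
      unfolding W_def by (intro fourier_coeff_mult_series lL sum_w)
    then have "(\<lambda>s. 0) sums fourier_coeff (\<lambda>z. l z * W z) (- int u - 1)"
      by (simp add: l0)
    then show ?thesis
      by (rule sums_unique2[OF _ sums_zero])
  qed
  have phiW: "fourier_coeff (\<lambda>z. \<phi> z * W z) (- int u - 1) = y u" for u
  proof -
    have "(\<lambda>s. w s * fourier_coeff \<phi> ((- int u - 1) - int s)) sums fourier_coeff (\<lambda>z. \<phi> z * W z) (- int u - 1)"
      unfolding W_def by (intro fourier_coeff_mult_series phi sum_w)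
    moreover have "fourier_coeff \<phi> ((- int u - 1) - int s) = (\<Sum>l<n. of_real (F u l) * of_real (B s l))" for s
      using hankel[of u s] by (simp add: algebra_simps)
    ultimately have "(\<lambda>s. w s * (\<Sum>l<n. of_real (F u l) * of_real (B s l))) sums
        fourier_coeff (\<lambda>z. \<phi> z * W z) (- int u - 1)"
      by simp
    then show ?thesis
      using sums_unique2[OF sums_gram[OF B(1), of c "\<lambda>l. of_real (F u l)"]]
      by (simp add: w_def y_def mult_ac)
  qed
  define h where "h = (\<lambda>z. \<phi> z - \<psi> z)"
  have hL: "h \<in> Linf"
    unfolding h_def by (intro Linf_diff phi psiL)
  have hW: "fourier_coeff (\<lambda>z. h z * W z) (- int u - 1) = y u" for u
  proof -
    have "fourier_coeff (\<lambda>z. h z * W z) (- int u - 1)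
        = fourier_coeff (\<lambda>z. \<phi> z * W z - (g z * W z + l z * W z)) (- int u - 1)"
    proof (rule fourier_coeff_cong_AE)
      show "AE z in circle. h z * W z = \<phi> z * W z - (g z * W z + l z * W z)"
        using psi_eq by eventually_elim (auto simp: h_def algebra_simps)
    qed (intro Linf_mult Linf_diff Linf_add phi hL WL gL lL)+
    also have "\<dots> = y u"
      by (simp add: fourier_coeff_diff fourier_coeff_add Linf_mult Linf_add phi WL gL lL phiW gW lW)
    finally show ?thesis .
  qed
  \<comment> \<open>The squared norms of \<open>Y\<close> and \<open>W\<close>. The columns of
    \<open>F\<close> and \<open>B\<close> already have squared length \<open>d i\<close>, hence the
    exponents 3 and 1.\<close>
  define Ny where "Ny = (\<Sum>i<n. (cmod (c i))\<^sup>2 * d i ^ 3)"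
  define Nw where "Nw = (\<Sum>i<n. (cmod (c i))\<^sup>2 * d i)"
  have norm_y: "(\<lambda>u. cnj (y u) * y u) sums of_real Ny"
  proof -
    have "(\<lambda>u. (\<Sum>i<n. (cnj (c i) * of_real (d i)) * of_real (F u i)) * (\<Sum>i<n. (c i * of_real (d i)) * of_real (F u i)))
        sums (\<Sum>i<n. (cnj (c i) * of_real (d i)) * (c i * of_real (d i)) * of_real (d i))"
      by (rule sums_gram[OF F(1)])
    also have "(\<Sum>i<n. (cnj (c i) * of_real (d i)) * (c i * of_real (d i)) * of_real (d i)) = of_real Ny"
      unfolding Ny_def of_real_sum
      by (intro sum.cong refl) (simp add: complex_norm_square power3_eq_cube mult_ac del: of_real_power)
    finally show ?thesis
      by (simp add: y_def)
  qed
  have norm_w: "(\<lambda>u. cnj (w u) * w u) sums of_real Nw"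
  proof -
    have "(\<lambda>u. (\<Sum>i<n. cnj (c i) * of_real (B u i)) * (\<Sum>i<n. c i * of_real (B u i)))
        sums (\<Sum>i<n. cnj (c i) * c i * of_real (d i))"
      by (rule sums_gram[OF B(1)])
    also have "(\<Sum>i<n. cnj (c i) * c i * of_real (d i)) = of_real Nw"
      unfolding Nw_def of_real_sum
      by (intro sum.cong refl) (simp add: complex_norm_square mult_ac del: of_real_power)
    finally show ?thesis
      by (simp add: w_def)
  qed
  have Wz: "(\<Sum>s. w s * z powi int s) = W z" and Yz: "(\<Sum>u. y u * z powi (- int u - 1)) = Y z" for z
    by (simp_all only: W_def Y_def)
  have int_WW: "(\<integral>z. W z * cnj (W z) \<partial>circle) = of_real Nw"
    by (rule sums_unique2[OF integral_mult_cnj_series_sums[OF WL sum_w, of int, unfolded Wz FW] norm_w])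
  have int_YY: "(\<integral>z. Y z * cnj (Y z) \<partial>circle) = of_real Ny"
    by (rule sums_unique2[OF integral_mult_cnj_series_sums[OF YL sum_y, of "\<lambda>u. - int u - 1", unfolded Yz FY] norm_y])
  have int_hWY: "(\<integral>z. (h z * W z) * cnj (Y z) \<partial>circle) = of_real Ny"
    by (rule sums_unique2[OF integral_mult_cnj_series_sums[OF Linf_mult[OF hL WL] sum_y, of "\<lambda>u. - int u - 1", unfolded Yz hW] norm_y])
  have iL: "integrable circle (\<lambda>z. Re (f z * cnj (f' z)))" if "f \<in> Linf" "f' \<in> Linf" for f f'
    by (intro integrable_Re Linf_integrable Linf_mult Linf_cnj that)
  have int_Re: "(\<integral>z. Re (f z * cnj (f' z)) \<partial>circle) = Re (\<integral>z. f z * cnj (f' z) \<partial>circle)"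
    if "f \<in> Linf" "f' \<in> Linf" for f f'
    by (intro integral_Re Linf_integrable Linf_mult Linf_cnj that)
  have hWL: "(\<lambda>z. h z * W z) \<in> Linf"
    by (intro Linf_mult hL WL)
  have nonneg: "(\<integral>z. (cmod (h z * W z - Y z))\<^sup>2 \<partial>circle) \<ge> 0"
    by simp
  \<comment> \<open>Since \<open>Y\<close> is the part of \<open>h * W\<close> with negative
    frequencies, the cross term equals the squared norm of \<open>Y\<close>. So the integral is the
    squared norm of \<open>h * W\<close> minus that of \<open>Y\<close>, hence at most
    \<open>\<sigma>\<^sup>2 * Nw - Ny\<close>, which is not positive.\<close>
  have "(\<integral>z. (cmod (h z * W z - Y z))\<^sup>2 \<partial>circle)
      = (\<integral>z. Re (h z * W z * cnj (h z * W z)) - 2 * Re (h z * W z * cnj (Y z)) + Re (Y z * cnj (Y z)) \<partial>circle)"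
    by (intro Bochner_Integration.integral_cong refl) (simp add: cmod_power2, simp add: power2_eq_square algebra_simps)
  also have "\<dots> = (\<integral>z. Re (h z * W z * cnj (h z * W z)) \<partial>circle)
      - 2 * (\<integral>z. Re (h z * W z * cnj (Y z)) \<partial>circle) + (\<integral>z. Re (Y z * cnj (Y z)) \<partial>circle)"
    by (simp only: Bochner_Integration.integral_add Bochner_Integration.integral_diff
        Bochner_Integration.integrable_diff integrable_mult_right iL[OF hWL hWL] iL[OF hWL YL] iL[OF YL YL]
        integral_mult_right_zero)
  also have "\<dots> = (\<integral>z. Re (h z * W z * cnj (h z * W z)) \<partial>circle) - Ny"
    by (simp add: int_Re[OF hWL YL] int_Re[OF YL YL] int_hWY int_YY del: times_complex.sel)
  finally have eq: "(\<integral>z. (cmod (h z * W z - Y z))\<^sup>2 \<partial>circle) = (\<integral>z. Re (h z * W z * cnj (h z * W z)) \<partial>circle) - Ny" .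
  have "(\<integral>z. Re (h z * W z * cnj (h z * W z)) \<partial>circle) \<le> (\<integral>z. \<sigma>\<^sup>2 * Re (W z * cnj (W z)) \<partial>circle)"
  proof (rule integral_mono_AE)
    have "AE z in circle. cmod (h z) \<le> \<sigma>"
      unfolding h_def by (rule AE_norm_le_Linf_norm[OF psi(2)])
    then show "AE z in circle. Re (h z * W z * cnj (h z * W z)) \<le> \<sigma>\<^sup>2 * Re (W z * cnj (W z))"
    proof eventually_elim
      case (elim z)
      have "Re (h z * W z * cnj (h z * W z)) = (cmod (h z))\<^sup>2 * (cmod (W z))\<^sup>2"
        by (metis Re_complex_of_real complex_norm_square norm_mult power_mult_distrib)
      also have "\<dots> \<le> \<sigma>\<^sup>2 * (cmod (W z))\<^sup>2"
        using elim by (intro mult_right_mono power_mono) auto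
      also have "(cmod (W z))\<^sup>2 = Re (W z * cnj (W z))"
        by (metis Re_complex_of_real complex_norm_square)
      finally show ?case .
    qed
  qed (intro iL hWL WL integrable_mult_right)+
  also have "\<dots> = \<sigma>\<^sup>2 * Nw"
    by (subst integral_mult_right_zero) (simp add: int_Re[OF WL WL] int_WW del: times_complex.sel)
  finally have "(\<integral>z. (cmod (h z * W z - Y z))\<^sup>2 \<partial>circle) \<le> \<sigma>\<^sup>2 * Nw - Ny"
    using eq by simp
  also have "\<sigma>\<^sup>2 * Nw - Ny = - (\<Sum>i<n. (cmod (c i))\<^sup>2 * d i * ((d i)\<^sup>2 - \<sigma>\<^sup>2))"
    unfolding Nw_def Ny_def
    by (simp add: sum_distrib_left power2_eq_square power3_eq_cube algebra_simps flip: sum_subtractf sum_negf)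
  finally have le: "(\<integral>z. (cmod (h z * W z - Y z))\<^sup>2 \<partial>circle) \<le> - (\<Sum>i<n. (cmod (c i))\<^sup>2 * d i * ((d i)\<^sup>2 - \<sigma>\<^sup>2))" .
  have term_nonneg: "(cmod (c i))\<^sup>2 * d i * ((d i)\<^sup>2 - \<sigma>\<^sup>2) \<ge> 0" if "i < n" for i
  proof (cases "i \<in> I")
    case True
    then have "\<sigma>\<^sup>2 \<le> (d i)\<^sup>2"
      using I(4) \<sigma> by (intro power_mono) auto
    then show ?thesis
      using pos[OF that] by simp
  qed (simp add: c_def)
  have sum0: "(\<Sum>i<n. (cmod (c i))\<^sup>2 * d i * ((d i)\<^sup>2 - \<sigma>\<^sup>2)) = 0"
  proof (rule antisym)
    show "(\<Sum>i<n. (cmod (c i))\<^sup>2 * d i * ((d i)\<^sup>2 - \<sigma>\<^sup>2)) \<ge> 0"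
      by (intro sum_nonneg) (use term_nonneg in auto)
  qed (use le nonneg in linarith)
  \<comment> \<open>Equality throughout leaves no room for an index with
    \<open>d i > \<sigma>\<close>: only \<open>i0\<close> remains in the combination, with a nonzero
    coefficient that cancels in the end.\<close>
  have c_zero: "c i = 0" if "i \<noteq> i0" for i
  proof (cases "i \<in> I")
    case True
    then have i: "i < n" "d i > \<sigma>"
      using that I(3) by (auto simp: I_def)
    have "(cmod (c i))\<^sup>2 * d i * ((d i)\<^sup>2 - \<sigma>\<^sup>2) = 0"
      using sum0 term_nonneg i(1) by (subst (asm) sum_nonneg_eq_0_iff) auto
    moreover have "(d i)\<^sup>2 > \<sigma>\<^sup>2"
      using i \<sigma> by (intro power_strict_mono) auto
    ultimately show ?thesis
      using pos[OF i(1)] by simp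
  qed (simp add: c_def)
  have c_i0: "c i0 \<noteq> 0"
    using c0(1) c_zero by (metis c_def)
  have "integrable circle (\<lambda>z. (cmod (h z * W z - Y z))\<^sup>2)"
  proof -
    have "(\<lambda>z. (cmod (h z * W z - Y z))\<^sup>2) = (\<lambda>z. Re ((h z * W z - Y z) * cnj (h z * W z - Y z)))"
      by (intro ext) (metis Re_complex_of_real complex_norm_square)
    then show ?thesis
      using iL[OF Linf_diff[OF hWL YL] Linf_diff[OF hWL YL]] by simp
  qed
  moreover have "(\<integral>z. (cmod (h z * W z - Y z))\<^sup>2 \<partial>circle) = 0"
    using le nonneg sum0 by simp
  ultimately have AE0: "AE z in circle. (cmod (h z * W z - Y z))\<^sup>2 = 0"
    by (subst (asm) integral_nonneg_eq_0_iff_AE) auto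
  have w_eq: "w s = c i0 * of_real (B s i0)" for s
    unfolding w_def using i0 c_zero by (subst sum.mono_neutral_right[of _ "{i0}"]) auto
  have y_eq: "y s = c i0 * (of_real \<sigma> * of_real (F s i0))" for s
    unfolding y_def using i0 c_zero by (subst sum.mono_neutral_right[of _ "{i0}"]) auto
  show ?thesis
    using AE0 AE_space
  proof eventually_elim
    case (elim z)
    then have z: "norm z = 1" by simp
    have sB: "summable (\<lambda>s. of_real (B s i0) * z powi int s)"
      by (rule summable_norm_cancel) (use B(2)[OF i0(1)] z in \<open>simp add: norm_mult norm_powi_circle del: power_int_of_nat\<close>)
    have sF: "summable (\<lambda>u. of_real (F u i0) * z powi (- int u - 1))"
      by (rule summable_norm_cancel) (use F(2)[OF i0(1)] z in \<open>simp add: norm_mult norm_powi_circle\<close>)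
    have "W z = c i0 * (\<Sum>s. of_real (B s i0) * z powi int s)"
      unfolding W_def w_eq mult.assoc by (rule suminf_mult[OF sB])
    moreover have "Y z = c i0 * (of_real \<sigma> * (\<Sum>u. of_real (F u i0) * z powi (- int u - 1)))"
      unfolding Y_def y_eq mult.assoc suminf_mult[OF summable_mult[OF sF]] suminf_mult[OF sF] ..
    moreover have "h z * W z = Y z"
      using elim(1) by simp
    ultimately show ?case
      using c_i0 by (simp add: h_def)
  qed
qed

subsection \<open>Rational functions on the circle\<close>

text \<open>Only values on the circle count, and poles on it are excluded. Complex conjugation of
  the argument is inversion there and therefore preserves the class.\<close>

definition circle_rational :: "(complex \<Rightarrow> complex) \<Rightarrow> bool" where
  "circle_rational f \<longleftrightarrow> (\<exists>p q. \<forall>z. norm z = 1 \<longrightarrow> poly q z \<noteq> 0 \<and> f z = poly p z / poly q z)"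

lemma circle_rationalI:
  "(\<And>z. norm z = 1 \<Longrightarrow> poly q z \<noteq> 0) \<Longrightarrow> (\<And>z. norm z = 1 \<Longrightarrow> f z = poly p z / poly q z) \<Longrightarrow> circle_rational f"
  unfolding circle_rational_def by blast

lemma circle_rational_const: "circle_rational (\<lambda>_. c)"
  by (rule circle_rationalI[of 1 _ "[:c:]"]) auto

lemma circle_rational_ident: "circle_rational (\<lambda>z. z)"
  by (rule circle_rationalI[of 1 _ "[:0, 1:]"]) auto

lemma circle_rational_diff: "circle_rational f \<Longrightarrow> circle_rational g \<Longrightarrow> circle_rational (\<lambda>z. f z - g z)"
proof -
  assume "circle_rational f" "circle_rational g"
  then obtain p q r s where "\<forall>z. norm z = 1 \<longrightarrow> poly q z \<noteq> 0 \<and> f z = poly p z / poly q z"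
      "\<forall>z. norm z = 1 \<longrightarrow> poly s z \<noteq> 0 \<and> g z = poly r z / poly s z"
    unfolding circle_rational_def by blast
  then show ?thesis
    by (intro circle_rationalI[of "q * s" _ "p * s - r * q"]) (auto simp: diff_frac_eq)
qed

lemma circle_rational_mult: "circle_rational f \<Longrightarrow> circle_rational g \<Longrightarrow> circle_rational (\<lambda>z. f z * g z)"
proof -
  assume "circle_rational f" "circle_rational g"
  then obtain p q r s where "\<forall>z. norm z = 1 \<longrightarrow> poly q z \<noteq> 0 \<and> f z = poly p z / poly q z"
      "\<forall>z. norm z = 1 \<longrightarrow> poly s z \<noteq> 0 \<and> g z = poly r z / poly s z"
    unfolding circle_rational_def by blast
  then show ?thesis
    by (intro circle_rationalI[of "q * s" _ "p * r"]) auto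
qed

lemma cnj_eq_inverse: "norm z = 1 \<Longrightarrow> cnj z = inverse z"
  by (intro inverse_unique[symmetric]) (metis complex_norm_square of_real_1 power_one)

lemma circle_mult_cnj: "norm z = 1 \<Longrightarrow> z * cnj z = 1"
  by (metis complex_norm_square of_real_1 power_one)

lemma circle_rational_cnj_arg: "circle_rational f \<Longrightarrow> circle_rational (\<lambda>z. f (cnj z))"
proof -
  assume "circle_rational f"
  then obtain p q where pq: "\<And>z. norm z = 1 \<Longrightarrow> poly q z \<noteq> 0 \<and> f z = poly p z / poly q z"
    unfolding circle_rational_def by blast
  show ?thesis
  \<comment> \<open>\<open>reflect_poly p\<close> at \<open>z\<close> is \<open>p\<close> at
    \<open>1/z\<close> times a power of \<open>z\<close>; the monomials make up for the two
    degrees.\<close>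
  proof (rule circle_rationalI[of "reflect_poly q * monom 1 (degree p)" _ "reflect_poly p * monom 1 (degree q)"])
    fix z :: complex assume z: "norm z = 1"
    then have "z \<noteq> 0" "norm (inverse z) = 1"
      by (auto simp: norm_inverse)
    then show "poly (reflect_poly q * monom 1 (degree p)) z \<noteq> 0"
        "f (cnj z) = poly (reflect_poly p * monom 1 (degree q)) z / poly (reflect_poly q * monom 1 (degree p)) z"
      using pq[of "inverse z"] z by (simp_all add: poly_reflect_poly_nz poly_monom cnj_eq_inverse)
  qed
qed

lemma circle_rational_eq_0:
  assumes f: "circle_rational f" and inf: "infinite {z \<in> sphere 0 1. f z = 0}" and z: "norm z = 1"
  shows "f z = 0"
proof -
  obtain p q where pq: "\<And>z. norm z = 1 \<Longrightarrow> poly q z \<noteq> 0 \<and> f z = poly p z / poly q z"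
    using f unfolding circle_rational_def by blast
  have "{z \<in> sphere 0 1. f z = 0} \<subseteq> {z. poly p z = 0}"
    using pq by auto
  then have "p = 0"
    using inf poly_roots_finite[of p] finite_subset by blast
  then show ?thesis
    using pq[OF z] by simp
qed

lemma infinite_circle_Diff: "finite F \<Longrightarrow> infinite (sphere (0::complex) 1 - F)"
  using AE_circle_imp_infinite[OF AE_circle_notin_finite, of F] by (simp add: set_diff_eq)

text \<open>There are no zero divisors: a function of the class that is nonzero at one point of the
  circle has only finitely many zeros there, so the other factor has infinitely many.\<close>

lemma circle_rational_mult_eq_0:
  assumes "circle_rational f" "circle_rational g" "\<And>z. norm z = 1 \<Longrightarrow> f z * g z = 0"
    and "norm z = 1" "g z \<noteq> 0" and w: "norm w = 1"
  shows "f w = 0"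
proof (rule circle_rational_eq_0[OF assms(1) _ w])
  have "finite {z \<in> sphere 0 1. g z = 0}"
    using circle_rational_eq_0[OF assms(2) _ assms(4)] assms(5) by blast
  then have "infinite (sphere 0 1 - {z \<in> sphere 0 1. g z = 0})"
    by (rule infinite_circle_Diff)
  then show "infinite {z \<in> sphere 0 1. f z = 0}"
    by (rule contrapos_nn) (erule finite_subset[rotated], use assms(3) in force)
qed

subsection \<open>Transfer functions on the circle\<close>

text \<open>The spectral condition contained in admissibility. It makes \<open>z 1 - M\<close>
  invertible on the circle without confining the eigenvalues to the disc.\<close>

definition circle_regular :: "real mat \<Rightarrow> bool" where
  "circle_regular M \<longleftrightarrow> (\<forall>z. eigenvalue (cmat M) z \<longrightarrow> cmod z \<noteq> 1)"

abbreviation tf :: "real vec \<Rightarrow> real mat \<Rightarrow> real vec \<Rightarrow> complex \<Rightarrow> complex" where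
  "tf a M x \<equiv> wfa_transfer (WFA a M x)"

lemma scalar_prod_cvec: "dim_vec a = dim_vec b \<Longrightarrow> cvec a \<bullet> cvec b = complex_of_real (a \<bullet> b)"
  by (simp add: scalar_prod_def)

lemma smult_one_mult_vec:
  "u \<in> carrier_vec m \<Longrightarrow> (c \<cdot>\<^sub>m 1\<^sub>m m) *\<^sub>v u = c \<cdot>\<^sub>v u" for c :: "'a :: comm_ring_1"
proof (rule eq_vecI)
  fix i assume u: "u \<in> carrier_vec m" and "i < dim_vec (c \<cdot>\<^sub>v u)"
  then have "i < m" by simp
  then have "row (c \<cdot>\<^sub>m 1\<^sub>m m) i = c \<cdot>\<^sub>v unit_vec m i"
    by (intro eq_vecI) auto
  with u \<open>i < m\<close> show "((c \<cdot>\<^sub>m 1\<^sub>m m) *\<^sub>v u) $ i = (c \<cdot>\<^sub>v u) $ i"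
    by simp
qed auto

lemma resolvent_mult_vec:
  assumes "M \<in> carrier_mat m m" "u \<in> carrier_vec m"
  shows "(z \<cdot>\<^sub>m 1\<^sub>m m - cmat M) *\<^sub>v u = z \<cdot>\<^sub>v u - cmat M *\<^sub>v u"
  using assms smult_one_mult_vec[OF assms(2), of z] by (subst minus_mult_distrib_mat_vec[of _ m m]) auto

lemma det_resolvent:
  assumes M: "M \<in> carrier_mat m m" and reg: "circle_regular M" and z: "norm z = 1"
  shows "det (z \<cdot>\<^sub>m 1\<^sub>m m - cmat M) \<noteq> 0"
proof
  have R: "z \<cdot>\<^sub>m 1\<^sub>m m - cmat M \<in> carrier_mat m m" using M by auto
  assume "det (z \<cdot>\<^sub>m 1\<^sub>m m - cmat M) = 0"
  then obtain v where v: "v \<in> carrier_vec m" "v \<noteq> 0\<^sub>v m" "(z \<cdot>\<^sub>m 1\<^sub>m m - cmat M) *\<^sub>v v = 0\<^sub>v m"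
    using det_0_iff_vec_prod_zero[OF R] by blast
  have eq: "z \<cdot>\<^sub>v v - cmat M *\<^sub>v v = 0\<^sub>v m"
    using v(3) by (simp add: resolvent_mult_vec[OF M v(1)])
  have "cmat M *\<^sub>v v = z \<cdot>\<^sub>v v"
  proof (rule eq_vecI)
    fix i assume "i < dim_vec (z \<cdot>\<^sub>v v)"
    then have "i < m" using v by simp
    then have "(z \<cdot>\<^sub>v v - cmat M *\<^sub>v v) $ i = z * v $ i - (cmat M *\<^sub>v v) $ i"
      using v(1) M by simp
    then show "(cmat M *\<^sub>v v) $ i = (z \<cdot>\<^sub>v v) $ i"
      using \<open>i < m\<close> v(1) unfolding eq by simp
  qed (use M v in auto)
  then have "eigenvalue (cmat M) z"
    using v M by (auto simp: eigenvalue_def eigenvector_def)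
  then show False
    using reg z by (auto simp: circle_regular_def)
qed

lemma resolvent_eq_iff:
  assumes "M \<in> carrier_mat m m" "u \<in> carrier_vec m" "x \<in> carrier_vec m"
  shows "(z \<cdot>\<^sub>m 1\<^sub>m m - cmat M) *\<^sub>v u = cvec x \<longleftrightarrow>
    (\<forall>i<m. z * u $ i - (cmat M *\<^sub>v u) $ i = of_real (x $ i))"
  unfolding resolvent_mult_vec[OF assms(1,2)] using assms
  by (subst vec_eq_iff) (auto simp del: index_mult_mat_vec)

text \<open>Together with \<open>tf_eqI\<close> this replaces the inverse in
  \<open>wfa_transfer\<close> by a vector \<open>u\<close> with \<open>(z 1 - M) u = x\<close>,
  written in coordinates. Further identities between transfer functions come from exhibiting such
  solutions.\<close>

lemma tf_solution:
  assumes M: "M \<in> carrier_mat m m" and reg: "circle_regular M" and z: "norm z = 1"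
    and a: "a \<in> carrier_vec m" and x: "x \<in> carrier_vec m"
  obtains u where "u \<in> carrier_vec m"
    "\<forall>i<m. z * u $ i - (cmat M *\<^sub>v u) $ i = of_real (x $ i)" "tf a M x z = cvec a \<bullet> u"
proof -
  let ?R = "z \<cdot>\<^sub>m 1\<^sub>m m - cmat M"
  have R: "?R \<in> carrier_mat m m" using M by auto
  obtain B where B: "mat_inverse ?R = Some B"
    using mat_inverse(1)[OF R, of undefined] det_non_zero_imp_unit[OF R det_resolvent[OF M reg z], of undefined]
    by (cases "mat_inverse ?R") auto
  note inv = mat_inverse(2)[OF R B]
  have u: "B *\<^sub>v cvec x \<in> carrier_vec m"
    using inv x by auto
  have "?R *\<^sub>v (B *\<^sub>v cvec x) = cvec x"
    using inv x R by (subst assoc_mult_mat_vec[symmetric, of _ m m _ m]) auto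
  then have "\<forall>i<m. z * (B *\<^sub>v cvec x) $ i - (cmat M *\<^sub>v (B *\<^sub>v cvec x)) $ i = of_real (x $ i)"
    by (simp only: resolvent_eq_iff[OF M u x])
  moreover have "tf a M x z = cvec a \<bullet> (B *\<^sub>v cvec x)"
    using B M by (simp add: wfa_transfer_def)
  ultimately show thesis
    using that[OF u] by blast
qed

lemma tf_eqI:
  assumes M: "M \<in> carrier_mat m m" and reg: "circle_regular M" and z: "norm z = 1"
    and a: "a \<in> carrier_vec m" and x: "x \<in> carrier_vec m"
    and u: "u \<in> carrier_vec m" "\<And>i. i < m \<Longrightarrow> z * u $ i - (cmat M *\<^sub>v u) $ i = of_real (x $ i)"
  shows "tf a M x z = cvec a \<bullet> u"
proof -
  obtain v where v: "v \<in> carrier_vec m"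
      "\<forall>i<m. z * v $ i - (cmat M *\<^sub>v v) $ i = of_real (x $ i)" "tf a M x z = cvec a \<bullet> v"
    using tf_solution[OF M reg z a x] .
  let ?R = "z \<cdot>\<^sub>m 1\<^sub>m m - cmat M"
  have R: "?R \<in> carrier_mat m m" using M by auto
  have eq: "?R *\<^sub>v u = cvec x"
    unfolding resolvent_eq_iff[OF M u(1) x] using u(2) by blast
  have eq': "?R *\<^sub>v v = cvec x"
    unfolding resolvent_eq_iff[OF M v(1) x] using v(2) by blast
  have "cvec x \<in> carrier_vec m"
    using x by simp
  then have "?R *\<^sub>v (u - v) = 0\<^sub>v m"
    unfolding mult_minus_distrib_mat_vec[OF R u(1) v(1)] eq eq' by (rule minus_cancel_vec)
  moreover have "\<not> (\<exists>w. w \<in> carrier_vec m \<and> w \<noteq> 0\<^sub>v m \<and> ?R *\<^sub>v w = 0\<^sub>v m)"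
    using det_resolvent[OF M reg z] unfolding det_0_iff_vec_prod_zero[OF R] .
  ultimately have "u - v = 0\<^sub>v m"
    using minus_carrier_vec[OF u(1) v(1)] by blast
  then have "u = v"
  proof (intro eq_vecI)
    fix i assume "i < dim_vec v"
    then have "u $ i - v $ i = (u - v) $ i" "i < m"
      using v(1) by auto
    then show "u $ i = v $ i"
      using \<open>u - v = 0\<^sub>v m\<close> by simp
  qed (use u(1) v(1) in auto)
  then show ?thesis
    using v by simp
qed

lemma tf_add:
  assumes "M \<in> carrier_mat m m" "circle_regular M" "norm z = 1" "a \<in> carrier_vec m"
    and "x \<in> carrier_vec m" "y \<in> carrier_vec m"
  shows "tf a M (x + y) z = tf a M x z + tf a M y z"
proof -
  obtain u where u: "u \<in> carrier_vec m"
      "\<forall>i<m. z * u $ i - (cmat M *\<^sub>v u) $ i = of_real (x $ i)" "tf a M x z = cvec a \<bullet> u"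
    using tf_solution[OF assms(1-4,5)] .
  obtain v where v: "v \<in> carrier_vec m"
      "\<forall>i<m. z * v $ i - (cmat M *\<^sub>v v) $ i = of_real (y $ i)" "tf a M y z = cvec a \<bullet> v"
    using tf_solution[OF assms(1-4,6)] .
  have "cmat M *\<^sub>v (u + v) = cmat M *\<^sub>v u + cmat M *\<^sub>v v"
    using assms(1) u(1) v(1) by (intro mult_add_distrib_mat_vec[of _ m m]) auto
  then have "tf a M (x + y) z = cvec a \<bullet> (u + v)"
    using assms u(1) v(1)
    by (intro tf_eqI[OF assms(1-4)])
      (auto simp: algebra_simps u(2)[rule_format, symmetric] v(2)[rule_format, symmetric] simp del: index_mult_mat_vec)
  then show ?thesis
    using u v assms(4) by (simp add: scalar_prod_add_distrib[of _ m])
qed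

lemma tf_smult:
  assumes "M \<in> carrier_mat m m" "circle_regular M" "norm z = 1" "a \<in> carrier_vec m" "x \<in> carrier_vec m"
  shows "tf a M (c \<cdot>\<^sub>v x) z = of_real c * tf a M x z"
proof -
  obtain u where u: "u \<in> carrier_vec m"
      "\<forall>i<m. z * u $ i - (cmat M *\<^sub>v u) $ i = of_real (x $ i)" "tf a M x z = cvec a \<bullet> u"
    using tf_solution[OF assms] .
  have "cmat M *\<^sub>v (of_real c \<cdot>\<^sub>v u) = of_real c \<cdot>\<^sub>v (cmat M *\<^sub>v u)"
    using assms(1) u(1) by (intro mult_mat_vec[of _ m m]) auto
  then have "z * (of_real c \<cdot>\<^sub>v u) $ i - (cmat M *\<^sub>v (of_real c \<cdot>\<^sub>v u)) $ i = of_real ((c \<cdot>\<^sub>v x) $ i)" if "i < m" for i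
    using assms u(1) that by (simp add: algebra_simps u(2)[rule_format, OF that, symmetric] del: index_mult_mat_vec mult_mat_vec)
  then have "tf a M (c \<cdot>\<^sub>v x) z = cvec a \<bullet> (of_real c \<cdot>\<^sub>v u)"
    using assms u(1) by (intro tf_eqI[OF assms(1-4)]) auto
  then show ?thesis
    using u assms(4) by simp
qed

text \<open>Since \<open>M (z 1 - M)^-1 = z (z 1 - M)^-1 - 1\<close>, the matrix acts on transfer
  functions as the backward shift.\<close>

lemma tf_mult_mat:
  assumes "M \<in> carrier_mat m m" "circle_regular M" "norm z = 1" "a \<in> carrier_vec m" "x \<in> carrier_vec m"
  shows "tf a M (M *\<^sub>v x) z = z * tf a M x z - of_real (a \<bullet> x)"
proof -
  obtain u where u: "u \<in> carrier_vec m"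
      "\<forall>i<m. z * u $ i - (cmat M *\<^sub>v u) $ i = of_real (x $ i)" "tf a M x z = cvec a \<bullet> u"
    using tf_solution[OF assms] .
  \<comment> \<open>The witness is \<open>M u\<close>, rewritten by the equation for
    \<open>u\<close>.\<close>
  define v where "v = z \<cdot>\<^sub>v u - cvec x"
  have v: "v \<in> carrier_vec m"
    using u assms by (auto simp: v_def)
  have "cmat M *\<^sub>v v = z \<cdot>\<^sub>v (cmat M *\<^sub>v u) - cmat M *\<^sub>v cvec x"
    using assms(1,5) u(1) unfolding v_def
    by (subst mult_minus_distrib_mat_vec[of _ m m]) (auto simp: mult_mat_vec[of _ m m])
  also have "cmat M *\<^sub>v cvec x = cvec (M *\<^sub>v x)"
    by (rule of_real_hom.mult_mat_vec_hom[OF assms(1,5), symmetric])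
  finally have Mv: "cmat M *\<^sub>v v = z \<cdot>\<^sub>v (cmat M *\<^sub>v u) - cvec (M *\<^sub>v x)" .
  have "tf a M (M *\<^sub>v x) z = cvec a \<bullet> v"
  proof (rule tf_eqI[OF assms(1-4) _ v])
    fix i assume i: "i < m"
    have "z * v $ i - (cmat M *\<^sub>v v) $ i
        = z * (z * u $ i - (cmat M *\<^sub>v u) $ i - of_real (x $ i)) + of_real ((M *\<^sub>v x) $ i)"
      unfolding Mv using i u(1) assms(1,5) by (simp add: v_def algebra_simps del: index_mult_mat_vec)
    then show "z * v $ i - (cmat M *\<^sub>v v) $ i = of_real ((M *\<^sub>v x) $ i)"
      using u(2)[rule_format, OF i] by simp
  qed (use assms in auto)
  also have "\<dots> = z * (cvec a \<bullet> u) - cvec a \<bullet> cvec x"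
    unfolding v_def using u(1) assms(4,5) by (subst scalar_prod_minus_distrib[of _ m]) auto
  finally show ?thesis
    using u(3) assms(4,5) by (simp add: scalar_prod_cvec)
qed

lemma circle_regular_transpose:
  assumes M: "M \<in> carrier_mat m m" and "circle_regular M"
  shows "circle_regular M\<^sup>T"
  unfolding circle_regular_def
proof (intro allI impI)
  fix z assume "eigenvalue (cmat M\<^sup>T) z"
  moreover have "cmat M\<^sup>T = (cmat M)\<^sup>T"
    by auto
  moreover have "char_poly (cmat M)\<^sup>T = char_poly (cmat M)"
    using M by (intro char_poly_transpose_mat[of _ m]) auto
  ultimately have "eigenvalue (cmat M) z"
    using M eigenvalue_root_char_poly[of "(cmat M)\<^sup>T" m z] eigenvalue_root_char_poly[of "cmat M" m z]
    by simp
  then show "cmod z \<noteq> 1"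
    using assms(2) by (simp add: circle_regular_def)
qed

lemma tf_transpose:
  assumes "M \<in> carrier_mat m m" "circle_regular M" "norm z = 1" "a \<in> carrier_vec m" "x \<in> carrier_vec m"
  shows "tf x M\<^sup>T a z = tf a M x z"
proof -
  have T: "M\<^sup>T \<in> carrier_mat m m" "circle_regular M\<^sup>T"
    using assms circle_regular_transpose by auto
  obtain u where u: "u \<in> carrier_vec m"
      "\<forall>i<m. z * u $ i - (cmat M *\<^sub>v u) $ i = of_real (x $ i)" "tf a M x z = cvec a \<bullet> u"
    using tf_solution[OF assms] .
  obtain v where v: "v \<in> carrier_vec m"
      "\<forall>i<m. z * v $ i - (cmat M\<^sup>T *\<^sub>v v) $ i = of_real (a $ i)" "tf x M\<^sup>T a z = cvec x \<bullet> v"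
    using tf_solution[OF T assms(3,5,4)] .
  have "cmat M\<^sup>T = (cmat M)\<^sup>T"
    by auto
  then have adj: "(cmat M\<^sup>T *\<^sub>v v) \<bullet> u = v \<bullet> (cmat M *\<^sub>v u)"
    using transpose_vec_mult_scalar[of "cmat M" m m u v] u(1) v(1) assms(1) by simp
  define p where "p = cmat M *\<^sub>v u"
  define q where "q = cmat M\<^sup>T *\<^sub>v v"
  have pq: "q \<bullet> u = v \<bullet> p" "dim_vec p = m"
    using adj assms(1) by (simp_all add: p_def q_def)
  have ai: "cvec a $ i = z * v $ i - q $ i" and xi: "cvec x $ i = z * u $ i - p $ i" if "i < m" for i
    using u(2) v(2) that assms(4,5) by (simp_all only: p_def q_def index_map_vec carrier_vecD)
  have "cvec a \<bullet> u = (\<Sum>i<m. cvec a $ i * u $ i)"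
    using u(1) by (simp only: scalar_prod_def carrier_vecD atLeast0LessThan)
  also have "\<dots> = (\<Sum>i<m. z * (v $ i * u $ i) - q $ i * u $ i)"
    by (intro sum.cong refl) (simp only: ai lessThan_iff left_diff_distrib mult.assoc)
  also have "\<dots> = z * (\<Sum>i<m. v $ i * u $ i) - q \<bullet> u"
    using u(1) by (simp only: scalar_prod_def carrier_vecD atLeast0LessThan sum_subtractf sum_distrib_left)
  also have "\<dots> = (\<Sum>i<m. z * (v $ i * u $ i) - v $ i * p $ i)"
    unfolding pq(1) using pq(2) by (simp only: scalar_prod_def atLeast0LessThan sum_subtractf sum_distrib_left)
  also have "\<dots> = (\<Sum>i<m. cvec x $ i * v $ i)"
    by (intro sum.cong refl) (simp only: xi lessThan_iff, simp add: algebra_simps)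
  also have "\<dots> = cvec x \<bullet> v"
    using v(1) by (simp only: scalar_prod_def carrier_vecD atLeast0LessThan)
  finally show ?thesis
    using u(3) v(3) by simp
qed

lemma tf_cnj:
  assumes "M \<in> carrier_mat m m" "circle_regular M" "norm z = 1" "a \<in> carrier_vec m" "x \<in> carrier_vec m"
  shows "tf a M x (cnj z) = cnj (tf a M x z)"
proof -
  interpret cnj: comm_ring_hom cnj
    by unfold_locales auto
  obtain u where u: "u \<in> carrier_vec m"
      "\<forall>i<m. z * u $ i - (cmat M *\<^sub>v u) $ i = of_real (x $ i)" "tf a M x z = cvec a \<bullet> u"
    using tf_solution[OF assms] .
  have "map_mat cnj (cmat M) = cmat M"
    by auto
  moreover have "map_mat cnj (cmat M) *\<^sub>v map_vec cnj u = map_vec cnj (cmat M *\<^sub>v u)"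
    by (rule cnj.mult_mat_vec_hom[of _ m m, symmetric]) (use assms(1) u(1) in simp_all)
  ultimately have *: "cmat M *\<^sub>v map_vec cnj u = map_vec cnj (cmat M *\<^sub>v u)"
    by (rule subst)
  have "tf a M x (cnj z) = cvec a \<bullet> map_vec cnj u"
  proof (rule tf_eqI[OF assms(1,2) _ assms(4,5)])
    fix i assume i: "i < m"
    have "cnj z * map_vec cnj u $ i - (cmat M *\<^sub>v map_vec cnj u) $ i = cnj (z * u $ i - (cmat M *\<^sub>v u) $ i)"
      unfolding * using i u(1) assms(1) by (simp del: index_mult_mat_vec)
    then show "cnj z * map_vec cnj u $ i - (cmat M *\<^sub>v map_vec cnj u) $ i = of_real (x $ i)"
      by (simp add: u(2)[rule_format, OF i] del: index_mult_mat_vec)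
  qed (use assms u in auto)
  then show ?thesis
    using u(1,3) assms(4) by (simp add: scalar_prod_def)
qed

text \<open>Cramer's rule over the polynomial ring: the adjugate of the characteristic matrix
  supplies a solution with polynomial entries, up to a determinant that has no zeros on the
  circle.\<close>

lemma tf_circle_rational:
  assumes M: "M \<in> carrier_mat m m" "circle_regular M" and a: "a \<in> carrier_vec m" and x: "x \<in> carrier_vec m"
  shows "circle_rational (tf a M x)"
proof -
  let ?P = "char_poly_matrix (cmat M)"
  let ?X = "map_vec (\<lambda>c. [:c:]) (cvec x)"
  define V where "V = adj_mat ?P *\<^sub>v ?X"
  have P: "?P \<in> carrier_mat m m" using M(1) by (intro char_poly_matrix_closed) simp
  have X: "?X \<in> carrier_vec m"
    by (rule map_carrier_vec[THEN iffD2]) (rule map_carrier_vec[THEN iffD2, OF x])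
  note adj = adj_mat[OF P]
  have V: "V \<in> carrier_vec m"
    unfolding V_def using adj(1) X by (rule mult_mat_vec_carrier)
  have PV: "?P *\<^sub>v V = (det ?P \<cdot>\<^sub>m 1\<^sub>m m) *\<^sub>v ?X"
    unfolding V_def using P X adj by (subst assoc_mult_mat_vec[symmetric, of _ m m _ m]) auto
  have ev: "map_mat (\<lambda>p. poly p z) ?P = z \<cdot>\<^sub>m 1\<^sub>m m - cmat M" for z
    using M(1) by (intro eq_matI) (auto simp: char_poly_matrix_def)
  show ?thesis
  proof (rule circle_rationalI[of "det ?P" _ "map_vec (\<lambda>c. [:c:]) (cvec a) \<bullet> V"])
    fix z :: complex assume z: "norm z = 1"
    have hom: "comm_ring_hom (\<lambda>p :: complex poly. poly p z)"
      by unfold_locales auto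
    have shom: "semiring_hom (\<lambda>p :: complex poly. poly p z)"
      by unfold_locales auto
    have det: "poly (det ?P) z = det (z \<cdot>\<^sub>m 1\<^sub>m m - cmat M)"
      unfolding ev[symmetric] by (rule comm_ring_hom.hom_det[OF hom, symmetric])
    then show nz: "poly (det ?P) z \<noteq> 0"
      using det_resolvent[OF M z] by simp
    let ?v = "map_vec (\<lambda>p. poly p z) V"
    have v: "?v \<in> carrier_vec m"
      using V by auto
    have eq: "(z \<cdot>\<^sub>m 1\<^sub>m m - cmat M) *\<^sub>v ?v = map_vec (\<lambda>p. poly p z) (?P *\<^sub>v V)"
      unfolding ev[symmetric] by (rule semiring_hom.mult_mat_vec_hom[OF shom P V, symmetric])
    have X': "map_vec (\<lambda>p. poly p z) ?X = cvec x"
      by auto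
    have "(?P *\<^sub>v V) $ i = det ?P * ?X $ i" if "i < m" for i
      unfolding PV smult_one_mult_vec[OF X] using X that by simp
    then have PVi: "poly ((?P *\<^sub>v V) $ i) z = poly (det ?P) z * of_real (x $ i)" if "i < m" for i
      using that x by simp
    have eqi: "z * ?v $ i - (cmat M *\<^sub>v ?v) $ i = poly (det ?P) z * of_real (x $ i)" if i: "i < m" for i
    proof -
      have "z * ?v $ i - (cmat M *\<^sub>v ?v) $ i = ((z \<cdot>\<^sub>m 1\<^sub>m m - cmat M) *\<^sub>v ?v) $ i"
        unfolding resolvent_mult_vec[OF M(1) v] using i v M(1) by (simp del: index_mult_mat_vec)
      also have "\<dots> = poly ((?P *\<^sub>v V) $ i) z"
        unfolding eq using i P by (subst index_map_vec) auto
      finally show ?thesis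
        using PVi[OF i] by simp
    qed
    define u where "u = inverse (poly (det ?P) z) \<cdot>\<^sub>v ?v"
    have Mu: "cmat M *\<^sub>v u = inverse (poly (det ?P) z) \<cdot>\<^sub>v (cmat M *\<^sub>v ?v)"
      unfolding u_def using M(1) v by (intro mult_mat_vec[of _ m m]) auto
    have "tf a M x z = cvec a \<bullet> u"
    proof (rule tf_eqI[OF M z a x])
      fix i assume i: "i < m"
      have "z * u $ i - (cmat M *\<^sub>v u) $ i = inverse (poly (det ?P) z) * (z * ?v $ i - (cmat M *\<^sub>v ?v) $ i)"
        unfolding Mu using i V M(1) by (simp add: u_def algebra_simps del: index_mult_mat_vec)
      also have "\<dots> = of_real (x $ i)"
        unfolding eqi[OF i] using nz by simp
      finally show "z * u $ i - (cmat M *\<^sub>v u) $ i = of_real (x $ i)" .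
    qed (use V in \<open>auto simp: u_def\<close>)
    also have "\<dots> = (cvec a \<bullet> ?v) / poly (det ?P) z"
      unfolding u_def using a v by (simp add: divide_inverse mult.commute)
    also have "cvec a \<bullet> ?v = poly (map_vec (\<lambda>c. [:c:]) (cvec a) \<bullet> V) z"
      using a V by (simp add: scalar_prod_def poly_sum)
    finally show "tf a M x z = poly (map_vec (\<lambda>c. [:c:]) (cvec a) \<bullet> V) z / poly (det ?P) z" .
  qed
qed

subsection \<open>Invariant subspaces\<close>

definition linear_subspace :: "nat \<Rightarrow> real vec set \<Rightarrow> bool" where
  "linear_subspace m V \<longleftrightarrow> V \<subseteq> carrier_vec m \<and> 0\<^sub>v m \<in> V \<and>
     (\<forall>x\<in>V. \<forall>y\<in>V. x + y \<in> V) \<and> (\<forall>c. \<forall>x\<in>V. c \<cdot>\<^sub>v x \<in> V)"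

text \<open>Kalman's rank condition in a form suited to induction: whatever defines an invariant
  subspace containing \<open>b\<close> holds for all states. For \<open>M\<^sup>T\<close> and the
  initial vector it says that no nonzero state is invisible.\<close>

definition cyclic :: "nat \<Rightarrow> real mat \<Rightarrow> real vec \<Rightarrow> bool" where
  "cyclic m M b \<longleftrightarrow> (\<forall>V. linear_subspace m V \<longrightarrow> b \<in> V \<longrightarrow> (\<forall>x\<in>V. M *\<^sub>v x \<in> V) \<longrightarrow> carrier_vec m \<subseteq> V)"

lemma linear_subspaceD:
  assumes "linear_subspace m V"
  shows "x \<in> V \<Longrightarrow> x \<in> carrier_vec m" "0\<^sub>v m \<in> V" "x \<in> V \<Longrightarrow> y \<in> V \<Longrightarrow> x + y \<in> V" "x \<in> V \<Longrightarrow> c \<cdot>\<^sub>v x \<in> V"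
  using assms by (auto simp: linear_subspace_def)

lemma minus_eq_add_smult: "x \<in> carrier_vec m \<Longrightarrow> y \<in> carrier_vec m \<Longrightarrow> x - y = x + (-1) \<cdot>\<^sub>v y" for x :: "real vec"
  by auto

lemma mult_mat_zero_vec: "A \<in> carrier_mat k m \<Longrightarrow> A *\<^sub>v 0\<^sub>v m = 0\<^sub>v k" for A :: "real mat"
  by (intro eq_vecI) auto

lemma linear_subspace_minus:
  "linear_subspace m V \<Longrightarrow> x \<in> V \<Longrightarrow> y \<in> V \<Longrightarrow> x - y \<in> V"
  using minus_eq_add_smult[of x m y] by (metis linear_subspaceD)

text \<open>A polynomial in \<open>N\<close> with coefficients \<open>d\<close>, applied to
  \<open>x\<close>. The recursion splits off the constant term, so that a factor \<open>N\<close>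
  can be cancelled from the rest.\<close>

fun horner_vec :: "real mat \<Rightarrow> (nat \<Rightarrow> real) \<Rightarrow> real vec \<Rightarrow> nat \<Rightarrow> real vec" where
  "horner_vec N d x 0 = d 0 \<cdot>\<^sub>v x"
| "horner_vec N d x (Suc k) = d 0 \<cdot>\<^sub>v x + horner_vec N (\<lambda>i. d (Suc i)) (N *\<^sub>v x) k"

lemma horner_vec_carrier:
  "N \<in> carrier_mat m m \<Longrightarrow> x \<in> carrier_vec m \<Longrightarrow> horner_vec N d x k \<in> carrier_vec m"
  by (induction k arbitrary: d x) auto

lemma horner_vec_mem:
  "linear_subspace m V \<Longrightarrow> (\<And>x. x \<in> V \<Longrightarrow> N *\<^sub>v x \<in> V) \<Longrightarrow> x \<in> V \<Longrightarrow> horner_vec N d x k \<in> V"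
  by (induction k arbitrary: d x) (auto intro: linear_subspaceD)

lemma horner_vec_mult:
  assumes N: "N \<in> carrier_mat m m"
  shows "x \<in> carrier_vec m \<Longrightarrow> horner_vec N d (N *\<^sub>v x) k = N *\<^sub>v horner_vec N d x k"
proof (induction k arbitrary: d x)
  case 0
  then show ?case using mult_mat_vec[OF N] by simp
next
  case (Suc k)
  have "N *\<^sub>v (d 0 \<cdot>\<^sub>v x + horner_vec N (\<lambda>i. d (Suc i)) (N *\<^sub>v x) k)
      = N *\<^sub>v (d 0 \<cdot>\<^sub>v x) + N *\<^sub>v horner_vec N (\<lambda>i. d (Suc i)) (N *\<^sub>v x) k"
    using Suc.prems N by (intro mult_add_distrib_mat_vec[OF N]) (auto intro!: horner_vec_carrier mult_mat_vec_carrier)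
  then show ?case
    using Suc.IH[of "N *\<^sub>v x" "\<lambda>i. d (Suc i)"] Suc.prems N mult_mat_vec[OF N Suc.prems, of "d 0"]
    by (simp only: horner_vec.simps mult_mat_vec_carrier[OF N])
qed

lemma horner_vec_index:
  assumes N: "N \<in> carrier_mat m m"
  shows "x \<in> carrier_vec m \<Longrightarrow> u < m \<Longrightarrow> horner_vec N d x k $ u = (\<Sum>i\<le>k. d i * ((\<lambda>v. N *\<^sub>v v) ^^ i) x $ u)"
proof (induction k arbitrary: d x)
  case (Suc k)
  have Nx: "N *\<^sub>v x \<in> carrier_vec m"
    using N Suc.prems(1) by (rule mult_mat_vec_carrier)
  have "horner_vec N d x (Suc k) $ u = d 0 * x $ u + horner_vec N (\<lambda>i. d (Suc i)) (N *\<^sub>v x) k $ u"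
    using Suc.prems horner_vec_carrier[OF N Nx, of "\<lambda>i. d (Suc i)" k] by simp
  also have "\<dots> = d 0 * x $ u + (\<Sum>i\<le>k. d (Suc i) * ((\<lambda>v. N *\<^sub>v v) ^^ i) (N *\<^sub>v x) $ u)"
    by (simp only: Suc.IH[OF Nx Suc.prems(2)])
  also have "\<dots> = (\<Sum>i\<le>Suc k. d i * ((\<lambda>v. N *\<^sub>v v) ^^ i) x $ u)"
    by (simp only: sum.atMost_Suc_shift funpow_Suc_right o_def funpow_0)
  finally show ?case .
qed simp

text \<open>If the constant term \<open>d 0\<close> is nonzero, the relation reads
  \<open>x = N y\<close> with \<open>y\<close> in \<open>V\<close>, and then \<open>K x = y\<close>.
  If it is zero, the invertible \<open>N\<close> is cancelled and the degree drops.\<close>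

lemma horner_vec_eq_0_imp_inverse_mem:
  assumes V: "linear_subspace m V" "\<And>x. x \<in> V \<Longrightarrow> N *\<^sub>v x \<in> V"
    and NK: "N \<in> carrier_mat m m" "K \<in> carrier_mat m m" "K * N = 1\<^sub>m m" and x: "x \<in> V"
  shows "horner_vec N d x k = 0\<^sub>v m \<Longrightarrow> \<exists>i\<le>k. d i \<noteq> 0 \<Longrightarrow> K *\<^sub>v x \<in> V"
proof (induction k arbitrary: d)
  case 0
  have xc: "x \<in> carrier_vec m" using V x by (metis linear_subspaceD(1))
  have "x = (1 / d 0) \<cdot>\<^sub>v (d 0 \<cdot>\<^sub>v x)"
    using 0(2) by (simp add: smult_smult_assoc)
  also have "\<dots> = 0\<^sub>v m"
    using 0 by (intro eq_vecI) auto
  finally have "K *\<^sub>v x = 0\<^sub>v m"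
    using mult_mat_zero_vec[OF NK(2)] by simp
  then show ?case
    using linear_subspaceD(2)[OF V(1)] by simp
next
  case (Suc k)
  have xc: "x \<in> carrier_vec m" using V x by (metis linear_subspaceD(1))
  define h where "h = horner_vec N (\<lambda>i. d (Suc i)) x k"
  have h: "h \<in> carrier_vec m" "h \<in> V"
    unfolding h_def by (rule horner_vec_carrier[OF NK(1) xc], rule horner_vec_mem[OF V x])
  define g where "g = N *\<^sub>v h"
  have g: "g \<in> carrier_vec m"
    using NK h by (simp add: g_def)
  have eq: "d 0 \<cdot>\<^sub>v x + g = 0\<^sub>v m"
    using Suc.prems(1) horner_vec_mult[OF NK(1) xc] by (simp add: h_def g_def)
  have eqi: "d 0 * x $ i + g $ i = 0" if "i < m" for i
    using arg_cong[OF eq, of "\<lambda>v. v $ i"] that xc g by simp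
  have Kg: "K *\<^sub>v g = h"
    unfolding g_def using NK h by (simp flip: assoc_mult_mat_vec)
  show ?case
  proof (cases "d 0 = 0")
    case True
    then have "g = 0\<^sub>v m"
      using eqi g by (intro eq_vecI) auto
    then have "h = 0\<^sub>v m"
      using Kg mult_mat_zero_vec[OF NK(2)] by simp
    moreover have "\<exists>i\<le>k. d (Suc i) \<noteq> 0"
      using Suc.prems(2) True by (metis Suc_le_mono not0_implies_Suc)
    ultimately show ?thesis
      using Suc.IH[of "\<lambda>i. d (Suc i)"] by (simp add: h_def)
  next
    case False
    have "x = (- 1 / d 0) \<cdot>\<^sub>v g"
    proof (rule eq_vecI)
      fix i assume "i < dim_vec ((- 1 / d 0) \<cdot>\<^sub>v g)"
      then have i: "i < m" using g by simp
      then show "x $ i = ((- 1 / d 0) \<cdot>\<^sub>v g) $ i"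
        using eqi[OF i] False g by (simp add: field_simps)
    qed (use xc g in auto)
    then have "K *\<^sub>v x = (- 1 / d 0) \<cdot>\<^sub>v h"
      using Kg mult_mat_vec[OF NK(2) g] by simp
    then show ?thesis
      using linear_subspaceD(4)[OF V(1) h(2)] by simp
  qed
qed

text \<open>The \<open>m + 1\<close> vectors \<open>x, N x, ..., N^m x\<close> are linearly
  dependent. In this way invariance under \<open>(1 - M)^-1\<close>, natural for difference
  quotients, becomes invariance under \<open>1 - M\<close>, hence under \<open>M\<close>.\<close>

lemma invariant_subspace_inverse:
  assumes V: "linear_subspace m V" "\<And>x. x \<in> V \<Longrightarrow> N *\<^sub>v x \<in> V"
    and NK: "N \<in> carrier_mat m m" "K \<in> carrier_mat m m" "K * N = 1\<^sub>m m" and x: "x \<in> V"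
  shows "K *\<^sub>v x \<in> V"
proof -
  have xc: "x \<in> carrier_vec m" using V x by (metis linear_subspaceD(1))
  obtain c where c: "\<exists>i\<in>{..m}. c i \<noteq> 0" "\<forall>u<m. (\<Sum>i\<in>{..m}. ((\<lambda>v. N *\<^sub>v v) ^^ i) x $ u * c i) = 0"
    using underdetermined_system[of "{..m}" m "\<lambda>u i. ((\<lambda>v. N *\<^sub>v v) ^^ i) x $ u"] by auto
  have "horner_vec N c x m = 0\<^sub>v m"
  proof (rule eq_vecI)
    fix u assume "u < dim_vec (0\<^sub>v m :: real vec)"
    then have "u < m" by simp
    then show "horner_vec N c x m $ u = 0\<^sub>v m $ u"
      using c(2) by (simp only: horner_vec_index[OF NK(1) xc] mult.commute[of "c _"]) simp
  qed (use horner_vec_carrier[OF NK(1) xc, of c m] in simp)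
  then show ?thesis
    using horner_vec_eq_0_imp_inverse_mem[OF assms, of c m] c(1) by auto
qed

lemma scalar_prod_self_eq_0:
  assumes "x \<in> carrier_vec m" "x \<bullet> x = (0::real)"
  shows "x = 0\<^sub>v m"
proof -
  have "x $ i = 0" if "i < m" for i
    using assms that sum_nonneg_eq_0_iff[of "{0..<m}" "\<lambda>i. x $ i * x $ i"] by (simp add: scalar_prod_def)
  then show ?thesis
    using assms(1) by (intro eq_vecI) auto
qed

text \<open>The annihilator of \<open>W\<close> is an invariant subspace of \<open>M\<^sup>T\<close>
  that contains \<open>a\<close>, hence everything, and so \<open>x\<close> is orthogonal to
  itself.\<close>

lemma cyclic_orthogonal_eq_0:
  assumes M: "M \<in> carrier_mat m m" and cyc: "cyclic m M\<^sup>T a" and a: "a \<in> carrier_vec m"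
    and W: "W \<subseteq> carrier_vec m" "\<And>x. x \<in> W \<Longrightarrow> M *\<^sub>v x \<in> W" "\<And>x. x \<in> W \<Longrightarrow> a \<bullet> x = 0" and x: "x \<in> W"
  shows "x = 0\<^sub>v m"
proof -
  let ?V = "{y \<in> carrier_vec m. \<forall>w\<in>W. y \<bullet> w = 0}"
  have "linear_subspace m ?V"
    unfolding linear_subspace_def using W(1)
    by (auto simp: subset_iff add_scalar_prod_distrib[of _ m])
  moreover have "M\<^sup>T *\<^sub>v y \<in> ?V" if "y \<in> ?V" for y
  proof -
    have "(M\<^sup>T *\<^sub>v y) \<bullet> w = 0" if "w \<in> W" for w
      using transpose_vec_mult_scalar[OF M, of w y] W(1,2) \<open>w \<in> W\<close> \<open>y \<in> ?V\<close> by (auto simp: subset_iff)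
    then show ?thesis
      using M that by auto
  qed
  moreover have "a \<in> ?V"
    using a W(3) by auto
  ultimately have "carrier_vec m \<subseteq> ?V"
    using cyc unfolding cyclic_def by blast
  then have "x \<bullet> x = 0"
    using x W(1) by blast
  then show ?thesis
    using x W(1) by (intro scalar_prod_self_eq_0) auto
qed

text \<open>The point 1 is on the circle, so it is not an eigenvalue. The matrix \<open>M\<close>
  itself may be singular, which is why \<open>1 - M\<close> is the one to be inverted.\<close>

lemma circle_regular_inverse:
  assumes M: "M \<in> carrier_mat m m" "circle_regular M"
  obtains N where "N \<in> carrier_mat m m" "N * (1\<^sub>m m - M) = 1\<^sub>m m" "(1\<^sub>m m - M) * N = 1\<^sub>m m"
    "\<And>x. x \<in> carrier_vec m \<Longrightarrow> N *\<^sub>v x - M *\<^sub>v (N *\<^sub>v x) = x"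
proof -
  have K: "1\<^sub>m m - M \<in> carrier_mat m m" using M by auto
  have "cmat (1\<^sub>m m - M) = 1 \<cdot>\<^sub>m 1\<^sub>m m - cmat M"
    using M(1) by (intro eq_matI) auto
  moreover have "det (cmat (1\<^sub>m m - M)) = complex_of_real (det (1\<^sub>m m - M))"
    by (rule of_real_hom.hom_det)
  ultimately have "complex_of_real (det (1\<^sub>m m - M)) \<noteq> 0"
    using det_resolvent[OF M, of 1] by (simp only: norm_one simp_thms)
  then have "det (1\<^sub>m m - M) \<noteq> 0" by simp
  then have "mat_inverse (1\<^sub>m m - M) \<noteq> None"
    using mat_inverse(1)[OF K, of undefined] det_non_zero_imp_unit[OF K, of undefined] by blast
  then obtain N where N: "mat_inverse (1\<^sub>m m - M) = Some N" by blast
  note inv = mat_inverse(2)[OF K N]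
  have "N *\<^sub>v x - M *\<^sub>v (N *\<^sub>v x) = x" if x: "x \<in> carrier_vec m" for x
  proof -
    have Nx: "N *\<^sub>v x \<in> carrier_vec m"
      using inv x by (metis mult_mat_vec_carrier)
    have "N *\<^sub>v x - M *\<^sub>v (N *\<^sub>v x) = (1\<^sub>m m - M) *\<^sub>v (N *\<^sub>v x)"
      using minus_mult_distrib_mat_vec[OF one_carrier_mat M(1) Nx] Nx by simp
    also have "\<dots> = ((1\<^sub>m m - M) * N) *\<^sub>v x"
      using inv x K by (metis assoc_mult_mat_vec)
    also have "\<dots> = x"
      using inv x by simp
    finally show ?thesis .
  qed
  then show thesis
    using inv that by blast
qed

lemma tf_minus:
  assumes "M \<in> carrier_mat m m" "circle_regular M" "norm z = 1" "a \<in> carrier_vec m"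
    and "x \<in> carrier_vec m" "y \<in> carrier_vec m"
  shows "tf a M (x - y) z = tf a M x z - tf a M y z"
proof -
  have "tf a M (x - y) z = tf a M (x + (-1) \<cdot>\<^sub>v y) z"
    using assms(5,6) by (simp only: minus_eq_add_smult)
  also have "\<dots> = tf a M x z - tf a M y z"
    using assms by (simp add: tf_add tf_smult)
  finally show ?thesis .
qed

lemma tf_zero:
  assumes "M \<in> carrier_mat m m" "circle_regular M" "norm z = 1" "a \<in> carrier_vec m"
  shows "tf a M (0\<^sub>v m) z = 0"
proof -
  have "(0::real) \<cdot>\<^sub>v 0\<^sub>v m = 0\<^sub>v m"
    by (intro eq_vecI) auto
  then show ?thesis
    using tf_smult[OF assms zero_carrier_vec, of 0] by simp
qed

text \<open>At \<open>z = 1\<close> the first summand vanishes. Hence the transfer function of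
  \<open>u = (1 - M)^-1 x\<close> is, up to sign, the difference quotient at 1 of that of
  \<open>x\<close>.\<close>

lemma tf_difference_quotient:
  assumes "M \<in> carrier_mat m m" "circle_regular M" "norm z = 1" "a \<in> carrier_vec m"
    and u: "u \<in> carrier_vec m" and x: "u - M *\<^sub>v u = x"
  shows "tf a M x z = (1 - z) * tf a M u z + of_real (a \<bullet> u)"
proof -
  have "M *\<^sub>v u \<in> carrier_vec m" using assms by simp
  then have "tf a M x z = tf a M u z - tf a M (M *\<^sub>v u) z"
    unfolding x[symmetric] using assms by (intro tf_minus) auto
  also have "\<dots> = tf a M u z - (z * tf a M u z - of_real (a \<bullet> u))"
    using assms by (simp only: tf_mult_mat)
  finally show ?thesis
    by (simp add: algebra_simps)
qed

lemma circle_eq_0_if_mult_ident_minus_1: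
  assumes "circle_rational f" "\<And>z. norm z = 1 \<Longrightarrow> (1 - z) * f z = 0" and z: "norm z = 1"
  shows "f z = 0"
proof (rule circle_rational_mult_eq_0[OF assms(1) _ _ _ _ z])
  show "circle_rational (\<lambda>z. 1 - z)"
    by (intro circle_rational_diff circle_rational_const circle_rational_ident)
  show "norm (-1 :: complex) = 1" "1 - (-1 :: complex) \<noteq> 0"
    by simp_all
qed (use assms(2) in \<open>simp add: mult.commute\<close>)

text \<open>The states with vanishing transfer function form a subspace \<open>W\<close> that is
  invariant under \<open>(1 - M)^-1\<close>, hence under \<open>M\<close>, and orthogonal to
  \<open>a\<close>; observability makes it zero. A constant has difference quotient zero, so
  \<open>(1 - M)^-1\<close> sends a state with constant transfer function into
  \<open>W\<close>.\<close>

lemma tf_eq_const_imp_eq_0: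
  assumes M: "M \<in> carrier_mat m m" "circle_regular M" and a: "a \<in> carrier_vec m" and cyc: "cyclic m M\<^sup>T a"
    and x: "x \<in> carrier_vec m" and const: "\<And>z. norm z = 1 \<Longrightarrow> tf a M x z = c"
  shows "x = 0\<^sub>v m"
proof -
  obtain N where N: "N \<in> carrier_mat m m" "N * (1\<^sub>m m - M) = 1\<^sub>m m" "(1\<^sub>m m - M) * N = 1\<^sub>m m"
      "\<And>x. x \<in> carrier_vec m \<Longrightarrow> N *\<^sub>v x - M *\<^sub>v (N *\<^sub>v x) = x"
    using circle_regular_inverse[OF M] by blast
  define W where "W = {x \<in> carrier_vec m. \<forall>z. norm z = 1 \<longrightarrow> tf a M x z = 0}"
  have step: "N *\<^sub>v x \<in> W" if x: "x \<in> carrier_vec m" and const: "\<And>z. norm z = 1 \<Longrightarrow> tf a M x z = c" for x c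
  proof -
    have u: "N *\<^sub>v x \<in> carrier_vec m"
      using N(1) x by simp
    have dq: "tf a M x z = (1 - z) * tf a M (N *\<^sub>v x) z + of_real (a \<bullet> (N *\<^sub>v x))" if "norm z = 1" for z
      using that by (intro tf_difference_quotient[OF M _ a u]) (use N(4) x in auto)
    have "of_real (a \<bullet> (N *\<^sub>v x)) = c"
      using dq[of 1] const[of 1] by simp
    then have "(1 - z) * tf a M (N *\<^sub>v x) z = 0" if "norm z = 1" for z
      using dq[OF that] const[OF that] by simp
    then have "tf a M (N *\<^sub>v x) z = 0" if "norm z = 1" for z
      by (rule circle_eq_0_if_mult_ident_minus_1[OF tf_circle_rational[OF M a u] _ that])
    then show ?thesis
      using u by (simp add: W_def)
  qed
  have Wsub: "linear_subspace m W"
    unfolding linear_subspace_def W_def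
    by (auto simp: tf_add[OF M _ a] tf_smult[OF M _ a] tf_zero[OF M _ a])
  have Wc: "w \<in> carrier_vec m" if "w \<in> W" for w
    using that by (simp add: W_def)
  have WN: "N *\<^sub>v w \<in> W" if "w \<in> W" for w
    using that by (intro step[of w 0]) (auto simp: W_def)
  have K: "1\<^sub>m m - M \<in> carrier_mat m m" using M by auto
  have WM: "M *\<^sub>v w \<in> W" if w: "w \<in> W" for w
  proof -
    have "(1\<^sub>m m - M) *\<^sub>v w \<in> W"
      by (rule invariant_subspace_inverse[OF Wsub WN N(1) K N(3) w])
    moreover have "M *\<^sub>v w = w - (1\<^sub>m m - M) *\<^sub>v w"
      using Wc[OF w] M(1) minus_mult_distrib_mat_vec[OF one_carrier_mat M(1) Wc[OF w]]
      by (intro eq_vecI) (auto simp del: index_mult_mat_vec)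
    ultimately show ?thesis
      using linear_subspace_minus[OF Wsub w] by simp
  qed
  have aw: "a \<bullet> w = 0" if w: "w \<in> W" for w
    using tf_mult_mat[OF M _ a Wc[OF w], of 1] WM[OF w] w by (simp add: W_def)
  have W0: "w = 0\<^sub>v m" if "w \<in> W" for w
    using cyclic_orthogonal_eq_0[OF M(1) cyc a _ WM aw that] Wc by blast
  have "N *\<^sub>v x = 0\<^sub>v m"
    using step[OF x const] W0 by blast
  then show ?thesis
    using N(4)[OF x] mult_mat_zero_vec[OF M(1)] by simp
qed

lemma tf_inject:
  assumes M: "M \<in> carrier_mat m m" "circle_regular M" and a: "a \<in> carrier_vec m" and cyc: "cyclic m M\<^sup>T a"
    and x: "x \<in> carrier_vec m" "y \<in> carrier_vec m" and eq: "\<And>z. norm z = 1 \<Longrightarrow> tf a M x z = tf a M y z"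
  shows "x = y"
proof -
  have "x - y = 0\<^sub>v m"
    using x by (intro tf_eq_const_imp_eq_0[OF M a cyc, of _ 0]) (simp_all add: tf_minus[OF M _ a] eq)
  show ?thesis
  proof (rule eq_vecI)
    fix i assume "i < dim_vec y"
    then have "x $ i - y $ i = (x - y) $ i" "i < m"
      using x by auto
    then show "x $ i = y $ i"
      using \<open>x - y = 0\<^sub>v m\<close> by simp
  qed (use x in auto)
qed

subsection \<open>Systems with all-pass transfer function\<close>

text \<open>The data are real, so the second factor of \<open>allpass\<close> is the conjugate of
  the first and the condition fixes the modulus of the error. In this bilinear form it is an
  identity between rational functions and symmetric under transposition of the system.\<close>

locale allpass_system =
  fixes m :: nat and M :: "real mat" and a b :: "real vec" and c \<sigma> :: real
  assumes M: "M \<in> carrier_mat m m" and regular: "circle_regular M"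
    and a: "a \<in> carrier_vec m" and b: "b \<in> carrier_vec m"
    and obs: "cyclic m M\<^sup>T a" and reach: "cyclic m M b"
    and allpass: "norm z = 1 \<Longrightarrow>
      (tf a M b z - of_real c) * (tf a M b (cnj z) - of_real c) = of_real (\<sigma>\<^sup>2)"
begin

abbreviation E :: "complex \<Rightarrow> complex" where
  "E z \<equiv> tf a M b z - of_real c"

text \<open>On the circle this is \<open>b\<^sup>T (1 - z M\<^sup>T)^-1 y\<close>: the transfer
  functions of the transposed system at \<open>1/z\<close>, normalised so that
  \<open>M\<^sup>T\<close> again acts as a backward shift.\<close>

definition G :: "real vec \<Rightarrow> complex \<Rightarrow> complex" where
  "G y z = cnj z * tf b M\<^sup>T y (cnj z)"

lemma MT: "M\<^sup>T \<in> carrier_mat m m" "circle_regular M\<^sup>T"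
  using M regular circle_regular_transpose by auto

lemma transposed: "allpass_system m M\<^sup>T b a c \<sigma>"
proof
  fix z :: complex assume "norm z = 1"
  then show "(tf b M\<^sup>T a z - of_real c) * (tf b M\<^sup>T a (cnj z) - of_real c) = of_real (\<sigma>\<^sup>2)"
    using allpass[of z] by (simp add: tf_transpose[OF M regular _ a b])
qed (use MT M a b obs reach in simp_all)

lemma G_add: "norm z = 1 \<Longrightarrow> x \<in> carrier_vec m \<Longrightarrow> y \<in> carrier_vec m \<Longrightarrow> G (x + y) z = G x z + G y z"
  by (simp add: G_def tf_add[OF MT _ b] algebra_simps)

lemma G_smult: "norm z = 1 \<Longrightarrow> x \<in> carrier_vec m \<Longrightarrow> G (k \<cdot>\<^sub>v x) z = of_real k * G x z"
  by (simp add: G_def tf_smult[OF MT _ b] algebra_simps)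

lemma G_mult_mat: "norm z = 1 \<Longrightarrow> y \<in> carrier_vec m \<Longrightarrow> z * G (M\<^sup>T *\<^sub>v y) z = G y z - of_real (b \<bullet> y)"
  using circle_mult_cnj[of z] by (simp add: G_def tf_mult_mat[OF MT _ b] flip: mult.assoc)

lemma G_difference_quotient:
  assumes "norm z = 1" "u \<in> carrier_vec m" "u - M\<^sup>T *\<^sub>v u = y"
  shows "z * G y z = (z - 1) * G u z + of_real (b \<bullet> u)"
proof -
  have "tf b M\<^sup>T y (cnj z) = (1 - cnj z) * tf b M\<^sup>T u (cnj z) + of_real (b \<bullet> u)"
    using assms by (intro tf_difference_quotient[OF MT _ b]) simp_all
  then show ?thesis
    using circle_mult_cnj[OF assms(1)] by (simp add: G_def algebra_simps flip: mult.assoc)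
qed

lemma G_circle_rational: "y \<in> carrier_vec m \<Longrightarrow> circle_rational (G y)"
  unfolding G_def
  using circle_rational_mult[OF circle_rational_cnj_arg[OF circle_rational_ident]
      circle_rational_cnj_arg[OF tf_circle_rational[OF MT b]]] .

lemma E_circle_rational: "circle_rational E"
  by (intro circle_rational_diff tf_circle_rational[OF M regular a b] circle_rational_const)

lemma E_cnj: "norm z = 1 \<Longrightarrow> E (cnj z) = z * G a z - of_real c"
  using circle_mult_cnj[of z] tf_transpose[OF M regular _ a b, of "cnj z"]
  by (simp add: G_def flip: mult.assoc)

text \<open>The set of all \<open>y\<close> for which a solution exists contains \<open>(1 - M\<^sup>T)\<^sup>-\<^sup>1 a\<close> and is invariant under \<open>(1 - M\<^sup>T)\<^sup>-\<^sup>1\<close>,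
  which acts on the functions \<open>G y\<close> as a difference quotient at the point 1.\<close>

lemma ex_tf_eq:
  assumes y: "y \<in> carrier_vec m"
  shows "\<exists>x\<in>carrier_vec m. \<forall>z. norm z = 1 \<longrightarrow> E z * G y z = tf a M x z"
proof -
  obtain N where N: "N \<in> carrier_mat m m" "(1\<^sub>m m - M\<^sup>T) * N = 1\<^sub>m m"
      "\<And>x. x \<in> carrier_vec m \<Longrightarrow> N *\<^sub>v x - M\<^sup>T *\<^sub>v (N *\<^sub>v x) = x"
    using circle_regular_inverse[OF MT] by blast
  obtain N' where N': "N' \<in> carrier_mat m m"
      "\<And>x. x \<in> carrier_vec m \<Longrightarrow> N' *\<^sub>v x - M *\<^sub>v (N' *\<^sub>v x) = x"
    using circle_regular_inverse[OF M regular] by blast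
  define U where "U = {y \<in> carrier_vec m. \<exists>x\<in>carrier_vec m. \<forall>z. norm z = 1 \<longrightarrow> E z * G y z = tf a M x z}"
  \<comment> \<open>\<open>e1\<close> is the value of \<open>E\<close> at 1, and \<open>x0\<close>
    is the state whose transfer function is, up to sign, the difference quotient of \<open>E\<close>
    there.\<close>
  define x0 where "x0 = N' *\<^sub>v b"
  define e1 where "e1 = a \<bullet> x0 - c"
  have x0: "x0 \<in> carrier_vec m"
    using N'(1) b by (simp add: x0_def)
  have E_dq: "E z = (1 - z) * tf a M x0 z + of_real e1" if "norm z = 1" for z
    using tf_difference_quotient[OF M regular that a x0, of b] N'(2)[OF b] by (simp add: x0_def e1_def)
  have E1: "E 1 = of_real e1"
    using E_dq[of 1] by simp
  have e1_sq: "of_real e1 * of_real e1 = (of_real (\<sigma>\<^sup>2) :: complex)"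
    using allpass[of 1] E1 by simp
  have extend: "E z * G y z = tf a M x z"
    if "y \<in> carrier_vec m" "x \<in> carrier_vec m" "norm z = 1"
      and eq: "\<And>z. norm z = 1 \<Longrightarrow> (z - 1) * (E z * G y z) = (z - 1) * tf a M x z" for x y z
  proof -
    have rat: "circle_rational (\<lambda>z. E z * G y z - tf a M x z)"
      by (intro circle_rational_diff circle_rational_mult E_circle_rational G_circle_rational
          tf_circle_rational[OF M regular a] that)
    have "E z * G y z - tf a M x z = 0"
      by (rule circle_eq_0_if_mult_ident_minus_1[OF rat _ that(3)]) (use eq in \<open>simp add: algebra_simps\<close>)
    then show ?thesis by simp
  qed
  have Usub: "linear_subspace m U"
    unfolding linear_subspace_def
  proof (intro conjI ballI allI)
    have "G (0\<^sub>v m) z = 0" if "norm z = 1" for z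
      using tf_zero[OF MT _ b] that by (simp add: G_def)
    then show "0\<^sub>v m \<in> U"
      by (auto simp: U_def tf_zero[OF M regular _ a] intro!: bexI[of _ "0\<^sub>v m"])
  next
    fix y y' assume "y \<in> U" "y' \<in> U"
    then obtain x x' where "x \<in> carrier_vec m" "\<And>z. norm z = 1 \<Longrightarrow> E z * G y z = tf a M x z"
        "x' \<in> carrier_vec m" "\<And>z. norm z = 1 \<Longrightarrow> E z * G y' z = tf a M x' z"
        "y \<in> carrier_vec m" "y' \<in> carrier_vec m"
      unfolding U_def by blast
    then show "y + y' \<in> U"
      unfolding U_def by (auto simp: G_add tf_add[OF M regular _ a] ring_distribs(1) intro!: bexI[of _ "x + x'"])
  next
    fix k y assume "y \<in> U"
    then obtain x where "x \<in> carrier_vec m" "\<And>z. norm z = 1 \<Longrightarrow> E z * G y z = tf a M x z" "y \<in> carrier_vec m"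
      unfolding U_def by blast
    then show "k \<cdot>\<^sub>v y \<in> U"
      unfolding U_def
      by (auto simp: G_smult tf_smult[OF M regular _ a] mult.left_commute[of "E _"] intro!: bexI[of _ "k \<cdot>\<^sub>v x"])
  qed (auto simp: U_def)
  have start: "N *\<^sub>v a \<in> U"
  proof -
    define y0 where "y0 = N *\<^sub>v a"
    have y0: "y0 \<in> carrier_vec m"
      using N(1) a by (simp add: y0_def)
    have dq: "z * G a z = (z - 1) * G y0 z + of_real (b \<bullet> y0)" if "norm z = 1" for z
      using G_difference_quotient[OF that y0] N(3)[OF a] by (simp add: y0_def)
    have "of_real (b \<bullet> y0) - of_real c = (of_real e1 :: complex)"
      using E_cnj[of 1] dq[of 1] E1 by simp
    then have Ecnj: "E (cnj z) = (z - 1) * G y0 z + of_real e1" if "norm z = 1" for z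
      using E_cnj[OF that] dq[OF that] by (simp add: algebra_simps)
    \<comment> \<open>Subtracting the value at 1 from \<open>E (cnj z)\<close> leaves
      \<open>(z - 1) G y0\<close>. Its product with \<open>E z\<close> is
      \<open>e1\<^sup>2 - e1 E z\<close> because the system is all-pass, and this is again a
      multiple of the difference of \<open>E\<close> from its value at 1; hence the witness
      \<open>e1 x0\<close>.\<close>
    have "(z - 1) * (E z * G y0 z) = (z - 1) * tf a M (e1 \<cdot>\<^sub>v x0) z" if z: "norm z = 1" for z
    proof -
      have "(z - 1) * (E z * G y0 z) = E z * E (cnj z) - E z * of_real e1"
        unfolding Ecnj[OF z] by (simp only: algebra_simps mult_1_left)
      also have "\<dots> = of_real e1 * (of_real e1 - E z)"
        unfolding allpass[OF z] e1_sq[symmetric] by (simp only: algebra_simps mult_1_left)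
      also have "\<dots> = (z - 1) * (of_real e1 * tf a M x0 z)"
        unfolding E_dq[OF z] by (simp add: algebra_simps)
      finally show ?thesis
        using z by (simp only: tf_smult[OF M regular _ a x0])
    qed
    then have "E z * G y0 z = tf a M (e1 \<cdot>\<^sub>v x0) z" if "norm z = 1" for z
      using that x0 by (intro extend y0) auto
    then show ?thesis
      using y0 x0 unfolding U_def y0_def[symmetric] by (auto intro!: bexI[of _ "e1 \<cdot>\<^sub>v x0"])
  qed
  have step: "N *\<^sub>v y \<in> U" if yU: "y \<in> U" for y
  proof -
    obtain x where y: "y \<in> carrier_vec m" and x: "x \<in> carrier_vec m"
        and xy: "\<And>z. norm z = 1 \<Longrightarrow> E z * G y z = tf a M x z"
      using yU unfolding U_def by blast
    define y' where "y' = N *\<^sub>v y"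
    define x' where "x' = N' *\<^sub>v x"
    define g where "g = b \<bullet> y'"
    \<comment> \<open>The witness results from expanding \<open>z E G y - g E\<close> by the
      difference quotients of \<open>tf a M x\<close> and of \<open>E\<close>. The values at 1 match
      because of \<open>ax'\<close>, so that \<open>z - 1\<close> splits off.\<close>
    define w where "w = g \<cdot>\<^sub>v x0 - M *\<^sub>v x'"
    have y': "y' \<in> carrier_vec m" and x': "x' \<in> carrier_vec m"
      using N(1) N'(1) x y by (simp_all add: y'_def x'_def)
    have Mx': "M *\<^sub>v x' \<in> carrier_vec m"
      using M x' by simp
    have w: "w \<in> carrier_vec m"
      using Mx' x0 by (simp add: w_def)
    have dq: "z * G y z = (z - 1) * G y' z + of_real g" if "norm z = 1" for z
      using G_difference_quotient[OF that y'] N(3)[OF y] by (simp add: y'_def g_def)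
    have dq': "tf a M x z = (1 - z) * tf a M x' z + of_real (a \<bullet> x')" if "norm z = 1" for z
      using tf_difference_quotient[OF M regular that a x'] N'(2)[OF x] by (simp add: x'_def)
    have ax': "of_real (a \<bullet> x') = (of_real e1 * of_real g :: complex)"
      using xy[of 1] dq[of 1] dq'[of 1] E1 by simp
    have tw: "tf a M w z = of_real g * tf a M x0 z - (z * tf a M x' z - of_real e1 * of_real g)"
      if "norm z = 1" for z
      unfolding w_def
      by (simp only: tf_minus[OF M regular that a smult_carrier_vec[THEN iffD2, OF x0] Mx']
          tf_smult[OF M regular that a x0] tf_mult_mat[OF M regular that a x'] ax')
    have "(z - 1) * (E z * G y' z) = (z - 1) * tf a M w z" if z: "norm z = 1" for z
    proof -
      have "(z - 1) * G y' z = z * G y z - of_real g"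
        using dq[OF z] by simp
      then have "E z * ((z - 1) * G y' z) = E z * (z * G y z - of_real g)"
        by (rule arg_cong)
      also have "\<dots> = z * (E z * G y z) - E z * of_real g"
        by (simp add: algebra_simps)
      also have "E z * ((z - 1) * G y' z) = (z - 1) * (E z * G y' z)"
        by (rule mult.left_commute)
      finally have "(z - 1) * (E z * G y' z) = z * (E z * G y z) - E z * of_real g" .
      also have "z * (E z * G y z) - E z * of_real g = z * ((1 - z) * tf a M x' z + of_real e1 * of_real g)
          - ((1 - z) * tf a M x0 z + of_real e1) * of_real g"
        unfolding xy[OF z] dq'[OF z] ax' unfolding E_dq[OF z] ..
      also have "\<dots> = (z - 1) * tf a M w z"
        unfolding tw[OF z] by (simp only: algebra_simps mult_1_left)
      finally show ?thesis .
    qed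
    then have "E z * G y' z = tf a M w z" if "norm z = 1" for z
      using that by (intro extend y' w) auto
    then show ?thesis
      using y' w unfolding U_def y'_def[symmetric] by blast
  qed
  have K: "1\<^sub>m m - M\<^sup>T \<in> carrier_mat m m" using M by auto
  have Uc: "u \<in> carrier_vec m" if "u \<in> U" for u
    using that by (simp add: U_def)
  have Kdef: "(1\<^sub>m m - M\<^sup>T) *\<^sub>v u = u - M\<^sup>T *\<^sub>v u" if "u \<in> carrier_vec m" for u
    using minus_mult_distrib_mat_vec[OF one_carrier_mat MT(1) that] that by simp
  \<comment> \<open>\<open>U\<close> is invariant under \<open>(1 - M\<^sup>T)^-1\<close>; finite
    dimension gives invariance under \<open>1 - M\<^sup>T\<close> as well, which brings
    \<open>N a\<close> back to \<open>a\<close>.\<close>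
  have KU: "(1\<^sub>m m - M\<^sup>T) *\<^sub>v u \<in> U" if "u \<in> U" for u
    by (rule invariant_subspace_inverse[OF Usub step N(1) K N(2) that])
  have "a \<in> U"
    using KU[OF start] N(3)[OF a] Kdef[OF Uc[OF start]] by simp
  moreover have "M\<^sup>T *\<^sub>v u \<in> U" if u: "u \<in> U" for u
  proof -
    have "M\<^sup>T *\<^sub>v u = u - (u - M\<^sup>T *\<^sub>v u)"
      using Uc[OF u] M by (intro eq_vecI) (auto simp del: index_mult_mat_vec)
    then show ?thesis
      using linear_subspace_minus[OF Usub u KU[OF u]] Kdef[OF Uc[OF u]] by simp
  qed
  ultimately have "carrier_vec m \<subseteq> U"
    using obs Usub unfolding cyclic_def by blast
  then show ?thesis
    using y unfolding U_def by blast
qed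

text \<open>Observability makes the solution unique (\<open>P_eqI\<close>), so the choice is
  automatically linear.\<close>

definition P :: "real vec \<Rightarrow> real vec" where
  "P y = (SOME x. x \<in> carrier_vec m \<and> (\<forall>z. norm z = 1 \<longrightarrow> E z * G y z = tf a M x z))"

lemma P:
  assumes "y \<in> carrier_vec m"
  shows "P y \<in> carrier_vec m" "norm z = 1 \<Longrightarrow> tf a M (P y) z = E z * G y z"
proof -
  have "P y \<in> carrier_vec m \<and> (\<forall>z. norm z = 1 \<longrightarrow> E z * G y z = tf a M (P y) z)"
    unfolding P_def using ex_tf_eq[OF assms] by (rule_tac someI_ex) blast
  then show "P y \<in> carrier_vec m" "norm z = 1 \<Longrightarrow> tf a M (P y) z = E z * G y z"
    by auto
qed

lemma P_eqI:
  assumes "y \<in> carrier_vec m" "x \<in> carrier_vec m" "\<And>z. norm z = 1 \<Longrightarrow> tf a M x z = E z * G y z"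
  shows "P y = x"
  by (rule tf_inject[OF M regular a obs P(1)[OF assms(1)] assms(2)]) (simp add: P(2)[OF assms(1)] assms(3))

lemma P_add: "x \<in> carrier_vec m \<Longrightarrow> y \<in> carrier_vec m \<Longrightarrow> P (x + y) = P x + P y"
  by (rule P_eqI) (simp_all add: P tf_add[OF M regular _ a] G_add ring_distribs(1))

lemma P_smult: "x \<in> carrier_vec m \<Longrightarrow> P (k \<cdot>\<^sub>v x) = k \<cdot>\<^sub>v P x"
  by (rule P_eqI) (simp_all add: P tf_smult[OF M regular _ a] G_smult mult.left_commute)

text \<open>Multiplication by \<open>E\<close> turns the shift rule for \<open>G\<close> into that
  for \<open>tf\<close>, up to constants. So the difference of both sides has a constant transfer
  function, and only the zero state has one.\<close>

lemma P_stein: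
  assumes y: "y \<in> carrier_vec m"
  shows "P y - M *\<^sub>v P (M\<^sup>T *\<^sub>v y) = (b \<bullet> y) \<cdot>\<^sub>v b"
proof -
  define v where "v = P (M\<^sup>T *\<^sub>v y)"
  have My: "M\<^sup>T *\<^sub>v y \<in> carrier_vec m"
    using MT y by simp
  have v: "v \<in> carrier_vec m"
    unfolding v_def by (rule P(1)[OF My])
  have Mv: "M *\<^sub>v v \<in> carrier_vec m"
    using M v by simp
  have Py: "P y \<in> carrier_vec m"
    by (rule P(1)[OF y])
  have bb: "(b \<bullet> y) \<cdot>\<^sub>v b \<in> carrier_vec m"
    using b by simp
  have d: "P y - M *\<^sub>v v \<in> carrier_vec m"
    using Mv Py by simp
  have "P y - M *\<^sub>v v - (b \<bullet> y) \<cdot>\<^sub>v b = 0\<^sub>v m"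
  proof (rule tf_eq_const_imp_eq_0[OF M regular a obs])
    fix z :: complex assume z: "norm z = 1"
    have "z * tf a M v z = E z * (z * G (M\<^sup>T *\<^sub>v y) z)"
      unfolding v_def P(2)[OF My z] by (simp only: mult_ac)
    also have "\<dots> = E z * (G y z - of_real (b \<bullet> y))"
      unfolding G_mult_mat[OF z y] ..
    finally have zv: "z * tf a M v z = E z * (G y z - of_real (b \<bullet> y))" .
    show "tf a M (P y - M *\<^sub>v v - (b \<bullet> y) \<cdot>\<^sub>v b) z = of_real (a \<bullet> v) - of_real c * of_real (b \<bullet> y)"
      unfolding tf_minus[OF M regular z a d bb] tf_minus[OF M regular z a Py Mv]
        tf_smult[OF M regular z a b] tf_mult_mat[OF M regular z a v] zv P(2)[OF y z]
      by (simp only: algebra_simps mult_1_left)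
  qed (use d bb in simp)
  show ?thesis
  proof (rule eq_vecI)
    fix i assume "i < dim_vec ((b \<bullet> y) \<cdot>\<^sub>v b)"
    then have i: "i < m" using b by simp
    then have "(P y - M *\<^sub>v v - (b \<bullet> y) \<cdot>\<^sub>v b) $ i = (P y - M *\<^sub>v v) $ i - ((b \<bullet> y) \<cdot>\<^sub>v b) $ i"
      using bb by simp
    then show "(P y - M *\<^sub>v P (M\<^sup>T *\<^sub>v y)) $ i = ((b \<bullet> y) \<cdot>\<^sub>v b) $ i"
      using \<open>P y - M *\<^sub>v v - (b \<bullet> y) \<cdot>\<^sub>v b = 0\<^sub>v m\<close> i by (simp add: v_def)
  qed (use M b in simp)
qed

end

context allpass_system
begin

interpretation Q: allpass_system m "M\<^sup>T" b a c \<sigma>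
  by (rule transposed)

text \<open>Passing to the transposed system interchanges the two families of functions and replaces
  \<open>z\<close> by \<open>1/z\<close>. Applying both maps therefore multiplies by
  \<open>E z * E (cnj z)\<close>.\<close>

lemma transposed_P_P:
  assumes y: "y \<in> carrier_vec m"
  shows "allpass_system.P m M\<^sup>T b a c (P y) = \<sigma>\<^sup>2 \<cdot>\<^sub>v y"
proof (rule Q.P_eqI[OF P(1)[OF y]])
  fix z :: complex assume z: "norm z = 1"
  have Ez: "Q.E z = E z"
    by (simp add: tf_transpose[OF M regular z a b])
  have "Q.G (P y) z = cnj z * (E (cnj z) * (z * tf b M\<^sup>T y z))"
    using z P(2)[OF y, of "cnj z"] by (simp add: Q.G_def G_def)
  also have "\<dots> = (z * cnj z) * (E (cnj z) * tf b M\<^sup>T y z)"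
    by (simp only: mult_ac)
  finally have "Q.G (P y) z = E (cnj z) * tf b M\<^sup>T y z"
    by (simp only: circle_mult_cnj[OF z] mult_1_left)
  then show "tf b M\<^sup>T (\<sigma>\<^sup>2 \<cdot>\<^sub>v y) z = Q.E z * Q.G (P y) z"
    unfolding Ez tf_smult[OF MT z b y] allpass[OF z, symmetric] by (simp only: mult_ac)
qed (use y in simp)

end

subsection \<open>Minimality\<close>

text \<open>A maximal independent subset of \<open>S\<close> already spans \<open>span S\<close>; it
  then has \<open>n\<close> elements and is a basis of the whole space.\<close>

lemma (in vec_space) span_eq_carrier_if_dim:
  assumes S: "S \<subseteq> carrier_vec n" and dim_S: "vectorspace.dim class_ring (span_vs S) = n"
  shows "span S = carrier_vec n"
proof -
  let ?P = "\<lambda>T. T \<subseteq> S \<and> lin_indpt T"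
  have fin: "finite T \<and> card T \<le> n" if "?P T" for T
    using that S li_le_dim[OF fin_dim, of T] dim_is_n by auto
  have "?P {}"
    by (simp add: lin_dep_def)
  from maximal_exists[of ?P, OF fin this] obtain U where U: "finite U" "maximal U ?P"
    by auto
  then have US: "U \<subseteq> S" "lin_indpt U"
    by (auto simp: maximal_def)
  have UC: "U \<subseteq> carrier_vec n"
    using US(1) S by blast
  have "s \<in> span U" if s: "s \<in> S" for s
  proof (cases "s \<in> U")
    case True
    then show ?thesis using span_mem UC by auto
  next
    case False
    then have "\<not> lin_indpt (U \<union> {s})"
      using U(2) US(1) s unfolding maximal_def by blast
    then show ?thesis
      using lin_dep_iff_in_span[of U s] UC US(2) s S False by auto
  qed
  then have "S \<subseteq> span U" by blast
  then have eq: "span S = span U"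
    using span_is_subset[OF _ span_is_submodule, of S U] UC S span_is_monotone[OF US(1)] by auto
  have "maximal U (\<lambda>T. T \<subseteq> U \<and> lin_indpt T)"
    using U(2) US by (auto simp: maximal_def)
  then have "vectorspace.dim class_ring (span_vs U) = card U"
    using dim_span[of U U] UC U(1) by auto
  then have "card U = n"
    using dim_S eq by simp
  then have "basis U"
    using dim_li_is_basis[OF fin_dim U(1)] UC US(2) dim_is_n by auto
  then show ?thesis
    unfolding eq by (simp add: basis_def)
qed

lemma (in vec_space) span_subset_if_closed:
  assumes S: "S \<subseteq> X" and X: "X \<subseteq> carrier_vec n" "0\<^sub>v n \<in> X" "\<And>x y. x \<in> X \<Longrightarrow> y \<in> X \<Longrightarrow> x + y \<in> X"
    "\<And>k x. x \<in> X \<Longrightarrow> k \<cdot>\<^sub>v x \<in> X"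
  shows "span S \<subseteq> X"
proof (rule span_is_subset[OF S])
  show "submodule class_ring X (module_vec TYPE('a) n)"
    using X by (unfold_locales) (auto simp: module_vec_simps)
qed

lemma pow_mat_Suc_left: "M \<in> carrier_mat m m \<Longrightarrow> M ^\<^sub>m Suc p = M * M ^\<^sub>m p" for M :: "'a :: semiring_1 mat"
proof (induction p)
  case (Suc p)
  have "M ^\<^sub>m Suc (Suc p) = (M * M ^\<^sub>m p) * M"
    using Suc by simp
  also have "\<dots> = M * (M ^\<^sub>m p * M)"
    using Suc.prems by (intro assoc_mult_mat[of _ m m _ m _ m]) auto
  finally show ?case by simp
qed simp

lemma transpose_pow_mat:
  fixes M :: "'a :: comm_semiring_1 mat"
  assumes M: "M \<in> carrier_mat m m"
  shows "(M ^\<^sub>m p)\<^sup>T = M\<^sup>T ^\<^sub>m p"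
proof (induction p)
  case 0
  show ?case using M by simp
next
  case (Suc p)
  have "(M ^\<^sub>m Suc p)\<^sup>T = M\<^sup>T * (M ^\<^sub>m p)\<^sup>T"
    using transpose_mult[OF pow_carrier_mat[OF M] M] by simp
  also have "\<dots> = M\<^sup>T ^\<^sub>m Suc p"
    unfolding Suc using M by (intro pow_mat_Suc_left[symmetric, of _ m]) simp
  finally show ?case .
qed

text \<open>An invariant subspace containing \<open>b\<close> contains the whole orbit of
  \<open>b\<close>, whose span has dimension \<open>m\<close> by the rank assumption.\<close>

lemma row_rank_imp_cyclic:
  fixes x :: "nat \<Rightarrow> real vec"
  assumes M: "M \<in> carrier_mat m m" and b: "b \<in> carrier_vec m"
    and x: "\<And>p. x p = (M ^\<^sub>m p) *\<^sub>v b" and rank: "vec_space.row_rank m x = m"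
  shows "cyclic m M b"
  unfolding cyclic_def
proof (intro allI impI)
  fix V assume V: "linear_subspace m V" "b \<in> V" "\<forall>x\<in>V. M *\<^sub>v x \<in> V"
  interpret vs: vec_space "TYPE(real)" m .
  have mem: "x p \<in> V" for p
  proof (induction p)
    case 0
    show ?case using V(2) b M by (simp add: x)
  next
    case (Suc p)
    have "x (Suc p) = M *\<^sub>v x p"
      unfolding x pow_mat_Suc_left[OF M] using assoc_mult_mat_vec[OF M pow_carrier_mat[OF M] b] by simp
    then show ?case using Suc V(3) by simp
  qed
  have VC: "V \<subseteq> carrier_vec m"
    using linear_subspaceD(1)[OF V(1)] by blast
  have "vs.span (range x) = carrier_vec m"
    using mem VC rank by (intro vs.span_eq_carrier_if_dim) (auto simp: vs.row_rank_def)
  moreover have "vs.span (range x) \<subseteq> V"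
    using mem VC linear_subspaceD[OF V(1)] by (intro vs.span_subset_if_closed) auto
  ultimately show "carrier_vec m \<subseteq> V"
    by simp
qed

lemma observable_imp_cyclic: "is_wfa m W \<Longrightarrow> observable m W \<Longrightarrow> cyclic m (trans_mat W) (final W)"
  by (rule row_rank_imp_cyclic[of _ _ _ "backward_mat W"]) (auto simp: is_wfa_def observable_def backward_mat_def)

lemma reachable_imp_cyclic: "is_wfa m W \<Longrightarrow> reachable m W \<Longrightarrow> cyclic m (trans_mat W)\<^sup>T (initial W)"
  by (rule row_rank_imp_cyclic[of _ _ _ "forward_mat W"])
    (auto simp: is_wfa_def reachable_def forward_mat_def transpose_pow_mat)

subsection \<open>Parallel connection\<close>

text \<open>Spelled exactly like the transition matrix in \<open>error_wfa\<close>, dimensions of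
  the zero blocks included.\<close>

abbreviation diag_block :: "'a :: zero mat \<Rightarrow> 'a mat \<Rightarrow> 'a mat" where
  "diag_block A B \<equiv> four_block_mat A (0\<^sub>m (dim_row A) (dim_col B)) (0\<^sub>m (dim_row B) (dim_col A)) B"

lemma diag_block_mult_append:
  assumes "A \<in> carrier_mat n n" "B \<in> carrier_mat j j" "x \<in> carrier_vec n" "y \<in> carrier_vec j"
  shows "diag_block A B *\<^sub>v (x @\<^sub>v y) = (A *\<^sub>v x) @\<^sub>v (B *\<^sub>v y)"
  using assms by (subst four_block_mat_mult_vec[of _ n n _ j _ j]) auto

lemma circle_regular_diag_block:
  assumes A: "A \<in> carrier_mat n n" "circle_regular A" and B: "B \<in> carrier_mat j j" "circle_regular B"
  shows "circle_regular (diag_block A B)"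
  unfolding circle_regular_def
proof (intro allI impI notI)
  fix z assume ev: "eigenvalue (cmat (diag_block A B)) z" and z: "cmod z = 1"
  then obtain v where v: "v \<in> carrier_vec (n + j)" "v \<noteq> 0\<^sub>v (n + j)" "cmat (diag_block A B) *\<^sub>v v = z \<cdot>\<^sub>v v"
    using A B by (auto simp: eigenvalue_def eigenvector_def)
  define x where "x = vec_first v n"
  define y where "y = vec_last v j"
  have vxy: "v = x @\<^sub>v y"
    using v(1) by (simp add: x_def y_def vec_first_last_append)
  have xy: "x \<in> carrier_vec n" "y \<in> carrier_vec j"
    by (simp_all add: x_def y_def)
  have "cmat (diag_block A B) = diag_block (cmat A) (cmat B)"
    using A B by (intro eq_matI) (auto simp: index_mat_four_block)
  moreover have "z \<cdot>\<^sub>v (x @\<^sub>v y) = (z \<cdot>\<^sub>v x) @\<^sub>v (z \<cdot>\<^sub>v y)"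
    by (intro eq_vecI) auto
  ultimately have "(cmat A *\<^sub>v x) @\<^sub>v (cmat B *\<^sub>v y) = (z \<cdot>\<^sub>v x) @\<^sub>v (z \<cdot>\<^sub>v y)"
    using v(3) diag_block_mult_append[of "cmat A" n "cmat B" j x y] A B xy
    by (simp add: vxy)
  then have "cmat A *\<^sub>v x = z \<cdot>\<^sub>v x" "cmat B *\<^sub>v y = z \<cdot>\<^sub>v y"
    using append_vec_eq[of "cmat A *\<^sub>v x" n "z \<cdot>\<^sub>v x"] A B xy by auto
  moreover have "x \<noteq> 0\<^sub>v n \<or> y \<noteq> 0\<^sub>v j"
    using v(2) by (auto simp: vxy)
  ultimately have "eigenvalue (cmat A) z \<or> eigenvalue (cmat B) z"
    using A B xy by (auto simp: eigenvalue_def eigenvector_def)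
  then show False
    using A B z by (auto simp: circle_regular_def)
qed

lemma tf_diag_block:
  assumes A: "A \<in> carrier_mat n n" "circle_regular A" and B: "B \<in> carrier_mat j j" "circle_regular B"
    and z: "norm z = 1"
    and x: "a \<in> carrier_vec n" "x \<in> carrier_vec n" and y: "b \<in> carrier_vec j" "y \<in> carrier_vec j"
  shows "tf (a @\<^sub>v b) (diag_block A B) (x @\<^sub>v y) z = tf a A x z + tf b B y z"
proof -
  obtain u where u: "u \<in> carrier_vec n"
      "\<forall>i<n. z * u $ i - (cmat A *\<^sub>v u) $ i = of_real (x $ i)" "tf a A x z = cvec a \<bullet> u"
    using tf_solution[OF A z x] .
  obtain w where w: "w \<in> carrier_vec j"
      "\<forall>i<j. z * w $ i - (cmat B *\<^sub>v w) $ i = of_real (y $ i)" "tf b B y z = cvec b \<bullet> w"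
    using tf_solution[OF B z y] .
  have "cmat (diag_block A B) = diag_block (cmat A) (cmat B)"
    using A B by (intro eq_matI) (auto simp: index_mat_four_block)
  then have mult: "cmat (diag_block A B) *\<^sub>v (u @\<^sub>v w) = (cmat A *\<^sub>v u) @\<^sub>v (cmat B *\<^sub>v w)"
    using diag_block_mult_append[of "cmat A" n "cmat B" j u w] A B u w by simp
  define p where "p = cmat A *\<^sub>v u"
  define q where "q = cmat B *\<^sub>v w"
  have pq: "p \<in> carrier_vec n" "q \<in> carrier_vec j"
    using A B u w by (simp_all add: p_def q_def)
  have "tf (a @\<^sub>v b) (diag_block A B) (x @\<^sub>v y) z = cvec (a @\<^sub>v b) \<bullet> (u @\<^sub>v w)"
  proof (rule tf_eqI[of _ "n + j"])
    show "diag_block A B \<in> carrier_mat (n + j) (n + j)"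
      using A B by (intro four_block_carrier_mat) auto
    show "circle_regular (diag_block A B)"
      by (rule circle_regular_diag_block[OF A B])
    fix i assume i: "i < n + j"
    show "z * (u @\<^sub>v w) $ i - (cmat (diag_block A B) *\<^sub>v (u @\<^sub>v w)) $ i = of_real ((x @\<^sub>v y) $ i)"
    proof (cases "i < n")
      case True
      then show ?thesis
        unfolding mult p_def[symmetric] q_def[symmetric]
        using u(1,2) w(1) x y pq by (simp add: p_def[symmetric])
    next
      case False
      then show ?thesis
        unfolding mult p_def[symmetric] q_def[symmetric]
        using i u(1) w(1,2) x y pq by (simp add: q_def[symmetric])
    qed
  qed (use z x y u w in auto)
  also have "cvec (a @\<^sub>v b) = cvec a @\<^sub>v cvec b"
    using x y by (intro eq_vecI) auto
  also have "(cvec a @\<^sub>v cvec b) \<bullet> (u @\<^sub>v w) = cvec a \<bullet> u + cvec b \<bullet> w"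
    using x y u w by (intro scalar_prod_append[of _ n _ j]) auto
  finally show ?thesis
    using u(3) w(3) by simp
qed

lemma tf_uminus_left:
  assumes M: "M \<in> carrier_mat m m" "circle_regular M" and z: "norm z = 1"
    and a: "a \<in> carrier_vec m" and x: "x \<in> carrier_vec m"
  shows "tf (- a) M x z = - tf a M x z"
proof -
  obtain u where u: "u \<in> carrier_vec m"
      "\<forall>i<m. z * u $ i - (cmat M *\<^sub>v u) $ i = of_real (x $ i)" "tf a M x z = cvec a \<bullet> u"
    using tf_solution[OF M z a x] .
  have "tf (- a) M x z = cvec (- a) \<bullet> u"
    using u by (intro tf_eqI[OF M z _ x]) (use a in auto)
  also have "\<dots> = - (cvec a \<bullet> u)"
    using a u(1) by (simp add: scalar_prod_def flip: sum_negf)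
  finally show ?thesis
    using u(3) by simp
qed

subsection \<open>Stable systems\<close>

lemma smult_pow_mat:
  fixes M :: "'a :: comm_semiring_1 mat"
  assumes M: "M \<in> carrier_mat m m"
  shows "(k \<cdot>\<^sub>m M) ^\<^sub>m p = k ^ p \<cdot>\<^sub>m (M ^\<^sub>m p)"
proof (induction p)
  case (Suc p)
  have "(k \<cdot>\<^sub>m M) ^\<^sub>m Suc p = (k ^ p \<cdot>\<^sub>m (M ^\<^sub>m p)) * (k \<cdot>\<^sub>m M)"
    by (simp add: Suc)
  also have "\<dots> = k ^ p \<cdot>\<^sub>m (k \<cdot>\<^sub>m (M ^\<^sub>m p * M))"
    using mult_smult_assoc_mat[OF pow_carrier_mat[OF M] smult_carrier_mat[OF M]]
      mult_smult_distrib[OF pow_carrier_mat[OF M] M] by simp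
  also have "\<dots> = k ^ Suc p \<cdot>\<^sub>m (M ^\<^sub>m Suc p)"
    using M by (intro eq_matI) (simp_all add: mult_ac)
  finally show ?case .
qed (use M in \<open>auto intro!: eq_matI\<close>)

lemma stable_imp_circle_regular:
  assumes M: "M \<in> carrier_mat m m" and stable: "spectral_radius (cmat M) < 1"
  shows "circle_regular M"
  unfolding circle_regular_def
proof (intro allI impI)
  fix z assume ev: "eigenvalue (cmat M) z"
  have M': "cmat M \<in> carrier_mat m m" using M by simp
  have "m > 0"
    using eigenvalue_imp_nonzero_dim[OF M' ev] .
  then have "cmod z \<le> spectral_radius (cmat M)"
    using ev by (intro spectral_radius_mem_max(2)[OF M']) (auto simp: spectrum_def)
  then show "cmod z \<noteq> 1"
    using stable by simp
qed

text \<open>Dividing \<open>M\<close> by a number \<open>t\<close> between its spectral radius and 1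
  keeps the spectral radius below 1, so the powers of the quotient stay bounded.\<close>

lemma stable_pow_bound:
  assumes M: "M \<in> carrier_mat m m" and m: "m > 0" and stable: "spectral_radius (cmat M) < 1"
  obtains K t where "K \<ge> 0" "0 \<le> t" "t < 1" "\<And>p i l. i < m \<Longrightarrow> l < m \<Longrightarrow> \<bar>(M ^\<^sub>m p) $$ (i, l)\<bar> \<le> K * t ^ p"
proof -
  have M': "cmat M \<in> carrier_mat m m" using M by simp
  define \<rho> where "\<rho> = spectral_radius (cmat M)"
  have "\<rho> \<ge> 0"
    using spectral_radius_mem_max(1)[OF M' m] by (auto simp: \<rho>_def)
  \<comment> \<open>The midpoint between the spectral radius and 1 is positive even if all
    eigenvalues are zero, so that division by \<open>t\<close> is possible.\<close>
  define t where "t = (1 + \<rho>) / 2"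
  have t: "0 < t" "t < 1" "\<rho> < t"
    using \<open>\<rho> \<ge> 0\<close> stable by (auto simp: t_def \<rho>_def)
  define k where "k = complex_of_real (1 / t)"
  have k: "k \<noteq> 0" "cmod k = 1 / t"
    using t by (auto simp: k_def norm_divide)
  define B where "B = k \<cdot>\<^sub>m cmat M"
  have B: "B \<in> carrier_mat m m"
    using M' by (simp add: B_def)
  have "spectral_radius B < 1"
  proof -
    obtain z where z: "eigenvalue B z" "spectral_radius B = cmod z"
      using spectral_radius_mem_max(1)[OF B m] by (auto simp: spectrum_def)
    then obtain v where v: "v \<in> carrier_vec m" "v \<noteq> 0\<^sub>v m" "B *\<^sub>v v = z \<cdot>\<^sub>v v"
      using B by (auto simp: eigenvalue_def eigenvector_def)
    define w where "w = cmat M *\<^sub>v v"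
    have w: "w \<in> carrier_vec m"
      using M' v by (simp add: w_def)
    have Bv: "B *\<^sub>v v = k \<cdot>\<^sub>v w"
      unfolding B_def w_def using M' v(1) by (intro eq_vecI) auto
    have "w = (z / k) \<cdot>\<^sub>v v"
    proof (rule eq_vecI)
      fix i assume "i < dim_vec ((z / k) \<cdot>\<^sub>v v)"
      then have "k * w $ i = z * v $ i"
        using arg_cong[OF v(3)[unfolded Bv], of "\<lambda>v. v $ i"] w v(1) by simp
      then show "w $ i = ((z / k) \<cdot>\<^sub>v v) $ i"
        using k(1) \<open>i < dim_vec ((z / k) \<cdot>\<^sub>v v)\<close> by (simp add: field_simps)
    qed (use w v in simp)
    then have "eigenvalue (cmat M) (z / k)"
      using M' v by (auto simp: eigenvalue_def eigenvector_def w_def)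
    then have "cmod (z / k) \<le> \<rho>"
      unfolding \<rho>_def by (intro spectral_radius_mem_max(2)[OF M' m]) (auto simp: spectrum_def)
    then have "cmod z * t \<le> \<rho>"
      using t k by (simp add: norm_divide)
    moreover have "1 * t \<le> cmod z * t" if "1 \<le> cmod z"
      using that t(1) by (intro mult_right_mono) auto
    ultimately show ?thesis
      using t(3) z(2) by linarith
  qed
  then obtain c where c: "\<And>p. norm_bound (B ^\<^sub>m p) c"
    using spectral_radius_jnf_norm_bound_less_1_upper_triangular[OF B] by blast
  have "\<bar>(M ^\<^sub>m p) $$ (i, l)\<bar> \<le> \<bar>c\<bar> * t ^ p" if il: "i < m" "l < m" for p i l
  proof -
    have Mp: "M ^\<^sub>m p \<in> carrier_mat m m"
      using M by simp
    have "cmod (w * of_real (X $$ (i, l))) \<le> c" if "norm_bound (w \<cdot>\<^sub>m cmat X) c" "X \<in> carrier_mat m m" for w X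
      using that il by (auto simp: norm_bound_def)
    moreover have "norm_bound (k ^ p \<cdot>\<^sub>m cmat (M ^\<^sub>m p)) c"
      using c[of p] unfolding B_def smult_pow_mat[OF M'] of_real_hom.mat_hom_pow[OF M] .
    ultimately have "cmod (k ^ p * of_real ((M ^\<^sub>m p) $$ (i, l))) \<le> c"
      using Mp by blast
    then have "\<bar>(M ^\<^sub>m p) $$ (i, l)\<bar> / t ^ p \<le> c"
      using k(2) by (simp add: norm_mult norm_power divide_inverse power_inverse mult.commute)
    then have "\<bar>(M ^\<^sub>m p) $$ (i, l)\<bar> \<le> c * t ^ p"
      using t by (simp add: field_simps)
    also have "\<dots> \<le> \<bar>c\<bar> * t ^ p"
      using t by (intro mult_right_mono) auto
    finally show ?thesis .
  qed
  then show thesis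
    using t by (intro that[of "\<bar>c\<bar>" t]) auto
qed

lemma scalar_prod_mult_mat_vec:
  "X \<in> carrier_mat m m \<Longrightarrow> x \<in> carrier_vec m \<Longrightarrow>
    a \<bullet> (X *\<^sub>v x) = (\<Sum>i<m. \<Sum>l<m. a $ i * (X $$ (i, l) * x $ l))"
  for X :: "'a :: semiring_0 mat"
  by (simp add: scalar_prod_def atLeast0LessThan sum_distrib_left)

lemma stable_pow_vec_bound:
  assumes M: "M \<in> carrier_mat m m" and stable: "spectral_radius (cmat M) < 1"
    and a: "a \<in> carrier_vec m" and x: "x \<in> carrier_vec m"
  obtains K t where "K \<ge> 0" "0 \<le> t" "t < 1" "\<forall>p. \<bar>a \<bullet> (M ^\<^sub>m p *\<^sub>v x)\<bar> \<le> K * t ^ p"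
proof (cases "m = 0")
  case True
  then have "a \<bullet> (M ^\<^sub>m p *\<^sub>v x) = 0" for p
    using M by (simp add: scalar_prod_def)
  then show ?thesis
    by (intro that[of 0 0]) auto
next
  case False
  obtain K t where Kt: "K \<ge> 0" "0 \<le> t" "t < 1" "\<And>p i l. i < m \<Longrightarrow> l < m \<Longrightarrow> \<bar>(M ^\<^sub>m p) $$ (i, l)\<bar> \<le> K * t ^ p"
    using stable_pow_bound[OF M _ stable] False by auto
  have "\<bar>a \<bullet> (M ^\<^sub>m p *\<^sub>v x)\<bar> \<le> (\<Sum>i<m. \<Sum>l<m. \<bar>a $ i\<bar> * (K * \<bar>x $ l\<bar>)) * t ^ p" for p
  proof -
    have Mp: "M ^\<^sub>m p \<in> carrier_mat m m"
      using M by simp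
    have "a \<bullet> (M ^\<^sub>m p *\<^sub>v x) = (\<Sum>i<m. \<Sum>l<m. a $ i * ((M ^\<^sub>m p) $$ (i, l) * x $ l))"
      by (rule scalar_prod_mult_mat_vec[OF Mp x])
    also have "\<bar>\<dots>\<bar> \<le> (\<Sum>i<m. \<Sum>l<m. \<bar>a $ i * ((M ^\<^sub>m p) $$ (i, l) * x $ l)\<bar>)"
      by (intro order_trans[OF sum_abs] sum_mono sum_abs)
    also have "\<dots> \<le> (\<Sum>i<m. \<Sum>l<m. (\<bar>a $ i\<bar> * (K * \<bar>x $ l\<bar>)) * t ^ p)"
    proof (intro sum_mono)
      fix i l assume "i \<in> {..<m}" "l \<in> {..<m}"
      then have "\<bar>(M ^\<^sub>m p) $$ (i, l)\<bar> * \<bar>x $ l\<bar> \<le> (K * t ^ p) * \<bar>x $ l\<bar>"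
        using Kt(4) by (intro mult_right_mono) auto
      then have "\<bar>a $ i\<bar> * (\<bar>(M ^\<^sub>m p) $$ (i, l)\<bar> * \<bar>x $ l\<bar>) \<le> \<bar>a $ i\<bar> * ((K * t ^ p) * \<bar>x $ l\<bar>)"
        by (intro mult_left_mono) auto
      then show "\<bar>a $ i * ((M ^\<^sub>m p) $$ (i, l) * x $ l)\<bar> \<le> (\<bar>a $ i\<bar> * (K * \<bar>x $ l\<bar>)) * t ^ p"
        by (simp add: abs_mult mult_ac)
    qed
    finally show ?thesis
      by (simp only: sum_distrib_right)
  qed
  then show ?thesis
    using Kt(1-3) by (intro that[of "\<Sum>i<m. \<Sum>l<m. \<bar>a $ i\<bar> * (K * \<bar>x $ l\<bar>)" t]) (auto intro!: sum_nonneg)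
qed

lemma stable_summable:
  assumes "M \<in> carrier_mat m m" "spectral_radius (cmat M) < 1" "a \<in> carrier_vec m" "x \<in> carrier_vec m"
  shows "summable (\<lambda>p. \<bar>a \<bullet> (M ^\<^sub>m p *\<^sub>v x)\<bar>)"
proof -
  obtain K t where Kt: "K \<ge> 0" "0 \<le> t" "t < 1" "\<forall>p. \<bar>a \<bullet> (M ^\<^sub>m p *\<^sub>v x)\<bar> \<le> K * t ^ p"
    by (rule stable_pow_vec_bound[OF assms])
  have "summable (\<lambda>p. K * t ^ p)"
    using Kt by (intro summable_mult summable_geometric) auto
  then show ?thesis
    by (rule summable_comparison_test[rotated]) (use Kt in auto)
qed

lemma stable_tendsto_0:
  assumes "M \<in> carrier_mat m m" "spectral_radius (cmat M) < 1" "a \<in> carrier_vec m" "x \<in> carrier_vec m"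
  shows "(\<lambda>p. a \<bullet> (M ^\<^sub>m p *\<^sub>v x)) \<longlonglongrightarrow> 0"
  using summable_LIMSEQ_zero[OF stable_summable[OF assms]] by (rule tendsto_rabs_zero_cancel)

text \<open>Iteration of \<open>tf_mult_mat\<close> gives the Laurent expansion at infinity with an
  exact remainder. Stability enters afterwards, to make the remainder vanish.\<close>

lemma tf_expansion:
  assumes M: "M \<in> carrier_mat m m" "circle_regular M" and z: "norm z = 1"
    and a: "a \<in> carrier_vec m" and x: "x \<in> carrier_vec m"
  shows "tf a M x z = (\<Sum>u<N. of_real (a \<bullet> (M ^\<^sub>m u *\<^sub>v x)) * z powi (- int u - 1))
    + z powi (- int N) * tf a M (M ^\<^sub>m N *\<^sub>v x) z"
proof (induction N)
  case 0
  then show ?case using M x by simp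
next
  case (Suc N)
  have nz: "z \<noteq> 0" using z by auto
  define y where "y = M ^\<^sub>m N *\<^sub>v x"
  have y: "y \<in> carrier_vec m"
    unfolding y_def using M(1) x by (intro mult_mat_vec_carrier[of _ m m] pow_carrier_mat) auto
  have "M ^\<^sub>m Suc N *\<^sub>v x = M *\<^sub>v y"
    unfolding pow_mat_Suc_left[OF M(1)] y_def by (rule assoc_mult_mat_vec[OF M(1) pow_carrier_mat[OF M(1)] x])
  then have "tf a M (M ^\<^sub>m Suc N *\<^sub>v x) z = z * tf a M y z - of_real (a \<bullet> y)"
    using tf_mult_mat[OF M z a y] by simp
  moreover have "- int (Suc N) = - int N - 1"
    by simp
  moreover have "z powi (- int N - 1) * z = z powi (- int N)"
    using nz by (simp add: power_int_diff)
  moreover have "w * (z * s - t) = (w * z) * s - t * w" for w s t :: complex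
    by (simp add: algebra_simps)
  ultimately have "z powi (- int (Suc N)) * tf a M (M ^\<^sub>m Suc N *\<^sub>v x) z
      = z powi (- int N) * tf a M y z - of_real (a \<bullet> y) * z powi (- int N - 1)"
    by (simp only:)
  then show ?case
    unfolding Suc by (simp only: sum.lessThan_Suc y_def) simp
qed

text \<open>Transposition moves the resolvent to the fixed vector \<open>a\<close>; the transfer
  function becomes a linear form in the entries of \<open>y N\<close> whose coefficients do not
  depend on \<open>N\<close>.\<close>

lemma tf_tendsto_0:
  assumes M: "M \<in> carrier_mat m m" "circle_regular M" and z: "norm z = 1" and a: "a \<in> carrier_vec m"
    and y: "\<And>N. y N \<in> carrier_vec m" "\<And>i. i < m \<Longrightarrow> (\<lambda>N. y N $ i) \<longlonglongrightarrow> 0"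
  shows "(\<lambda>N. tf a M (y N) z) \<longlonglongrightarrow> 0"
proof -
  have MT: "M\<^sup>T \<in> carrier_mat m m" "circle_regular M\<^sup>T"
    using M circle_regular_transpose[OF M] by auto
  obtain v where v: "v \<in> carrier_vec m" "\<forall>i<m. z * v $ i - (cmat M\<^sup>T *\<^sub>v v) $ i = of_real (a $ i)"
    using tf_solution[OF MT z a a] by metis
  have "tf a M (y N) z = cvec (y N) \<bullet> v" for N
    using tf_transpose[OF M z a y(1)] tf_eqI[OF MT z y(1) a v(1)] v(2) by simp
  also have "cvec (y N) \<bullet> v = (\<Sum>i<m. of_real (y N $ i) * v $ i)" for N
    unfolding scalar_prod_def using v(1) carrier_vecD[OF y(1), of N] by (intro sum.cong) auto
  finally have tf_v: "tf a M (y N) z = (\<Sum>i<m. of_real (y N $ i) * v $ i)" for N .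
  have "(\<lambda>N. \<Sum>i<m. of_real (y N $ i) * v $ i) \<longlonglongrightarrow> (\<Sum>i<m. of_real 0 * v $ i)"
    by (intro tendsto_sum tendsto_mult tendsto_of_real tendsto_const y(2)) auto
  then show ?thesis
    by (simp add: tf_v)
qed

lemma stable_pow_vec_tendsto_0:
  assumes "M \<in> carrier_mat m m" "spectral_radius (cmat M) < 1" "x \<in> carrier_vec m" "i < m"
  shows "(\<lambda>N. (M ^\<^sub>m N *\<^sub>v x) $ i) \<longlonglongrightarrow> 0"
  using stable_tendsto_0[OF assms(1,2) unit_vec_carrier[of m i] assms(3)]
    scalar_prod_left_unit[OF mult_mat_vec_carrier[OF pow_carrier_mat[OF assms(1)] assms(3)] assms(4)] by simp

lemma tf_sums:
  assumes M: "M \<in> carrier_mat m m" and stable: "spectral_radius (cmat M) < 1" and z: "norm z = 1"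
    and a: "a \<in> carrier_vec m" and x: "x \<in> carrier_vec m"
  shows "(\<lambda>u. of_real (a \<bullet> (M ^\<^sub>m u *\<^sub>v x)) * z powi (- int u - 1)) sums tf a M x z"
proof -
  have reg: "circle_regular M"
    by (rule stable_imp_circle_regular[OF M stable])
  have "(\<lambda>N. tf a M (M ^\<^sub>m N *\<^sub>v x) z) \<longlonglongrightarrow> 0"
    by (rule tf_tendsto_0[OF M reg z a mult_mat_vec_carrier[OF pow_carrier_mat[OF M] x]
          stable_pow_vec_tendsto_0[OF M stable x]])
  then have "(\<lambda>N. z powi (- int N) * tf a M (M ^\<^sub>m N *\<^sub>v x) z) \<longlonglongrightarrow> 0"
    unfolding tendsto_norm_zero_iff[symmetric, of "\<lambda>N. z powi (- int N) * tf a M (M ^\<^sub>m N *\<^sub>v x) z"]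
      norm_mult norm_powi_circle[OF z] mult_1_left by (rule tendsto_norm_zero)
  then have "(\<lambda>N. tf a M x z - z powi (- int N) * tf a M (M ^\<^sub>m N *\<^sub>v x) z) \<longlonglongrightarrow> tf a M x z - 0"
    by (intro tendsto_diff tendsto_const)
  moreover have "tf a M x z - z powi (- int N) * tf a M (M ^\<^sub>m N *\<^sub>v x) z
      = (\<Sum>u<N. of_real (a \<bullet> (M ^\<^sub>m u *\<^sub>v x)) * z powi (- int u - 1))" for N
    using tf_expansion[OF M reg z a x, of N] by (simp only: add_diff_cancel_right')
  ultimately show ?thesis
    by (simp add: sums_def)
qed

subsection \<open>Stein equations in matrix form\<close>

definition outer :: "real vec \<Rightarrow> real vec \<Rightarrow> real mat" where
  "outer a b = mat (dim_vec a) (dim_vec b) (\<lambda>(i, l). a $ i * b $ l)"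

lemma outer_carrier [simp]: "a \<in> carrier_vec k \<Longrightarrow> b \<in> carrier_vec m \<Longrightarrow> outer a b \<in> carrier_mat k m"
  by (simp add: outer_def)

lemma outer_index [simp]: "i < dim_vec a \<Longrightarrow> l < dim_vec b \<Longrightarrow> outer a b $$ (i, l) = a $ i * b $ l"
  by (simp add: outer_def)

lemma outer_dim [simp]: "dim_row (outer a b) = dim_vec a" "dim_col (outer a b) = dim_vec b"
  by (simp_all add: outer_def)

lemma outer_mult_vec: "y \<in> carrier_vec (dim_vec b) \<Longrightarrow> outer a b *\<^sub>v y = (b \<bullet> y) \<cdot>\<^sub>v a"
  by (intro eq_vecI) (auto simp: outer_def scalar_prod_def sum_distrib_left mult_ac)

lemma outer_transpose: "(outer a b)\<^sup>T = outer b a"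
  by (intro eq_matI) auto

lemma mult_outer:
  assumes "X \<in> carrier_mat k m" "a \<in> carrier_vec m"
  shows "X * outer a b = outer (X *\<^sub>v a) b"
  using assms by (intro eq_matI) (auto simp: scalar_prod_def outer_def sum_distrib_right mult.assoc)

lemma outer_mult:
  assumes "Y \<in> carrier_mat m k" "b \<in> carrier_vec m"
  shows "outer a b * Y = outer a (Y\<^sup>T *\<^sub>v b)"
  using assms by (intro eq_matI) (auto simp: scalar_prod_def outer_def sum_distrib_left mult_ac)

lemma eq_mat_on_vec:
  fixes A B :: "real mat"
  assumes A: "A \<in> carrier_mat k m" and B: "B \<in> carrier_mat k m"
    and eq: "\<And>v. v \<in> carrier_vec m \<Longrightarrow> A *\<^sub>v v = B *\<^sub>v v"
  shows "A = B"
proof (rule eq_matI)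
  fix i l assume "i < dim_row B" "l < dim_col B"
  then have il: "i < k" "l < m" using B by auto
  have "(A *\<^sub>v unit_vec m l) $ i = (B *\<^sub>v unit_vec m l) $ i"
    by (simp only: eq[OF unit_vec_carrier])
  then show "A $$ (i, l) = B $$ (i, l)"
    using A B il by (simp add: scalar_prod_right_unit)
qed (use A B in auto)

lemma linear_subspace_unit_vecs:
  assumes V: "linear_subspace m V" and unit: "\<And>i. i < m \<Longrightarrow> unit_vec m i \<in> V" and y: "y \<in> carrier_vec m"
  shows "y \<in> V"
proof -
  have "vec m (\<lambda>i. if i < k then y $ i else 0) \<in> V" if "k \<le> m" for k
    using that
  proof (induction k)
    case 0
    have "vec m (\<lambda>i. if i < 0 then y $ i else 0) = 0\<^sub>v m"
      by (intro eq_vecI) auto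
    then show ?case
      using linear_subspaceD(2)[OF V] by simp
  next
    case (Suc k)
    have "vec m (\<lambda>i. if i < Suc k then y $ i else 0)
        = vec m (\<lambda>i. if i < k then y $ i else 0) + y $ k \<cdot>\<^sub>v unit_vec m k"
      using Suc.prems by (intro eq_vecI) (auto simp: less_Suc_eq)
    then show ?case
      using Suc V unit[of k] by (simp add: linear_subspaceD)
  qed
  from this[of m] have "vec m (\<lambda>i. if i < m then y $ i else 0) \<in> V" by simp
  moreover have "vec m (\<lambda>i. if i < m then y $ i else 0) = y"
    using y by (intro eq_vecI) auto
  ultimately show ?thesis by simp
qed

context allpass_system
begin

definition Pmat :: "real mat" where
  "Pmat = mat m m (\<lambda>(i, l). P (unit_vec m l) $ i)"

lemma Pmat_carrier: "Pmat \<in> carrier_mat m m"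
  by (simp add: Pmat_def)

lemma Pmat_mult:
  assumes y: "y \<in> carrier_vec m"
  shows "Pmat *\<^sub>v y = P y"
proof -
  let ?V = "{y \<in> carrier_vec m. Pmat *\<^sub>v y = P y}"
  have P0: "P (0\<^sub>v m) = 0\<^sub>v m"
    by (rule P_eqI) (auto simp: tf_zero[OF M regular _ a] tf_zero[OF MT _ b] G_def)
  have "linear_subspace m ?V"
    unfolding linear_subspace_def
    using mult_mat_zero_vec[OF Pmat_carrier]
    by (auto simp: P0 P_add P_smult mult_add_distrib_mat_vec[OF Pmat_carrier] mult_mat_vec[OF Pmat_carrier])
  moreover have "unit_vec m l \<in> ?V" if l: "l < m" for l
  proof -
    have "P (unit_vec m l) \<in> carrier_vec m"
      by (rule P(1)) simp
    then have "Pmat *\<^sub>v unit_vec m l = P (unit_vec m l)"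
      using l by (intro eq_vecI) (auto simp: Pmat_def scalar_prod_right_unit)
    then show ?thesis by simp
  qed
  ultimately have "y \<in> ?V"
    using y by (rule linear_subspace_unit_vecs)
  then show ?thesis by simp
qed

lemma Pmat_stein: "Pmat = M * Pmat * M\<^sup>T + outer b b"
proof (rule eq_mat_on_vec[OF Pmat_carrier])
  show "M * Pmat * M\<^sup>T + outer b b \<in> carrier_mat m m"
    using M b Pmat_carrier by auto
  fix y :: "real vec" assume y: "y \<in> carrier_vec m"
  have My: "M\<^sup>T *\<^sub>v y \<in> carrier_vec m"
    using MT y by simp
  have "(M * Pmat * M\<^sup>T) *\<^sub>v y = M *\<^sub>v (Pmat *\<^sub>v (M\<^sup>T *\<^sub>v y))"
    using assoc_mult_mat_vec[OF mult_carrier_mat[OF M Pmat_carrier] MT(1) y]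
      assoc_mult_mat_vec[OF M Pmat_carrier My] by simp
  then have 1: "(M * Pmat * M\<^sup>T) *\<^sub>v y = M *\<^sub>v P (M\<^sup>T *\<^sub>v y)"
    by (simp only: Pmat_mult[OF My])
  have 2: "(M * Pmat * M\<^sup>T + outer b b) *\<^sub>v y = (M * Pmat * M\<^sup>T) *\<^sub>v y + outer b b *\<^sub>v y"
    using y b M Pmat_carrier by (intro add_mult_distrib_mat_vec[of _ m m]) auto
  define v where "v = M *\<^sub>v P (M\<^sup>T *\<^sub>v y)"
  have v: "v \<in> carrier_vec m"
    unfolding v_def by (rule mult_mat_vec_carrier[OF M P(1)[OF My]])
  have Py: "P y \<in> carrier_vec m"
    by (rule P(1)[OF y])
  have "outer b b *\<^sub>v y = P y - v"
    using P_stein[OF y] outer_mult_vec[of y b b] y b by (simp add: v_def)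
  then have "(M * Pmat * M\<^sup>T + outer b b) *\<^sub>v y = v + (P y - v)"
    unfolding 1 2 v_def[symmetric] by simp
  also have "\<dots> = P y"
    using v Py by (intro eq_vecI) auto
  finally show "Pmat *\<^sub>v y = (M * Pmat * M\<^sup>T + outer b b) *\<^sub>v y"
    by (simp only: Pmat_mult[OF y])
qed

lemma transposed_Pmat_Pmat: "allpass_system.Pmat m M\<^sup>T b a c * Pmat = \<sigma>\<^sup>2 \<cdot>\<^sub>m 1\<^sub>m m"
proof -
  interpret Q: allpass_system m "M\<^sup>T" b a c \<sigma>
    by (rule transposed)
  show ?thesis
  proof (rule eq_mat_on_vec[of _ m m])
    fix y :: "real vec" assume y: "y \<in> carrier_vec m"
    have "(Q.Pmat * Pmat) *\<^sub>v y = Q.Pmat *\<^sub>v P y"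
      using assoc_mult_mat_vec[OF Q.Pmat_carrier Pmat_carrier y] by (simp only: Pmat_mult[OF y])
    also have "\<dots> = \<sigma>\<^sup>2 \<cdot>\<^sub>v y"
      using transposed_P_P[OF y] by (simp only: Q.Pmat_mult[OF P(1)[OF y]])
    finally show "(Q.Pmat * Pmat) *\<^sub>v y = (\<sigma>\<^sup>2 \<cdot>\<^sub>m 1\<^sub>m m) *\<^sub>v y"
      by (simp only: smult_one_mult_vec[OF y])
  qed (use Q.Pmat_carrier Pmat_carrier in auto)
qed

end

lemma four_block_mat_inject:
  assumes "A \<in> carrier_mat n n" "B \<in> carrier_mat n j" "C \<in> carrier_mat j n" "D \<in> carrier_mat j j"
    and "A' \<in> carrier_mat n n" "B' \<in> carrier_mat n j" "C' \<in> carrier_mat j n" "D' \<in> carrier_mat j j"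
    and eq: "four_block_mat A B C D = four_block_mat A' B' C' D'"
  shows "A = A'" "B = B'" "C = C'" "D = D'"
proof -
  have e: "four_block_mat A B C D $$ (i, l) = four_block_mat A' B' C' D' $$ (i, l)" for i l
    by (simp only: eq)
  show "A = A'"
  proof (rule eq_matI)
    fix i l assume "i < dim_row A'" "l < dim_col A'"
    then show "A $$ (i, l) = A' $$ (i, l)" using e[of i l] assms(1-8) by auto
  qed (use assms in auto)
  show "B = B'"
  proof (rule eq_matI)
    fix i l assume "i < dim_row B'" "l < dim_col B'"
    then show "B $$ (i, l) = B' $$ (i, l)" using e[of i "n + l"] assms(1-8) by auto
  qed (use assms in auto)
  show "C = C'"
  proof (rule eq_matI)
    fix i l assume "i < dim_row C'" "l < dim_col C'"
    then show "C $$ (i, l) = C' $$ (i, l)" using e[of "n + i" l] assms(1-8) by auto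
  qed (use assms in auto)
  show "D = D'"
  proof (rule eq_matI)
    fix i l assume "i < dim_row D'" "l < dim_col D'"
    then show "D $$ (i, l) = D' $$ (i, l)" using e[of "n + i" "n + l"] assms(1-8) by auto
  qed (use assms in auto)
qed

lemma diag_block_mult_four_block:
  fixes A B C D X11 X12 X21 X22 :: "real mat"
  assumes A: "A \<in> carrier_mat n n" and B: "B \<in> carrier_mat j j"
    and C: "C \<in> carrier_mat n n" and D: "D \<in> carrier_mat j j"
    and X: "X11 \<in> carrier_mat n n" "X12 \<in> carrier_mat n j" "X21 \<in> carrier_mat j n" "X22 \<in> carrier_mat j j"
  shows "diag_block A B * four_block_mat X11 X12 X21 X22 * diag_block C D
    = four_block_mat (A * X11 * C) (A * X12 * D) (B * X21 * C) (B * X22 * D)"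
proof -
  have "diag_block A B * four_block_mat X11 X12 X21 X22 = four_block_mat (A * X11) (A * X12) (B * X21) (B * X22)"
    using A B X by (subst mult_four_block_mat[of _ n n _ j _ j _ _ n _ j]) auto
  also have "\<dots> * diag_block C D = four_block_mat (A * X11 * C) (A * X12 * D) (B * X21 * C) (B * X22 * D)"
    using A B C D X by (subst mult_four_block_mat[of _ n n _ j _ j _ _ n _ j]) auto
  finally show ?thesis .
qed

lemma outer_append:
  assumes "a \<in> carrier_vec n" "a' \<in> carrier_vec j" "b \<in> carrier_vec n" "b' \<in> carrier_vec j"
  shows "outer (a @\<^sub>v a') (b @\<^sub>v b') = four_block_mat (outer a b) (outer a b') (outer a' b) (outer a' b')"
  using assms by (intro eq_matI) auto

lemma transpose_diag_block:
  assumes "A \<in> carrier_mat n n" "B \<in> carrier_mat j j"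
  shows "(diag_block A B)\<^sup>T = diag_block A\<^sup>T B\<^sup>T"
  using assms by (intro eq_matI) auto

lemma stein_blocks:
  fixes A B C D X11 X12 X21 X22 :: "real mat"
  assumes A: "A \<in> carrier_mat n n" and B: "B \<in> carrier_mat j j"
    and C: "C \<in> carrier_mat n n" and D: "D \<in> carrier_mat j j"
    and X: "X11 \<in> carrier_mat n n" "X12 \<in> carrier_mat n j" "X21 \<in> carrier_mat j n" "X22 \<in> carrier_mat j j"
    and v: "v \<in> carrier_vec n" "w \<in> carrier_vec j"
    and eq: "four_block_mat X11 X12 X21 X22
      = diag_block A B * four_block_mat X11 X12 X21 X22 * diag_block C D + outer (v @\<^sub>v w) (v @\<^sub>v w)"
  shows "X11 = A * X11 * C + outer v v" "X12 = A * X12 * D + outer v w"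
    "X21 = B * X21 * C + outer w v"
proof -
  have "diag_block A B * four_block_mat X11 X12 X21 X22 * diag_block C D + outer (v @\<^sub>v w) (v @\<^sub>v w)
      = four_block_mat (A * X11 * C + outer v v) (A * X12 * D + outer v w)
          (B * X21 * C + outer w v) (B * X22 * D + outer w w)"
    unfolding diag_block_mult_four_block[OF A B C D X] outer_append[OF v v]
    using A B C D X v by (intro add_four_block_mat[of _ n n _ j _ j]) auto
  then have eq': "four_block_mat X11 X12 X21 X22 = four_block_mat (A * X11 * C + outer v v) (A * X12 * D + outer v w)
          (B * X21 * C + outer w v) (B * X22 * D + outer w w)"
    using eq by simp
  note inj = four_block_mat_inject[OF X _ _ _ _ eq']
  show "X11 = A * X11 * C + outer v v" "X12 = A * X12 * D + outer v w" "X21 = B * X21 * C + outer w v"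
    using A B C D X v by (intro inj; simp)+
qed

text \<open>The matrices \<open>A^p X (A^p)^T\<close> tend to zero and their consecutive differences
  are the terms of the Gramian, so the series telescopes to \<open>X\<close>. This identifies the
  leading blocks of \<open>P\<close> and \<open>Q\<close>.\<close>

lemma stein_unique:
  fixes A X :: "real mat"
  assumes A: "A \<in> carrier_mat n n" and stable: "spectral_radius (cmat A) < 1"
    and X: "X \<in> carrier_mat n n" and b: "b \<in> carrier_vec n" and eq: "X = A * X * A\<^sup>T + outer b b"
    and il: "i < n" "l < n"
  shows "(\<lambda>p. (A ^\<^sub>m p *\<^sub>v b) $ i * (A ^\<^sub>m p *\<^sub>v b) $ l) sums X $$ (i, l)"
proof -
  define S where "S = (\<lambda>p. A ^\<^sub>m p * X * (A ^\<^sub>m p)\<^sup>T)"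
  have Ap: "A ^\<^sub>m p \<in> carrier_mat n n" for p
    using A by simp
  have step: "S p = S (Suc p) + outer (A ^\<^sub>m p *\<^sub>v b) (A ^\<^sub>m p *\<^sub>v b)" for p
  proof -
    define Y where "Y = A ^\<^sub>m p"
    have Y: "Y \<in> carrier_mat n n" "Y\<^sup>T \<in> carrier_mat n n"
      using Ap by (simp_all add: Y_def)
    have AT: "A\<^sup>T \<in> carrier_mat n n" using A by simp
    have AXA: "A * X * A\<^sup>T \<in> carrier_mat n n" using A X by auto
    have bb: "outer b b \<in> carrier_mat n n" using b by simp
    have "S p = Y * (A * X * A\<^sup>T + outer b b) * Y\<^sup>T"
      using eq by (simp add: S_def Y_def)
    also have "\<dots> = Y * (A * X * A\<^sup>T) * Y\<^sup>T + Y * outer b b * Y\<^sup>T"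
      using Y AXA bb by (simp add: mult_add_distrib_mat[of _ n n _ n] add_mult_distrib_mat[of _ n n _ _ n])
    also have "Y * outer b b * Y\<^sup>T = outer (Y *\<^sub>v b) (Y *\<^sub>v b)"
      using Y b by (simp add: mult_outer[of _ n n] outer_mult[of _ n n])
    also have "Y * (A * X * A\<^sup>T) * Y\<^sup>T = (Y * A) * X * (Y * A)\<^sup>T"
    proof -
      have "Y * (A * X * A\<^sup>T) * Y\<^sup>T = (Y * (A * X)) * A\<^sup>T * Y\<^sup>T"
        using assoc_mult_mat[OF Y(1) mult_carrier_mat[OF A X] AT] by simp
      also have "\<dots> = ((Y * A) * X) * A\<^sup>T * Y\<^sup>T"
        using assoc_mult_mat[OF Y(1) A X] by simp
      also have "\<dots> = ((Y * A) * X) * (A\<^sup>T * Y\<^sup>T)"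
        by (rule assoc_mult_mat[OF mult_carrier_mat[OF mult_carrier_mat[OF Y(1) A] X] AT Y(2)])
      finally show ?thesis
        using transpose_mult[OF Y(1) A] by simp
    qed
    also have "(Y * A) * X * (Y * A)\<^sup>T = S (Suc p)"
      by (simp add: S_def Y_def)
    finally show ?thesis
      by (simp add: Y_def)
  qed
  have S_carrier: "S p \<in> carrier_mat n n" for p
    using Ap[of p] X by (auto simp: S_def)
  have Apb: "A ^\<^sub>m p *\<^sub>v b \<in> carrier_vec n" for p
    using mult_mat_vec_carrier[OF Ap b] .
  have S_diff: "S p $$ (i, l) - S (Suc p) $$ (i, l) = (A ^\<^sub>m p *\<^sub>v b) $ i * (A ^\<^sub>m p *\<^sub>v b) $ l" for p
  proof -
    define g where "g = A ^\<^sub>m p *\<^sub>v b"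
    have "g \<in> carrier_vec n"
      unfolding g_def by (rule Apb)
    then have "S p $$ (i, l) = S (Suc p) $$ (i, l) + g $ i * g $ l"
      using step[of p] S_carrier[of "Suc p"] il by (simp flip: g_def)
    then show ?thesis
      by (simp flip: g_def)
  qed
  have coord: "(\<lambda>p. (A ^\<^sub>m p) $$ (i, k)) \<longlonglongrightarrow> 0" if "i < n" "k < n" for i k
  proof -
    have "unit_vec n i \<bullet> (A ^\<^sub>m p *\<^sub>v unit_vec n k) = (A ^\<^sub>m p) $$ (i, k)" for p
    proof -
      have "unit_vec n i \<bullet> (Y *\<^sub>v unit_vec n k) = Y $$ (i, k)" if "Y \<in> carrier_mat n n" for Y :: "real mat"
        using that \<open>i < n\<close> \<open>k < n\<close> scalar_prod_left_unit[OF mult_mat_vec_carrier[OF that unit_vec_carrier]]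
        by (simp add: scalar_prod_right_unit)
      then show ?thesis using Ap by blast
    qed
    then show ?thesis
      using stable_tendsto_0[OF A stable unit_vec_carrier[of n i] unit_vec_carrier[of n k]] by simp
  qed
  have S_index: "S p $$ (i, l) = (\<Sum>a<n. (A ^\<^sub>m p) $$ (i, a) * (\<Sum>b<n. X $$ (a, b) * (A ^\<^sub>m p) $$ (l, b)))" for p
  proof -
    have "(Y * X * Y\<^sup>T) $$ (i, l) = (\<Sum>a<n. Y $$ (i, a) * (\<Sum>b<n. X $$ (a, b) * Y $$ (l, b)))"
      if "Y \<in> carrier_mat n n" for Y
      using that X il by (simp add: scalar_prod_def atLeast0LessThan)
    then show ?thesis
      using Ap by (simp add: S_def)
  qed
  have "(\<lambda>p. S p $$ (i, l)) \<longlonglongrightarrow> (\<Sum>a<n. 0 * (\<Sum>b<n. X $$ (a, b) * 0))"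
    unfolding S_index by (intro tendsto_sum tendsto_mult tendsto_const coord il) auto
  then have "(\<lambda>p. S p $$ (i, l)) \<longlonglongrightarrow> 0"
    by simp
  then have "(\<lambda>p. S p $$ (i, l) - S (Suc p) $$ (i, l)) sums (S 0 $$ (i, l) - 0)"
    by (rule telescope_sums')
  moreover have "S 0 = X"
    using A X by (simp add: S_def)
  ultimately show ?thesis
    by (simp only: S_diff diff_zero)
qed

subsection \<open>Pseudo-inverse of a row\<close>

text \<open>Penrose's argument: \<open>M X\<close> and \<open>M Y\<close> are the same orthogonal
  projection, and so are \<open>X M\<close> and \<open>Y M\<close>; then
  \<open>X = Y M X = Y M Y = Y\<close>.\<close>

lemma pseudo_inverse_unique:
  assumes X: "is_pseudo_inverse M X" and Y: "is_pseudo_inverse M Y"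
  shows "X = Y"
proof -
  define k m where "k = dim_row M" and "m = dim_col M"
  have M: "M \<in> carrier_mat k m"
    by (simp add: k_def m_def)
  have Xc: "X \<in> carrier_mat m k" and Yc: "Y \<in> carrier_mat m k"
    using X Y by (simp_all add: is_pseudo_inverse_def k_def m_def)
  note MX = mult_carrier_mat[OF M Xc] and MY = mult_carrier_mat[OF M Yc]
    and XM = mult_carrier_mat[OF Xc M] and YM = mult_carrier_mat[OF Yc M]
  have X': "M * X * M = M" "X * M * X = X" "(M * X)\<^sup>T = M * X" "(X * M)\<^sup>T = X * M"
    using X by (simp_all add: is_pseudo_inverse_def)
  have Y': "M * Y * M = M" "Y * M * Y = Y" "(M * Y)\<^sup>T = M * Y" "(Y * M)\<^sup>T = Y * M"
    using Y by (simp_all add: is_pseudo_inverse_def)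
  have "(M * X) * (M * Y) = M * Y"
    using assoc_mult_mat[OF MX M Yc] X'(1) by metis
  then have "(M * Y)\<^sup>T * (M * X)\<^sup>T = (M * Y)\<^sup>T"
    using transpose_mult[OF MX MY] by simp
  then have "(M * Y) * (M * X) = M * Y"
    by (simp only: X' Y')
  moreover have "(M * Y) * (M * X) = M * X"
    using assoc_mult_mat[OF MY M Xc] Y'(1) by metis
  ultimately have 1: "M * X = M * Y" by simp
  have "(Y * M) * (X * M) = Y * M"
    using assoc_mult_mat[OF Yc M XM] assoc_mult_mat[OF M Xc M] X'(1) by metis
  then have "(X * M)\<^sup>T * (Y * M)\<^sup>T = (Y * M)\<^sup>T"
    using transpose_mult[OF YM XM] by simp
  then have "(X * M) * (Y * M) = Y * M"
    by (simp only: X' Y')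
  moreover have "(X * M) * (Y * M) = X * M"
    using assoc_mult_mat[OF Xc M YM] assoc_mult_mat[OF M Yc M] Y'(1) by metis
  ultimately have 2: "X * M = Y * M" by simp
  have "X = Y * M * X"
    using X'(2) 2 by simp
  also have "\<dots> = Y * (M * Y)"
    using assoc_mult_mat[OF Yc M Xc] 1 by simp
  also have "\<dots> = Y"
    using assoc_mult_mat[OF Yc M Yc] Y'(2) by simp
  finally show ?thesis .
qed

lemma mat_of_col_carrier [simp]: "v \<in> carrier_vec k \<Longrightarrow> mat_of_col v \<in> carrier_mat k 1"
  by (auto simp: mat_of_col_def)

lemma mat_of_col_index [simp]: "i < dim_vec v \<Longrightarrow> mat_of_col v $$ (i, 0) = v $ i"
  by (simp add: mat_of_col_def mat_of_cols_index)

lemma mat_of_col_dim [simp]: "dim_row (mat_of_col v) = dim_vec v" "dim_col (mat_of_col v) = 1"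
  by (simp_all add: mat_of_col_def)

lemma col_mat_of_col [simp]: "col (mat_of_col v) 0 = v"
  by (intro eq_vecI) (auto simp: col_def)

lemma mat_of_col_mult_mat_of_row: "mat_of_col w * mat_of_row v = outer w v"
  by (intro eq_matI) (auto simp: mat_of_row_def scalar_prod_def)

lemma pseudo_inverse_mat_of_row:
  assumes v: "v \<in> carrier_vec k" "v \<noteq> 0\<^sub>v k"
  shows "pseudo_inverse (mat_of_row v) = (1 / (v \<bullet> v)) \<cdot>\<^sub>m mat_of_col v"
proof -
  let ?M = "mat_of_row v" and ?X = "(1 / (v \<bullet> v)) \<cdot>\<^sub>m mat_of_col v"
  have vv: "v \<bullet> v \<noteq> 0"
    using scalar_prod_self_eq_0[OF v(1)] v(2) by blast
  have M: "?M \<in> carrier_mat 1 k" and X: "?X \<in> carrier_mat k 1"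
    using v by auto
  have MX: "?M * ?X = 1\<^sub>m 1"
  proof (rule eq_matI)
    fix i l assume "i < dim_row (1\<^sub>m 1 :: real mat)" "l < dim_col (1\<^sub>m 1 :: real mat)"
    then have "i = 0" "l = 0" by auto
    then show "(?M * ?X) $$ (i, l) = 1\<^sub>m 1 $$ (i, l)"
      using v(1) vv by simp
  qed (use v in auto)
  have XM: "?X * ?M = (1 / (v \<bullet> v)) \<cdot>\<^sub>m outer v v"
    unfolding mult_smult_assoc_mat[OF mat_of_col_carrier[OF v(1)] M] mat_of_col_mult_mat_of_row ..
  have "(?X * ?M)\<^sup>T = ?X * ?M"
    unfolding XM by (intro eq_matI) auto
  moreover have "?X * ?M * ?X = ?X * (?M * ?X)"
    by (rule assoc_mult_mat[OF X M X])
  moreover have "?X * (?M * ?X) = ?X"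
    unfolding MX by (rule right_mult_one_mat[OF X])
  moreover have "?M * ?X * ?M = ?M"
    unfolding MX by (rule left_mult_one_mat[OF M])
  moreover have "(?M * ?X)\<^sup>T = ?M * ?X"
    unfolding MX by (rule transpose_one)
  moreover have "?X \<in> carrier_mat (dim_col ?M) (dim_row ?M)"
    using X M by (metis carrier_matD)
  ultimately have "is_pseudo_inverse ?M ?X"
    unfolding is_pseudo_inverse_def by metis
  then show ?thesis
    unfolding pseudo_inverse_def using pseudo_inverse_unique by blast
qed

text \<open>This is how the pseudo-inverse enters the final formulas: for nonzero \<open>v\<close>
  it recovers \<open>w\<close> from a rank-one matrix.\<close>

lemma outer_mult_pseudo_inverse:
  assumes v: "v \<in> carrier_vec k" "v \<noteq> 0\<^sub>v k" and w: "w \<in> carrier_vec m"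
  shows "outer w v * pseudo_inverse (mat_of_row v) = mat_of_col w"
proof -
  have vv: "v \<bullet> v \<noteq> 0"
    using scalar_prod_self_eq_0[OF v(1)] v(2) by blast
  show ?thesis
  proof (rule eq_matI)
    fix i l assume "i < dim_row (mat_of_col w)" "l < dim_col (mat_of_col w)"
    then have il: "i < m" "l = 0" using w by auto
    have "row (outer w v) i = w $ i \<cdot>\<^sub>v v"
      using il w by (intro eq_vecI) auto
    then show "(outer w v * pseudo_inverse (mat_of_row v)) $$ (i, l) = mat_of_col w $$ (i, l)"
      unfolding pseudo_inverse_mat_of_row[OF v] using il v(1) w vv by simp
  qed (use v w in \<open>auto simp: pseudo_inverse_mat_of_row\<close>)
qed

subsection \<open>Blocks of the Gramians\<close>

text \<open>Iterating the equation would express \<open>Y\<close> by a series in powers of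
  \<open>B\<close> and \<open>A\<close>, which need not converge because \<open>B\<close> may be
  unstable. Orthogonality of \<open>x\<close> to the range of \<open>Y\<close> gives instead a
  defect with \<open>\<delta> c = z \<delta> (A c)\<close>; its modulus is unchanged when
  \<open>c\<close> is replaced by \<open>A c\<close>, yet tends to zero along
  \<open>A^N c\<close>.\<close>

lemma tf_stein_orthogonal:
  assumes A: "A \<in> carrier_mat n n" "spectral_radius (cmat A) < 1" and B: "B \<in> carrier_mat j j" "circle_regular B"
    and Y: "Y \<in> carrier_mat j n" and v: "v \<in> carrier_vec n" and w: "w \<in> carrier_vec j"
    and eq: "Y = B * Y * A + outer w v"
    and x: "x \<in> carrier_vec j" "Y\<^sup>T *\<^sub>v x = 0\<^sub>v n" and c: "c \<in> carrier_vec n" and z: "norm z = 1"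
  shows "tf x B (Y *\<^sub>v c) z = tf x B w z * (cnj z * tf v A c (cnj z))"
proof -
  have regA: "circle_regular A"
    by (rule stable_imp_circle_regular[OF A])
  have cz: "norm (cnj z) = 1" using z by simp
  define \<tau> where "\<tau> = tf x B w z"
  define \<delta> where "\<delta> = (\<lambda>c. tf x B (Y *\<^sub>v c) z - \<tau> * (cnj z * tf v A c (cnj z)))"
  have Yc: "Y *\<^sub>v c \<in> carrier_vec j" if "c \<in> carrier_vec n" for c
    using Y that by (rule mult_mat_vec_carrier)
  have Ac: "A *\<^sub>v c \<in> carrier_vec n" if "c \<in> carrier_vec n" for c
    using A(1) that by (rule mult_mat_vec_carrier)
  have \<delta>_step: "\<delta> c = z * \<delta> (A *\<^sub>v c)" if c: "c \<in> carrier_vec n" for c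
  proof -
    define y where "y = Y *\<^sub>v (A *\<^sub>v c)"
    have y: "y \<in> carrier_vec j"
      unfolding y_def by (intro Yc Ac c)
    have By: "B *\<^sub>v y \<in> carrier_vec j"
      using B(1) y by (rule mult_mat_vec_carrier)
    \<comment> \<open>Orthogonality removes the constant that \<open>tf_mult_mat\<close> would
      produce on the side of \<open>B\<close>.\<close>
    have "x \<bullet> y = (Y\<^sup>T *\<^sub>v x) \<bullet> (A *\<^sub>v c)"
      unfolding y_def by (rule transpose_vec_mult_scalar[OF Y Ac[OF c] x(1), symmetric])
    also have "\<dots> = 0"
      unfolding x(2) using Ac[OF c] by (rule scalar_prod_left_zero)
    finally have xy: "x \<bullet> y = 0" .
    have "Y *\<^sub>v c = (B * Y * A + outer w v) *\<^sub>v c"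
      using eq by simp
    also have "\<dots> = (B * Y * A) *\<^sub>v c + outer w v *\<^sub>v c"
      using B(1) Y A(1) v w c by (intro add_mult_distrib_mat_vec[of _ j n]) auto
    also have "(B * Y * A) *\<^sub>v c = B *\<^sub>v y"
      using assoc_mult_mat_vec[OF mult_carrier_mat[OF B(1) Y] A(1) c] assoc_mult_mat_vec[OF B(1) Y Ac[OF c]]
      by (simp add: y_def)
    also have "outer w v *\<^sub>v c = (v \<bullet> c) \<cdot>\<^sub>v w"
      using c v by (intro outer_mult_vec) simp
    finally have "tf x B (Y *\<^sub>v c) z = tf x B (B *\<^sub>v y) z + tf x B ((v \<bullet> c) \<cdot>\<^sub>v w) z"
      using tf_add[OF B z x(1) By smult_carrier_vec[THEN iffD2, OF w]] by simp
    also have "\<dots> = z * tf x B y z + of_real (v \<bullet> c) * \<tau>"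
      using tf_mult_mat[OF B z x(1) y] tf_smult[OF B z x(1) w] by (simp add: xy \<tau>_def)
    finally have 1: "tf x B (Y *\<^sub>v c) z = z * tf x B y z + of_real (v \<bullet> c) * \<tau>" .
    have 2: "tf v A (A *\<^sub>v c) (cnj z) = cnj z * tf v A c (cnj z) - of_real (v \<bullet> c)"
      by (rule tf_mult_mat[OF A(1) regA cz v c])
    have 3: "z * (\<tau> * (cnj z * s)) = \<tau> * s" for s
      using circle_mult_cnj[OF z] by (metis mult.assoc mult.left_commute mult_1_left)
    show ?thesis
      unfolding \<delta>_def 1 2 y_def[symmetric] right_diff_distrib 3 by (simp only: algebra_simps)
  qed
  have AN: "A ^\<^sub>m N *\<^sub>v c \<in> carrier_vec n" for N
    by (rule mult_mat_vec_carrier[OF pow_carrier_mat[OF A(1)] c])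
  have iter: "\<delta> c = z ^ N * \<delta> (A ^\<^sub>m N *\<^sub>v c)" for N
  proof (induction N)
    case 0
    then show ?case using A c by simp
  next
    case (Suc N)
    have "A ^\<^sub>m Suc N *\<^sub>v c = A *\<^sub>v (A ^\<^sub>m N *\<^sub>v c)"
      unfolding pow_mat_Suc_left[OF A(1)] by (rule assoc_mult_mat_vec[OF A(1) pow_carrier_mat[OF A(1)] c])
    then show ?case
      using Suc \<delta>_step[OF AN] by simp
  qed
  have "(\<lambda>N. tf x B (Y *\<^sub>v (A ^\<^sub>m N *\<^sub>v c)) z) \<longlonglongrightarrow> 0"
  proof (rule tf_tendsto_0[OF B z x(1) Yc[OF AN]])
    fix i assume i: "i < j"
    have "(Y *\<^sub>v (A ^\<^sub>m N *\<^sub>v c)) $ i = row Y i \<bullet> (A ^\<^sub>m N *\<^sub>v c)" for N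
      using i Y by simp
    then show "(\<lambda>N. (Y *\<^sub>v (A ^\<^sub>m N *\<^sub>v c)) $ i) \<longlonglongrightarrow> 0"
      using stable_tendsto_0[OF A row_carrier_vec[OF i Y] c] by simp
  qed
  moreover have "(\<lambda>N. tf v A (A ^\<^sub>m N *\<^sub>v c) (cnj z)) \<longlonglongrightarrow> 0"
    by (rule tf_tendsto_0[OF A(1) regA cz v AN stable_pow_vec_tendsto_0[OF A c]])
  ultimately have "(\<lambda>N. \<delta> (A ^\<^sub>m N *\<^sub>v c)) \<longlonglongrightarrow> 0 - \<tau> * (cnj z * 0)"
    unfolding \<delta>_def by (intro tendsto_diff tendsto_mult tendsto_const)
  then have "(\<lambda>N. norm (\<delta> (A ^\<^sub>m N *\<^sub>v c))) \<longlonglongrightarrow> 0"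
    by (intro tendsto_norm_zero) simp
  moreover have "norm (\<delta> (A ^\<^sub>m N *\<^sub>v c)) = norm (\<delta> c)" for N
    using arg_cong[OF iter[of N], of norm] z by (simp add: norm_mult norm_power)
  ultimately have "\<delta> c = 0"
    by (simp add: LIMSEQ_const_iff)
  then show ?thesis
    by (simp add: \<delta>_def \<tau>_def)
qed

text \<open>Since its last \<open>r\<close> columns vanish, \<open>W\<close> sees only the first
  part of a vector. Testing the equation on vectors whose second or first part is zero yields the
  two blocks.\<close>

lemma stein_first_block:
  assumes A11: "A11 \<in> carrier_mat p p" and A12: "A12 \<in> carrier_mat p r" and A22: "A22 \<in> carrier_mat r r"
    and B: "B \<in> carrier_mat j j" and W: "W \<in> carrier_mat j (p + r)"
    and v: "v1 \<in> carrier_vec p" "v2 \<in> carrier_vec r" and w: "w \<in> carrier_vec j"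
    and eq: "W = B * W * four_block_mat A11 A12 (A12\<^sup>T) A22 + outer w (v1 @\<^sub>v v2)"
    and zero: "\<And>k i. k < j \<Longrightarrow> p \<le> i \<Longrightarrow> i < p + r \<Longrightarrow> W $$ (k, i) = 0"
    and W1: "W1 = mat j p (\<lambda>(k, i). W $$ (k, i))"
  shows "W1 = B * W1 * A11 + outer w v1" "0\<^sub>m j r = B * W1 * A12 + outer w v2"
proof -
  let ?A = "four_block_mat A11 A12 (A12\<^sup>T) A22"
  have A: "?A \<in> carrier_mat (p + r) (p + r)"
    using A11 A22 by (intro four_block_carrier_mat) auto
  have A21: "A12\<^sup>T \<in> carrier_mat r p" using A12 by simp
  have W1c: "W1 \<in> carrier_mat j p"
    by (simp add: W1)
  have W_append: "W *\<^sub>v (c @\<^sub>v d) = W1 *\<^sub>v c" if c: "c \<in> carrier_vec p" and d: "d \<in> carrier_vec r" for c d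
  proof (rule eq_vecI)
    fix k assume "k < dim_vec (W1 *\<^sub>v c)"
    then have k: "k < j" using W1c by simp
    have "(W *\<^sub>v (c @\<^sub>v d)) $ k = (\<Sum>i<p + r. W $$ (k, i) * (c @\<^sub>v d) $ i)"
      using k W c d by (simp add: scalar_prod_def atLeast0LessThan)
    also have "\<dots> = (\<Sum>i<p. W $$ (k, i) * (c @\<^sub>v d) $ i)"
      using zero[OF k] by (intro sum.mono_neutral_right) auto
    also have "\<dots> = (\<Sum>i<p. W1 $$ (k, i) * c $ i)"
      using k c by (intro sum.cong) (auto simp: W1)
    also have "\<dots> = (W1 *\<^sub>v c) $ k"
      using k c W1c by (simp add: scalar_prod_def atLeast0LessThan)
    finally show "(W *\<^sub>v (c @\<^sub>v d)) $ k = (W1 *\<^sub>v c) $ k" .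
  qed (use W W1c in auto)
  have main: "W1 *\<^sub>v c = B *\<^sub>v (W1 *\<^sub>v (A11 *\<^sub>v c + A12 *\<^sub>v d)) + (v1 \<bullet> c + v2 \<bullet> d) \<cdot>\<^sub>v w"
    if c: "c \<in> carrier_vec p" and d: "d \<in> carrier_vec r" for c d
  proof -
    have cd: "c @\<^sub>v d \<in> carrier_vec (p + r)" using c d by simp
    have mult: "?A *\<^sub>v (c @\<^sub>v d) = (A11 *\<^sub>v c + A12 *\<^sub>v d) @\<^sub>v (A12\<^sup>T *\<^sub>v c + A22 *\<^sub>v d)"
      by (rule four_block_mat_mult_vec[OF A11 A12 A21 A22 c d])
    have c1: "A11 *\<^sub>v c + A12 *\<^sub>v d \<in> carrier_vec p" "A12\<^sup>T *\<^sub>v c + A22 *\<^sub>v d \<in> carrier_vec r"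
      by (rule add_carrier_vec[OF mult_mat_vec_carrier[OF A11 c] mult_mat_vec_carrier[OF A12 d]],
          rule add_carrier_vec[OF mult_mat_vec_carrier[OF A21 c] mult_mat_vec_carrier[OF A22 d]])
    have "W *\<^sub>v (c @\<^sub>v d) = (B * W * ?A + outer w (v1 @\<^sub>v v2)) *\<^sub>v (c @\<^sub>v d)"
      using eq by simp
    also have "\<dots> = (B * W * ?A) *\<^sub>v (c @\<^sub>v d) + outer w (v1 @\<^sub>v v2) *\<^sub>v (c @\<^sub>v d)"
      using B W A v w cd by (intro add_mult_distrib_mat_vec[of _ j "p + r"]) auto
    also have "(B * W * ?A) *\<^sub>v (c @\<^sub>v d) = B *\<^sub>v (W *\<^sub>v (?A *\<^sub>v (c @\<^sub>v d)))"
      using assoc_mult_mat_vec[OF mult_carrier_mat[OF B W] A cd]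
        assoc_mult_mat_vec[OF B W mult_mat_vec_carrier[OF A cd]] by simp
    also have "\<dots> = B *\<^sub>v (W1 *\<^sub>v (A11 *\<^sub>v c + A12 *\<^sub>v d))"
      by (simp only: mult W_append[OF c1])
    also have "outer w (v1 @\<^sub>v v2) *\<^sub>v (c @\<^sub>v d) = (v1 \<bullet> c + v2 \<bullet> d) \<cdot>\<^sub>v w"
      using outer_mult_vec[of "c @\<^sub>v d" "v1 @\<^sub>v v2" w] cd c d v scalar_prod_append[OF v c d] by simp
    finally show ?thesis
      by (simp only: W_append[OF c d])
  qed
  show "W1 = B * W1 * A11 + outer w v1"
  proof (rule eq_mat_on_vec[OF W1c])
    fix c :: "real vec" assume c: "c \<in> carrier_vec p"
    have Ac: "A11 *\<^sub>v c \<in> carrier_vec p" using A11 c by simp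
    have "A12 *\<^sub>v 0\<^sub>v r = 0\<^sub>v p" by (rule mult_mat_zero_vec[OF A12])
    then have "W1 *\<^sub>v c = B *\<^sub>v (W1 *\<^sub>v (A11 *\<^sub>v c)) + (v1 \<bullet> c) \<cdot>\<^sub>v w"
      using main[OF c zero_carrier_vec] Ac v by simp
    also have "\<dots> = (B * W1 * A11) *\<^sub>v c + outer w v1 *\<^sub>v c"
      using assoc_mult_mat_vec[OF mult_carrier_mat[OF B W1c] A11 c] assoc_mult_mat_vec[OF B W1c Ac]
        outer_mult_vec[of c v1 w] c v by simp
    also have "\<dots> = (B * W1 * A11 + outer w v1) *\<^sub>v c"
      using B W1c A11 c v w by (intro add_mult_distrib_mat_vec[of _ j p, symmetric]) auto
    finally show "W1 *\<^sub>v c = (B * W1 * A11 + outer w v1) *\<^sub>v c" .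
  qed (use B W1c A11 v w in auto)
  show "0\<^sub>m j r = B * W1 * A12 + outer w v2"
  proof (rule eq_mat_on_vec[of _ j r])
    fix d :: "real vec" assume d: "d \<in> carrier_vec r"
    have Ad: "A12 *\<^sub>v d \<in> carrier_vec p" using A12 d by simp
    have "0\<^sub>m j r *\<^sub>v d = W1 *\<^sub>v 0\<^sub>v p"
      unfolding mult_mat_zero_vec[OF W1c] using d by (intro eq_vecI) auto
    also have "\<dots> = B *\<^sub>v (W1 *\<^sub>v (A12 *\<^sub>v d)) + (v2 \<bullet> d) \<cdot>\<^sub>v w"
      using main[OF zero_carrier_vec d] mult_mat_zero_vec[OF A11] Ad v by simp
    also have "\<dots> = (B * W1 * A12) *\<^sub>v d + outer w v2 *\<^sub>v d"
      using assoc_mult_mat_vec[OF mult_carrier_mat[OF B W1c] A12 d] assoc_mult_mat_vec[OF B W1c Ad]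
        outer_mult_vec[of d v2 w] d v by simp
    also have "\<dots> = (B * W1 * A12 + outer w v2) *\<^sub>v d"
      using B W1c A12 d v w by (intro add_mult_distrib_mat_vec[of _ j r, symmetric]) auto
    finally show "0\<^sub>m j r *\<^sub>v d = (B * W1 * A12 + outer w v2) *\<^sub>v d" .
  qed (use B W1c A12 v w in auto)
qed

text \<open>Compare the traces of \<open>T * S\<close> and \<open>S * T\<close>.\<close>

lemma inverse_imp_same_dim:
  fixes T S :: "real mat"
  assumes T: "T \<in> carrier_mat j p" and S: "S \<in> carrier_mat p j"
    and TS: "T * S = 1\<^sub>m j" and ST: "S * T = 1\<^sub>m p"
  shows "j = p"
proof -
  have "real j = (\<Sum>i<j. (T * S) $$ (i, i))"
    by (simp add: TS)
  also have "\<dots> = (\<Sum>i<j. \<Sum>k<p. T $$ (i, k) * S $$ (k, i))"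
    using T S by (simp add: scalar_prod_def atLeast0LessThan)
  also have "\<dots> = (\<Sum>k<p. \<Sum>i<j. S $$ (k, i) * T $$ (i, k))"
    by (subst sum.swap) (simp add: mult.commute)
  also have "\<dots> = (\<Sum>k<p. (S * T) $$ (k, k))"
    using T S by (simp add: scalar_prod_def atLeast0LessThan)
  also have "\<dots> = real p"
    by (simp add: ST)
  finally show ?thesis by simp
qed

lemma diagonal_mult_index:
  fixes D :: "'a :: semiring_0 mat"
  assumes D: "D \<in> carrier_mat p p" "diagonal_mat D" and X: "X \<in> carrier_mat p q" and i: "i < p" "l < q"
  shows "(D * X) $$ (i, l) = D $$ (i, i) * X $$ (i, l)"
proof -
  have "(D * X) $$ (i, l) = (\<Sum>k<p. D $$ (i, k) * X $$ (k, l))"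
    using D(1) X i by (simp add: scalar_prod_def atLeast0LessThan)
  also have "\<dots> = (\<Sum>k\<in>{i}. D $$ (i, k) * X $$ (k, l))"
    using D i by (intro sum.mono_neutral_right) (auto simp: diagonal_mat_def)
  finally show ?thesis by simp
qed

text \<open>The first rows and columns of \<open>eq\<close> say \<open>X1 * T = R\<close>, so
  \<open>S = R^-1 X1\<close> is a left inverse of \<open>T\<close>. Injectivity of
  \<open>Y\<^sup>T\<close>, which passes to \<open>T\<^sup>T\<close>, makes it two-sided. The
  remaining rows of \<open>X\<close> annihilate \<open>T\<close> from the left and hence
  vanish.\<close>

lemma gramian_blocks:
  fixes \<Sigma> R X Y :: "real mat" and s :: real
  assumes Sigma: "\<Sigma> \<in> carrier_mat p p" "diagonal_mat \<Sigma>" "\<And>i. i < p \<Longrightarrow> (\<Sigma> $$ (i, i))\<^sup>2 \<noteq> s\<^sup>2"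
    and R: "R = s\<^sup>2 \<cdot>\<^sub>m 1\<^sub>m p - \<Sigma> * \<Sigma>"
    and D: "D = four_block_mat \<Sigma> (0\<^sub>m p r) (0\<^sub>m r p) (s \<cdot>\<^sub>m 1\<^sub>m r)"
    and Y: "Y \<in> carrier_mat j (p + r)" and X: "X \<in> carrier_mat (p + r) j"
    and zero: "\<And>k i. k < j \<Longrightarrow> p \<le> i \<Longrightarrow> i < p + r \<Longrightarrow> Y $$ (k, i) = 0"
    and inj: "\<And>x. x \<in> carrier_vec j \<Longrightarrow> Y\<^sup>T *\<^sub>v x = 0\<^sub>v (p + r) \<Longrightarrow> x = 0\<^sub>v j"
    and eq: "D * D + X * Y = s\<^sup>2 \<cdot>\<^sub>m 1\<^sub>m (p + r)"
    and T: "T = mat j p (\<lambda>(k, i). Y $$ (k, i))" and X1: "X1 = mat p j (\<lambda>(i, k). X $$ (i, k))"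
  obtains S where "S \<in> carrier_mat p j" "T * S = 1\<^sub>m j" "S * T = 1\<^sub>m p" "X1 = R * S"
    "\<forall>i k. p \<le> i \<longrightarrow> i < p + r \<longrightarrow> k < j \<longrightarrow> X $$ (i, k) = 0"
proof -
  have Tc: "T \<in> carrier_mat j p" and X1c: "X1 \<in> carrier_mat p j"
    by (simp_all add: T X1)
  have SS: "\<Sigma> * \<Sigma> \<in> carrier_mat p p" using Sigma by auto
  have Rc: "R \<in> carrier_mat p p" unfolding R by (rule minus_carrier_mat[OF SS])
  have "D * D = four_block_mat (\<Sigma> * \<Sigma>) (0\<^sub>m p r) (0\<^sub>m r p) ((s \<cdot>\<^sub>m 1\<^sub>m r) * (s \<cdot>\<^sub>m 1\<^sub>m r))"
    unfolding D using Sigma(1) by (subst mult_four_block_mat[of _ p p _ r _ r _ _ p _ r]) auto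
  then have DD: "(D * D) $$ (i, l) = (if i < p then (\<Sigma> * \<Sigma>) $$ (i, l) else 0)" if il: "i < p + r" "l < p" for i l
  proof -
    have "four_block_mat Z (0\<^sub>m p r) (0\<^sub>m r p) W $$ (i, l) = (if i < p then Z $$ (i, l) else 0)"
      if "Z \<in> carrier_mat p p" "W \<in> carrier_mat r r" for Z W :: "real mat"
      using il that by auto
    moreover have "(s \<cdot>\<^sub>m 1\<^sub>m r) * (s \<cdot>\<^sub>m 1\<^sub>m r) \<in> carrier_mat r r"
      by (rule mult_carrier_mat[of _ _ r]) simp_all
    ultimately show ?thesis
      using \<open>D * D = _\<close> SS by metis
  qed
  have DDc: "D * D \<in> carrier_mat (p + r) (p + r)"
    unfolding D using Sigma(1) by (intro mult_carrier_mat four_block_carrier_mat) auto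
  have XY: "(X * Y) $$ (i, l) = (\<Sum>k<j. X $$ (i, k) * Y $$ (k, l))" if "i < p + r" "l < p + r" for i l
    using X Y that by (simp add: scalar_prod_def atLeast0LessThan)
  have XY': "(D * D) $$ (i, l) + (X * Y) $$ (i, l) = s\<^sup>2 * (if i = l then 1 else 0)" if "i < p + r" "l < p + r" for i l
    using arg_cong[OF eq, of "\<lambda>Z. Z $$ (i, l)"] that DDc X Y by simp
  have R_entry: "R $$ (i, l) = s\<^sup>2 * (if i = l then 1 else 0) - (\<Sigma> * \<Sigma>) $$ (i, l)" if "i < p" "l < p" for i l
  proof -
    have "(s\<^sup>2 \<cdot>\<^sub>m 1\<^sub>m p - Z) $$ (i, l) = s\<^sup>2 * (if i = l then 1 else 0) - Z $$ (i, l)"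
      if "Z \<in> carrier_mat p p" for Z
      using that \<open>i < p\<close> \<open>l < p\<close> by auto
    then show ?thesis
      unfolding R using SS by blast
  qed
  have X1T: "X1 * T = R"
  proof (rule eq_matI)
    fix i l assume "i < dim_row R" "l < dim_col R"
    then have il: "i < p" "l < p" using Rc by auto
    then have "(X1 * T) $$ (i, l) = (X * Y) $$ (i, l)"
      using XY[of i l] by (simp add: T X1 scalar_prod_def atLeast0LessThan)
    then show "(X1 * T) $$ (i, l) = R $$ (i, l)"
      using XY'[of i l] DD[of i l] il R_entry[of i l] by simp
  qed (use Rc Tc X1c in auto)
  \<comment> \<open>\<open>R\<close> is invertible because no diagonal entry of
    \<open>\<Sigma>\<close> has the square \<open>s\<^sup>2\<close>.\<close>
  define Ri where "Ri = mat p p (\<lambda>(i, l). if i = l then 1 / R $$ (i, i) else 0)"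
  have Ric: "Ri \<in> carrier_mat p p" "diagonal_mat Ri"
    by (auto simp: Ri_def diagonal_mat_def)
  have R_index: "R $$ (i, l) = (if i = l then s\<^sup>2 - (\<Sigma> $$ (i, i))\<^sup>2 else 0)" if il: "i < p" "l < p" for i l
  proof -
    have "(\<Sigma> * \<Sigma>) $$ (i, l) = \<Sigma> $$ (i, i) * \<Sigma> $$ (i, l)"
      by (rule diagonal_mult_index[OF Sigma(1,2,1) il])
    also have "\<dots> = (if i = l then (\<Sigma> $$ (i, i))\<^sup>2 else 0)"
      using Sigma(1,2) il by (auto simp: diagonal_mat_def power2_eq_square)
    finally show ?thesis
      using R_entry[OF il] by simp
  qed
  have R_diag: "diagonal_mat R"
    using R_index Rc by (auto simp: diagonal_mat_def)
  have R_nz: "R $$ (i, i) \<noteq> 0" if "i < p" for i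
    using R_index[OF that that] Sigma(3)[OF that] by simp
  have Ri_index: "Ri $$ (i, l) = (if i = l then 1 / R $$ (i, i) else 0)" if "i < p" "l < p" for i l
    using that by (simp add: Ri_def)
  have RiR: "Ri * R = 1\<^sub>m p"
  proof (rule eq_matI)
    fix i l assume "i < dim_row (1\<^sub>m p :: real mat)" "l < dim_col (1\<^sub>m p :: real mat)"
    then have il: "i < p" "l < p" by simp_all
    show "(Ri * R) $$ (i, l) = 1\<^sub>m p $$ (i, l)"
      unfolding diagonal_mult_index[OF Ric Rc il] Ri_index[OF il(1,1)]
      using R_index[OF il] R_nz[OF il(1)] il by auto
  qed (use Ric Rc in auto)
  have RRi: "R * Ri = 1\<^sub>m p"
  proof (rule eq_matI)
    fix i l assume "i < dim_row (1\<^sub>m p :: real mat)" "l < dim_col (1\<^sub>m p :: real mat)"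
    then have il: "i < p" "l < p" by simp_all
    show "(R * Ri) $$ (i, l) = 1\<^sub>m p $$ (i, l)"
      unfolding diagonal_mult_index[OF Rc R_diag Ric(1) il] Ri_index[OF il]
      using R_nz[OF il(1)] il by auto
  qed (use Ric Rc in auto)
  define S where "S = Ri * X1"
  have Sc: "S \<in> carrier_mat p j"
    using Ric X1c by (simp add: S_def)
  have ST: "S * T = 1\<^sub>m p"
    unfolding S_def assoc_mult_mat[OF Ric(1) X1c Tc] X1T by (rule RiR)
  have RS: "X1 = R * S"
    unfolding S_def assoc_mult_mat[OF Rc Ric(1) X1c, symmetric] RRi using X1c by simp
  have TSc: "T * S \<in> carrier_mat j j"
    using Tc Sc by simp
  have TS: "T * S = 1\<^sub>m j"
  proof -
    \<comment> \<open>The matrix \<open>N\<close> satisfies \<open>N * T = 0\<close>, so the range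
      of \<open>N\<^sup>T\<close> lies in the kernel of \<open>T\<^sup>T\<close>.\<close>
    define N where "N = T * S - 1\<^sub>m j"
    have Nc: "N \<in> carrier_mat j j"
      by (simp add: N_def minus_carrier_mat)
    have "N * T = T * S * T - 1\<^sub>m j * T"
      unfolding N_def by (rule minus_mult_distrib_mat[OF TSc one_carrier_mat Tc])
    also have "\<dots> = T - T"
      unfolding assoc_mult_mat[OF Tc Sc Tc] ST using Tc by simp
    also have "\<dots> = 0\<^sub>m j p"
      using Tc by (intro eq_matI) auto
    finally have NT: "T\<^sup>T * N\<^sup>T = 0\<^sub>m p j"
      using transpose_mult[OF Nc Tc] by simp
    have NTc: "N\<^sup>T \<in> carrier_mat j j" and TTc: "T\<^sup>T \<in> carrier_mat p j"
      using Nc Tc by simp_all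
    have "N\<^sup>T = 0\<^sub>m j j"
    proof (rule eq_mat_on_vec[OF NTc zero_carrier_mat])
      fix v :: "real vec" assume v: "v \<in> carrier_vec j"
      define x where "x = N\<^sup>T *\<^sub>v v"
      have x: "x \<in> carrier_vec j"
        unfolding x_def using NTc v by (rule mult_mat_vec_carrier)
      have "T\<^sup>T *\<^sub>v x = 0\<^sub>v p"
        unfolding x_def assoc_mult_mat_vec[OF TTc NTc v, symmetric] NT using v by (intro eq_vecI) auto
      then have "(T\<^sup>T *\<^sub>v x) $ i = 0" if "i < p" for i
        using that by (simp del: index_mult_mat_vec)
      moreover have "(T\<^sup>T *\<^sub>v x) $ i = (\<Sum>k<j. T $$ (k, i) * x $ k)" if "i < p" for i
        using that Tc x by (simp add: scalar_prod_def atLeast0LessThan)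
      ultimately have Tx: "(\<Sum>k<j. T $$ (k, i) * x $ k) = 0" if "i < p" for i
        using that by simp
      have "Y\<^sup>T *\<^sub>v x = 0\<^sub>v (p + r)"
      proof (rule eq_vecI)
        fix i assume "i < dim_vec (0\<^sub>v (p + r) :: real vec)"
        then have i: "i < p + r" by simp
        have "(Y\<^sup>T *\<^sub>v x) $ i = (\<Sum>k<j. Y $$ (k, i) * x $ k)"
          using i Y x by (simp add: scalar_prod_def atLeast0LessThan)
        also have "\<dots> = 0"
        proof (cases "i < p")
          case True
          then show ?thesis using Tx[OF True] by (simp add: T)
        next
          case False
          then show ?thesis using zero i by (intro sum.neutral) auto
        qed
        finally show "(Y\<^sup>T *\<^sub>v x) $ i = 0\<^sub>v (p + r) $ i"
          using i by simp
      qed (use Y in simp)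
      then have "x = 0\<^sub>v j"
        by (rule inj[OF x])
      then show "N\<^sup>T *\<^sub>v v = 0\<^sub>m j j *\<^sub>v v"
        using v by (intro eq_vecI) (auto simp: x_def)
    qed
    then have "N\<^sup>T $$ (i, l) = 0" if "i < j" "l < j" for i l
      using that by simp
    then have N0: "N $$ (l, i) = 0" if "i < j" "l < j" for i l
      using that Nc by simp
    show ?thesis
    proof (rule eq_matI)
      fix i l assume "i < dim_row (1\<^sub>m j :: real mat)" "l < dim_col (1\<^sub>m j :: real mat)"
      then have il: "i < j" "l < j" by simp_all
      then have "N $$ (i, l) = (T * S) $$ (i, l) - 1\<^sub>m j $$ (i, l)"
        unfolding N_def using TSc by (intro index_minus_mat) simp_all
      then show "(T * S) $$ (i, l) = 1\<^sub>m j $$ (i, l)"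
        using N0[OF il(2,1)] by simp
    qed (use TSc in auto)
  qed
  define X2 where "X2 = mat r j (\<lambda>(i, k). X $$ (p + i, k))"
  have X2c: "X2 \<in> carrier_mat r j"
    by (simp add: X2_def)
  have "X2 * T = 0\<^sub>m r p"
  proof (rule eq_matI)
    fix i l assume "i < dim_row (0\<^sub>m r p :: real mat)" "l < dim_col (0\<^sub>m r p :: real mat)"
    then have il: "i < r" "l < p" by simp_all
    then have "(X2 * T) $$ (i, l) = (X * Y) $$ (p + i, l)"
      using XY[of "p + i" l] by (simp add: T X2_def scalar_prod_def atLeast0LessThan)
    then show "(X2 * T) $$ (i, l) = 0\<^sub>m r p $$ (i, l)"
      using XY'[of "p + i" l] DD[of "p + i" l] il by simp
  qed (use X2c Tc in auto)
  then have "X2 * T * S = 0\<^sub>m r j"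
    using Sc by simp
  then have X20: "X2 = 0\<^sub>m r j"
    unfolding assoc_mult_mat[OF X2c Tc Sc] TS right_mult_one_mat[OF X2c] .
  have X0: "X $$ (i, k) = 0" if "p \<le> i" "i < p + r" "k < j" for i k
  proof -
    have "X2 $$ (i - p, k) = 0"
      unfolding X20 using that by simp
    then show ?thesis
      using that by (simp add: X2_def)
  qed
  show thesis
    by (rule that[OF Sc TS ST RS]) (use X0 in blast)
qed

text \<open>A change of state coordinates in a Stein equation. The factor \<open>W\<close> is the
  identity for the block of \<open>P\<close> and \<open>R\<close> for that of
  \<open>Q\<close>.\<close>

lemma change_of_basis_stein:
  fixes A B R S T W X :: "real mat"
  assumes B: "B \<in> carrier_mat j j" and S: "S \<in> carrier_mat p j" and T: "T \<in> carrier_mat j p"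
    and W: "W \<in> carrier_mat p p" and X: "X \<in> carrier_mat p q"
    and w: "w \<in> carrier_vec j" and v: "v \<in> carrier_vec q"
  shows "S * (B * (T * W) * X + outer w v) = (S * B * T) * W * X + outer (S *\<^sub>v w) v"
proof -
  have "S * (B * (T * W) * X + outer w v) = S * (B * (T * W) * X) + S * outer w v"
    using B S T W X w v by (intro mult_add_distrib_mat[of _ p j _ q]) auto
  also have "S * outer w v = outer (S *\<^sub>v w) v"
    by (rule mult_outer[OF S w])
  also have "S * (B * (T * W) * X) = (S * B * T) * W * X"
  proof -
    have TW: "T * W \<in> carrier_mat j p" using T W by simp
    have "S * (B * (T * W) * X) = S * (B * (T * W)) * X"
      by (rule assoc_mult_mat[OF S mult_carrier_mat[OF B TW] X, symmetric])
    also have "S * (B * (T * W)) = (S * B) * (T * W)"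
      by (rule assoc_mult_mat[OF S B TW, symmetric])
    also have "\<dots> = (S * B * T) * W"
      by (rule assoc_mult_mat[OF mult_carrier_mat[OF S B] T W, symmetric])
    finally show ?thesis .
  qed
  finally show ?thesis .
qed

lemma eq_add_imp_diff:
  fixes X Y Z :: "real mat"
  assumes "X \<in> carrier_mat k l" "Y \<in> carrier_mat k l" "Z \<in> carrier_mat k l" "X = Y + Z"
  shows "X - Y = Z" "Y = X - Z"
  using assms by (intro eq_matI; auto)+

lemma outer_uminus: "outer (- w) v = - outer w v"
  by (intro eq_matI) auto

text \<open>Each equation exhibits a matrix as an outer product with \<open>\<beta>h\<close> or
  \<open>\<alpha>h\<close>, the sign of \<open>- \<alpha>h\<close> coming from the error automaton;
  multiplication by a pseudo-inverse then isolates the vector.\<close>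

lemma realization_formulas:
  fixes A11 A12 Ah R :: "real mat"
  assumes A: "A11 \<in> carrier_mat p p" "A12 \<in> carrier_mat p r" and Ah: "Ah \<in> carrier_mat p p"
    and R: "R \<in> carrier_mat p p"
    and v: "\<alpha>1 \<in> carrier_vec p" "\<alpha>2 \<in> carrier_vec r" "\<beta>1 \<in> carrier_vec p" "\<beta>2 \<in> carrier_vec r"
    and h: "\<alpha>h \<in> carrier_vec p" "\<beta>h \<in> carrier_vec p"
    and eqs: "1\<^sub>m p = Ah * A11 + outer \<beta>h \<beta>1" "0\<^sub>m p r = Ah * A12 + outer \<beta>h \<beta>2"
      "R = Ah\<^sup>T * R * A11 + outer (- \<alpha>h) \<alpha>1" "0\<^sub>m p r = Ah\<^sup>T * R * A12 + outer (- \<alpha>h) \<alpha>2"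
  shows "\<beta>2 \<noteq> 0\<^sub>v r \<Longrightarrow> mat_of_col \<beta>h = - (Ah * A12 * pseudo_inverse (mat_of_row \<beta>2))"
    "\<alpha>2 \<noteq> 0\<^sub>v r \<Longrightarrow> mat_of_col \<alpha>h = Ah\<^sup>T * R * A12 * pseudo_inverse (mat_of_row \<alpha>2)"
    "\<beta>2 \<noteq> 0\<^sub>v r \<Longrightarrow> Ah * (A11 - A12 * pseudo_inverse (mat_of_row \<beta>2) * mat_of_row \<beta>1) = 1\<^sub>m p"
    "\<beta>1 \<noteq> 0\<^sub>v p \<Longrightarrow> mat_of_col \<beta>h = (1\<^sub>m p - Ah * A11) * pseudo_inverse (mat_of_row \<beta>1)"
    "\<alpha>1 \<noteq> 0\<^sub>v p \<Longrightarrow> mat_of_col \<alpha>h = - ((R - Ah\<^sup>T * R * A11) * pseudo_inverse (mat_of_row \<alpha>1))"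
    "\<beta>2 = 0\<^sub>v r \<Longrightarrow> Ah * A12 = 0\<^sub>m p r"
proof -
  have c: "Ah * A11 \<in> carrier_mat p p" "Ah * A12 \<in> carrier_mat p r"
      "Ah\<^sup>T * R * A11 \<in> carrier_mat p p" "Ah\<^sup>T * R * A12 \<in> carrier_mat p r"
    using A Ah R by auto
  have e1: "1\<^sub>m p - Ah * A11 = outer \<beta>h \<beta>1"
    by (rule eq_add_imp_diff(1)[OF one_carrier_mat c(1) _ eqs(1)]) (use h v in simp)
  have zero_minus: "0\<^sub>m p r - outer w u = outer (- w) u" if "w \<in> carrier_vec p" "u \<in> carrier_vec r" for w u
    using that by (intro eq_matI) auto
  have e2: "Ah * A12 = outer (- \<beta>h) \<beta>2"
    using eq_add_imp_diff(2)[OF zero_carrier_mat c(2) _ eqs(2)] zero_minus[OF h(2) v(4)] h v by simp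
  have e3: "R - Ah\<^sup>T * R * A11 = outer (- \<alpha>h) \<alpha>1"
    by (rule eq_add_imp_diff(1)[OF R c(3) _ eqs(3)]) (use h v in simp)
  have e4: "Ah\<^sup>T * R * A12 = outer \<alpha>h \<alpha>2"
    using eq_add_imp_diff(2)[OF zero_carrier_mat c(4) _ eqs(4)] zero_minus[of "- \<alpha>h" \<alpha>2] h v by simp
  have h': "- \<alpha>h \<in> carrier_vec p" "- \<beta>h \<in> carrier_vec p"
    using h by simp_all
  have neg: "- mat_of_col (- w) = mat_of_col w" for w
    by (intro eq_matI) auto
  show "mat_of_col \<beta>h = - (Ah * A12 * pseudo_inverse (mat_of_row \<beta>2))" if "\<beta>2 \<noteq> 0\<^sub>v r"
    unfolding e2 outer_mult_pseudo_inverse[OF v(4) that h'(2)] neg ..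
  show "mat_of_col \<alpha>h = Ah\<^sup>T * R * A12 * pseudo_inverse (mat_of_row \<alpha>2)" if "\<alpha>2 \<noteq> 0\<^sub>v r"
    unfolding e4 outer_mult_pseudo_inverse[OF v(2) that h(1)] ..
  show "mat_of_col \<beta>h = (1\<^sub>m p - Ah * A11) * pseudo_inverse (mat_of_row \<beta>1)" if "\<beta>1 \<noteq> 0\<^sub>v p"
    unfolding e1 outer_mult_pseudo_inverse[OF v(3) that h(2)] ..
  show "mat_of_col \<alpha>h = - ((R - Ah\<^sup>T * R * A11) * pseudo_inverse (mat_of_row \<alpha>1))" if "\<alpha>1 \<noteq> 0\<^sub>v p"
    unfolding e3 outer_mult_pseudo_inverse[OF v(1) that h'(1)] neg ..
  show "Ah * A12 = 0\<^sub>m p r" if "\<beta>2 = 0\<^sub>v r"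
    unfolding e2 that using h by (intro eq_matI) auto
  show "Ah * (A11 - A12 * pseudo_inverse (mat_of_row \<beta>2) * mat_of_row \<beta>1) = 1\<^sub>m p" if "\<beta>2 \<noteq> 0\<^sub>v r"
  proof -
    let ?K = "pseudo_inverse (mat_of_row \<beta>2)"
    have K: "?K \<in> carrier_mat r 1"
      unfolding pseudo_inverse_mat_of_row[OF v(4) that] by (rule smult_carrier_mat[OF mat_of_col_carrier[OF v(4)]])
    have row: "mat_of_row \<beta>1 \<in> carrier_mat 1 p"
      using v by auto
    have AK: "A12 * ?K \<in> carrier_mat p 1" using A K by simp
    have "Ah * (A12 * ?K * mat_of_row \<beta>1) = Ah * (A12 * ?K) * mat_of_row \<beta>1"
      by (rule assoc_mult_mat[OF Ah AK row, symmetric])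
    also have "Ah * (A12 * ?K) = Ah * A12 * ?K"
      by (rule assoc_mult_mat[OF Ah A(2) K, symmetric])
    also have "\<dots> * mat_of_row \<beta>1 = outer (- \<beta>h) \<beta>1"
      unfolding e2 outer_mult_pseudo_inverse[OF v(4) that h'(2)] by (rule mat_of_col_mult_mat_of_row)
    finally have K': "Ah * (A12 * ?K * mat_of_row \<beta>1) = - outer \<beta>h \<beta>1"
      by (simp add: outer_uminus)
    have "Ah * (A11 - A12 * ?K * mat_of_row \<beta>1) = Ah * A11 - Ah * (A12 * ?K * mat_of_row \<beta>1)"
      by (rule mult_minus_distrib_mat[OF Ah A(1) mult_carrier_mat[OF AK row]])
    also have "\<dots> = Ah * A11 + outer \<beta>h \<beta>1"
      unfolding K' using c(1) h v by (intro eq_matI) auto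
    finally show ?thesis
      using eqs(1) by simp
  qed
qed

subsection \<open>Singular value automata\<close>

lemma forward_mat_symmetric:
  assumes W: "is_wfa n W" and sym: "trans_mat W = (trans_mat W)\<^sup>T"
  shows "forward_mat W p = trans_mat W ^\<^sub>m p *\<^sub>v initial W"
  using W sym transpose_pow_mat[of "trans_mat W" n p] by (simp add: is_wfa_def forward_mat_def)

text \<open>For a symmetric matrix, column \<open>i\<close> of the forward or backward matrix is the
  coefficient sequence of a transfer function with final vector \<open>unit_vec n i\<close>. This
  turns the Schmidt vectors into rational functions.\<close>

lemma pow_mult_vec_index:
  fixes M :: "real mat"
  assumes M: "M \<in> carrier_mat n n" and sym: "M = M\<^sup>T" and v: "v \<in> carrier_vec n" and i: "i < n"
  shows "(M ^\<^sub>m p *\<^sub>v v) $ i = v \<bullet> (M ^\<^sub>m p *\<^sub>v unit_vec n i)"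
proof -
  have Mp: "M ^\<^sub>m p \<in> carrier_mat n n" using M by simp
  have T: "(M ^\<^sub>m p)\<^sup>T = M ^\<^sub>m p"
    using transpose_pow_mat[OF M, of p] sym by simp
  have "v \<bullet> (M ^\<^sub>m p *\<^sub>v unit_vec n i) = ((M ^\<^sub>m p)\<^sup>T *\<^sub>v v) \<bullet> unit_vec n i"
    by (rule transpose_vec_mult_scalar[OF Mp unit_vec_carrier v, symmetric])
  also have "\<dots> = (M ^\<^sub>m p *\<^sub>v v) $ i"
    unfolding T by (rule scalar_prod_right_unit[OF i])
  finally show ?thesis ..
qed

lemma sva_formE:
  assumes "sva_form n W"
  obtains d where "\<And>i. i < n \<Longrightarrow> 0 < d i"
    "\<forall>i<n. \<forall>l<n. (\<lambda>s. forward_mat W s $ i * forward_mat W s $ l) sums (if i = l then d i else 0)"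
    "\<forall>i<n. \<forall>l<n. (\<lambda>s. backward_mat W s $ i * backward_mat W s $ l) sums (if i = l then d i else 0)"
    "\<And>u s. hankel W u s = (\<Sum>l<n. forward_mat W u $ l * backward_mat W s $ l)"
proof -
  obtain U d V where svd: "compact_svd n (hankel W) U d V"
      and F: "\<And>p i. i < n \<Longrightarrow> forward_mat W p $ i = U p i * sqrt (d i)"
      and B: "\<And>p i. i < n \<Longrightarrow> backward_mat W p $ i = V p i * sqrt (d i)"
    using assms unfolding sva_form_def by blast
  have d: "0 < d i" if "i < n" for i
    using svd that by (simp add: compact_svd_def)
  have ortho: "(\<lambda>s. (X s i * sqrt (d i)) * (X s l * sqrt (d l))) sums (if i = l then d i else 0)"
    if X: "orthonormal_columns n X" and il: "i < n" "l < n" for X i l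
  proof -
    have "(\<lambda>s. (sqrt (d i) * sqrt (d l)) * (X s i * X s l)) sums ((sqrt (d i) * sqrt (d l)) * (if i = l then 1 else 0))"
      using X il unfolding orthonormal_columns_def by (intro sums_mult) auto
    moreover have "(sqrt (d i) * sqrt (d l)) * (if i = l then 1 else 0) = (if i = l then d i else 0)"
      using d[OF il(1)] by auto
    ultimately show ?thesis
      by (simp add: mult_ac)
  qed
  have "hankel W u s = (\<Sum>l<n. forward_mat W u $ l * backward_mat W s $ l)" for u s
  proof -
    have "hankel W u s = (\<Sum>l<n. U u l * d l * V s l)"
      using svd by (simp add: compact_svd_def)
    also have "\<dots> = (\<Sum>l<n. forward_mat W u $ l * backward_mat W s $ l)"
    proof (rule sum.cong[OF refl])
      fix l assume "l \<in> {..<n}"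
      then have "l < n" by simp
      then have "sqrt (d l) * sqrt (d l) = d l"
        using d[of l] by simp
      then show "U u l * d l * V s l = forward_mat W u $ l * backward_mat W s $ l"
        unfolding F[OF \<open>l < n\<close>] B[OF \<open>l < n\<close>] by (metis mult.assoc mult.left_commute mult.commute)
    qed
    finally show ?thesis .
  qed
  then show thesis
    using that[OF d] svd ortho by (simp add: compact_svd_def F B)
qed

lemma gram_index:
  assumes "\<forall>i<n. \<forall>l<n. (\<lambda>s. X s $ i * X s $ l) sums (if i = l then d i else 0)" "i < n" "l < n"
  shows "gram n X $$ (i, l) = (if i = l then d i else 0)"
  using assms by (simp add: gram_def sums_unique[symmetric])

text \<open>The diagonal of \<open>\<Sigma>\<close> may list the singular numbers in any order, so
  the count is done with multisets. Exactly the positions before \<open>k\<close> carry larger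
  values.\<close>

lemma card_singular_numbers_greater:
  fixes \<sigma> :: "nat \<Rightarrow> real" and \<Sigma> :: "real mat"
  assumes decr: "\<forall>i j. i \<le> j \<longrightarrow> j < n \<longrightarrow> \<sigma> j \<le> \<sigma> i" and pos: "\<forall>i<n. 0 < \<sigma> i"
    and mult: "0 < r" "k + r \<le> n" "\<forall>i<n. \<sigma> i = \<sigma> k \<longleftrightarrow> k \<le> i \<and> i < k + r"
    and Sigma: "\<Sigma> \<in> carrier_mat (n - r) (n - r)"
      "mset (diag_mat \<Sigma>) = image_mset \<sigma> (mset_set ({..<n} - {k..<k + r}))"
  shows "card {i. i < n - r \<and> \<Sigma> $$ (i, i) > \<sigma> k} = k"
    "\<And>i. i < n - r \<Longrightarrow> 0 < \<Sigma> $$ (i, i) \<and> \<Sigma> $$ (i, i) \<noteq> \<sigma> k"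
proof -
  have diag: "mset (diag_mat \<Sigma>) = image_mset (\<lambda>i. \<Sigma> $$ (i, i)) (mset_set {0..<n - r})"
    using Sigma(1) by (simp add: diag_mat_def mset_map flip: mset_upt)
  have "card {i. i < n - r \<and> \<Sigma> $$ (i, i) > \<sigma> k} = size (filter_mset (\<lambda>x. x > \<sigma> k) (mset (diag_mat \<Sigma>)))"
  proof -
    have "{i. i < n - r \<and> \<Sigma> $$ (i, i) > \<sigma> k} = {i \<in> {0..<n - r}. \<Sigma> $$ (i, i) > \<sigma> k}"
      by auto
    then show ?thesis
      unfolding diag by (simp add: filter_mset_image_mset filter_mset_mset_set)
  qed
  also have "\<dots> = card {i \<in> {..<n} - {k..<k + r}. \<sigma> i > \<sigma> k}"
    unfolding Sigma(2) by (simp add: filter_mset_image_mset)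
  also have "{i \<in> {..<n} - {k..<k + r}. \<sigma> i > \<sigma> k} = {..<k}"
  proof (intro equalityI subsetI)
    fix i assume i: "i \<in> {i \<in> {..<n} - {k..<k + r}. \<sigma> i > \<sigma> k}"
    then have "\<not> k \<le> i"
      using decr[rule_format, of k i] by auto
    then show "i \<in> {..<k}" by simp
  next
    fix i assume "i \<in> {..<k}"
    then have i: "i < k" by simp
    have "\<sigma> k \<le> \<sigma> i"
      using decr[rule_format, of i k] i mult(1,2) by simp
    moreover have "\<sigma> i \<noteq> \<sigma> k"
      using mult(3)[rule_format, of i] i mult(1,2) by simp
    ultimately show "i \<in> {i \<in> {..<n} - {k..<k + r}. \<sigma> i > \<sigma> k}"
      using i mult(1,2) by auto
  qed
  finally show "card {i. i < n - r \<and> \<Sigma> $$ (i, i) > \<sigma> k} = k"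
    by simp
  fix i assume "i < n - r"
  then have "\<Sigma> $$ (i, i) \<in># mset (diag_mat \<Sigma>)"
    unfolding diag by simp
  then obtain l where "l \<in> {..<n} - {k..<k + r}" "\<Sigma> $$ (i, i) = \<sigma> l"
    unfolding Sigma(2) by auto
  then show "0 < \<Sigma> $$ (i, i) \<and> \<Sigma> $$ (i, i) \<noteq> \<sigma> k"
    using pos mult(3)[rule_format, of l] by auto
qed

text \<open>The second formula is the first one at \<open>cnj z\<close>, which equals
  \<open>1/z\<close>, multiplied by \<open>1/z\<close>.\<close>

lemma tf_series:
  assumes M: "M \<in> carrier_mat m m" "spectral_radius (cmat M) < 1" and z: "norm z = 1"
    and a: "a \<in> carrier_vec m" and x: "x \<in> carrier_vec m"
  shows "(\<Sum>u. of_real (a \<bullet> (M ^\<^sub>m u *\<^sub>v x)) * z powi (- int u - 1)) = tf a M x z"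
    "(\<Sum>s. of_real (a \<bullet> (M ^\<^sub>m s *\<^sub>v x)) * z powi int s) = cnj z * tf a M x (cnj z)"
proof -
  show "(\<Sum>u. of_real (a \<bullet> (M ^\<^sub>m u *\<^sub>v x)) * z powi (- int u - 1)) = tf a M x z"
    by (rule sums_unique[OF tf_sums[OF M z a x], symmetric])
  have cz: "norm (cnj z) = 1" using z by simp
  have nz: "z \<noteq> 0" using z by auto
  have shift: "cnj z * (w * cnj z powi (- int s - 1)) = w * z powi int s" for w s
  proof -
    have "cnj z * cnj z powi (- int s - 1) = cnj z powi (1 + (- int s - 1))"
      using nz by (subst power_int_add) auto
    also have "1 + (- int s - 1) = - int s"
      by simp
    also have "cnj z powi (- int s) = z powi int s"
      unfolding cnj_eq_inverse[OF z] by (simp only: power_int_minus power_int_inverse inverse_inverse_eq)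
    finally show ?thesis by (metis mult.left_commute)
  qed
  have "(\<lambda>s. of_real (a \<bullet> (M ^\<^sub>m s *\<^sub>v x)) * z powi int s) sums (cnj z * tf a M x (cnj z))"
    using sums_mult[OF tf_sums[OF M cz a x], of "cnj z"] by (simp only: shift)
  then show "(\<Sum>s. of_real (a \<bullet> (M ^\<^sub>m s *\<^sub>v x)) * z powi int s) = cnj z * tf a M x (cnj z)"
    by (rule sums_unique[symmetric])
qed

text \<open>The second identity is the first with forward and backward matrices exchanged, which is
  legitimate because a Hankel matrix is symmetric. Both are needed for the all-pass
  property.\<close>

lemma best_approximation_tf:
  assumes W: "is_wfa n W" and sym: "trans_mat W = (trans_mat W)\<^sup>T" and stable: "spectral_radius (cmat (trans_mat W)) < 1"
    and sva: "sva_form n W" and symbol: "is_symbol \<phi> (hankel W)"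
    and psi: "\<psi> \<in> Hinf_k k" "Linf_norm (\<lambda>z. \<phi> z - \<psi> z) = ereal s"
    and card: "k \<le> card {i. i < n \<and> gram n (forward_mat W) $$ (i, i) > s}"
    and i0: "i0 < n" "gram n (forward_mat W) $$ (i0, i0) = s"
  defines "tF \<equiv> tf (initial W) (trans_mat W) (unit_vec n i0)"
    and "tB \<equiv> tf (final W) (trans_mat W) (unit_vec n i0)"
  shows "AE z in circle. (\<phi> z - \<psi> z) * (cnj z * tB (cnj z)) = of_real s * tF z"
    "AE z in circle. (\<phi> z - \<psi> z) * (cnj z * tF (cnj z)) = of_real s * tB z"
proof -
  define M where "M = trans_mat W"
  define a where "a = initial W"
  define b where "b = final W"
  have M: "M \<in> carrier_mat n n" "M = M\<^sup>T" "spectral_radius (cmat M) < 1"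
      and a: "a \<in> carrier_vec n" and b: "b \<in> carrier_vec n"
    using W sym stable by (simp_all add: is_wfa_def M_def a_def b_def)
  obtain d where d: "\<And>i. i < n \<Longrightarrow> 0 < d i"
    and F: "\<forall>i<n. \<forall>l<n. (\<lambda>s. forward_mat W s $ i * forward_mat W s $ l) sums (if i = l then d i else 0)"
    and B: "\<forall>i<n. \<forall>l<n. (\<lambda>s. backward_mat W s $ i * backward_mat W s $ l) sums (if i = l then d i else 0)"
    and H: "\<And>u s. hankel W u s = (\<Sum>l<n. forward_mat W u $ l * backward_mat W s $ l)"
    using sva by (rule sva_formE) blast
  have F_index: "forward_mat W u $ l = a \<bullet> (M ^\<^sub>m u *\<^sub>v unit_vec n l)" if "l < n" for u l
    using pow_mult_vec_index[OF M(1,2) a that, of u] forward_mat_symmetric[OF W sym, of u] by (simp add: M_def a_def)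
  have B_index: "backward_mat W u $ l = b \<bullet> (M ^\<^sub>m u *\<^sub>v unit_vec n l)" if "l < n" for u l
    using pow_mult_vec_index[OF M(1,2) b that, of u] by (simp add: M_def b_def backward_mat_def)
  have F1: "summable (\<lambda>s. \<bar>forward_mat W s $ i\<bar>)" if "i < n" for i
    unfolding F_index[OF that] by (rule stable_summable[OF M(1,3) a unit_vec_carrier])
  have B1: "summable (\<lambda>s. \<bar>backward_mat W s $ i\<bar>)" if "i < n" for i
    unfolding B_index[OF that] by (rule stable_summable[OF M(1,3) b unit_vec_carrier])
  have phi: "\<phi> \<in> Linf" and FC: "\<And>u s. fourier_coeff \<phi> (- int u - int s - 1) = of_real (hankel W u s)"
    using symbol by (simp_all add: is_symbol_def)
  have gram: "gram n (forward_mat W) $$ (i, i) = d i" if "i < n" for i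
    using gram_index[OF F that that] by simp
  have "{i. i < n \<and> gram n (forward_mat W) $$ (i, i) > s} = {i. i < n \<and> d i > s}"
    using gram by auto
  then have card': "k \<le> card {i. i < n \<and> d i > s}"
    using card by simp
  have i0': "d i0 = s"
    using gram i0 by simp
  have H': "hankel W u s = (\<Sum>l<n. backward_mat W u $ l * forward_mat W s $ l)" for u s
    using H[of s u] by (simp add: hankel_def add.commute mult.commute)
  have "AE z in circle. (\<phi> z - \<psi> z) * (\<Sum>q. of_real (backward_mat W q $ i0) * z powi int q)
    = of_real s * (\<Sum>u. of_real (forward_mat W u $ i0) * z powi (- int u - 1))"
    by (rule best_approximation_Schmidt_pair[OF phi _ F F1 B B1 d psi card' i0(1) i0'])
      (simp_all only: FC H)
  then show "AE z in circle. (\<phi> z - \<psi> z) * (cnj z * tB (cnj z)) = of_real s * tF z"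
    using AE_space
  proof eventually_elim
    case (elim z)
    then have z: "norm z = 1" by simp
    show ?case
      using elim(1) unfolding F_index[OF i0(1)] B_index[OF i0(1)]
        tf_series(1)[OF M(1,3) z a unit_vec_carrier] tf_series(2)[OF M(1,3) z b unit_vec_carrier]
      by (simp add: tF_def tB_def M_def a_def b_def)
  qed
  have "AE z in circle. (\<phi> z - \<psi> z) * (\<Sum>q. of_real (forward_mat W q $ i0) * z powi int q)
    = of_real s * (\<Sum>u. of_real (backward_mat W u $ i0) * z powi (- int u - 1))"
    by (rule best_approximation_Schmidt_pair[OF phi _ B B1 F F1 d psi card' i0(1) i0'])
      (simp_all only: FC H')
  then show "AE z in circle. (\<phi> z - \<psi> z) * (cnj z * tF (cnj z)) = of_real s * tB z"
    using AE_space
  proof eventually_elim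
    case (elim z)
    then have z: "norm z = 1" by simp
    show ?case
      using elim(1) unfolding F_index[OF i0(1)] B_index[OF i0(1)]
        tf_series(1)[OF M(1,3) z b unit_vec_carrier] tf_series(2)[OF M(1,3) z a unit_vec_carrier]
      by (simp add: tF_def tB_def M_def a_def b_def)
  qed
qed

text \<open>Identities that hold almost everywhere extend to the whole circle, since both sides are rational.
  By conjugation \<open>C\<close> is real, and the two identities together show that the error is all-pass.\<close>

lemma error_all_pass:
  assumes M: "M \<in> carrier_mat n n" "circle_regular M" and e: "e \<in> carrier_vec n"
    and a: "a \<in> carrier_vec n" and b: "b \<in> carrier_vec n"
    and nz: "\<exists>z. norm z = 1 \<and> tf a M e z \<noteq> 0" "\<exists>z. norm z = 1 \<and> tf b M e z \<noteq> 0"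
    and N: "N \<in> carrier_mat m m" "circle_regular N" and x: "x \<in> carrier_vec m" "y \<in> carrier_vec m"
    and ae1: "AE z in circle. (tf x N y z - C) * (cnj z * tf b M e (cnj z)) = of_real s * tf a M e z"
    and ae2: "AE z in circle. (tf x N y z - C) * (cnj z * tf a M e (cnj z)) = of_real s * tf b M e z"
  shows "C = of_real (Re C)"
    "norm z = 1 \<Longrightarrow> (tf x N y z - C) * (cnj z * tf b M e (cnj z)) = of_real s * tf a M e z"
    "norm z = 1 \<Longrightarrow> (tf x N y z - C) * (tf x N y (cnj z) - C) = of_real (s\<^sup>2)"
proof -
  define E where "E = (\<lambda>z. tf x N y z - C)"
  have rat: "circle_rational (tf a M e)" "circle_rational (tf b M e)" "circle_rational E"
    using tf_circle_rational[OF M a e] tf_circle_rational[OF M b e]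
      circle_rational_diff[OF tf_circle_rational[OF N x] circle_rational_const]
    by (simp_all add: E_def)
  note rat_cnj = rat[THEN circle_rational_cnj_arg] and id_cnj = circle_rational_cnj_arg[OF circle_rational_ident]
  have extend: "f z = g z" if "circle_rational f" "circle_rational g" "AE z in circle. f z = g z" "norm z = 1" for f g z
  proof -
    have "AE z in circle. f z - g z = 0"
      using that(3) by eventually_elim simp
    then have "f z - g z = 0"
      using that(4) by (intro circle_rational_eq_0[OF circle_rational_diff[OF that(1,2)] AE_circle_imp_infinite])
    then show ?thesis by simp
  qed
  have eq1: "E z * (cnj z * tf b M e (cnj z)) = of_real s * tf a M e z" if "norm z = 1" for z
  proof (rule extend[OF _ _ _ that])
    show "circle_rational (\<lambda>z. E z * (cnj z * tf b M e (cnj z)))" "circle_rational (\<lambda>z. of_real s * tf a M e z)"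
      by (intro circle_rational_mult circle_rational_const rat rat_cnj id_cnj)+
    show "AE z in circle. E z * (cnj z * tf b M e (cnj z)) = of_real s * tf a M e z"
      using ae1 by (simp add: E_def)
  qed
  have eq2: "E z * (cnj z * tf a M e (cnj z)) = of_real s * tf b M e z" if "norm z = 1" for z
  proof (rule extend[OF _ _ _ that])
    show "circle_rational (\<lambda>z. E z * (cnj z * tf a M e (cnj z)))" "circle_rational (\<lambda>z. of_real s * tf b M e z)"
      by (intro circle_rational_mult circle_rational_const rat rat_cnj id_cnj)+
    show "AE z in circle. E z * (cnj z * tf a M e (cnj z)) = of_real s * tf b M e z"
      using ae2 by (simp add: E_def)
  qed
  show "norm z = 1 \<Longrightarrow> (tf x N y z - C) * (cnj z * tf b M e (cnj z)) = of_real s * tf a M e z"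
    using eq1[of z] by (simp add: E_def)
  show "C = of_real (Re C)"
  proof -
    obtain z where z: "norm z = 1" "tf b M e z \<noteq> 0" using nz(2) by blast
    then have cz: "norm (cnj z) = 1" "z \<noteq> 0" by auto
    have "cnj (E z * (cnj z * tf b M e (cnj z))) = cnj (of_real s * tf a M e z)"
      by (simp only: eq1[OF z(1)])
    then have "cnj (E z) * (z * tf b M e z) = of_real s * tf a M e (cnj z)"
      by (simp add: tf_cnj[OF M z(1) a e] tf_cnj[OF M z(1) b e])
    also have "\<dots> = E (cnj z) * (z * tf b M e z)"
      using eq1[OF cz(1)] by simp
    \<comment> \<open>Conjugating \<open>eq1\<close> at \<open>z\<close> and reading it at
      \<open>cnj z\<close> give the same right-hand side, because \<open>s\<close> and the data of
      both transfer functions in it are real.\<close>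
    finally have "cnj (E z) = E (cnj z)"
      using z(2) cz(2) by simp
    then have "cnj C = C"
      by (simp add: E_def tf_cnj[OF N z(1) x])
    then show ?thesis
      by (simp add: complex_eq_iff)
  qed
  have "(E z * E (cnj z) - of_real (s\<^sup>2)) * tf a M e z * tf b M e (cnj z) = 0" if z: "norm z = 1" for z
  proof -
    have cz: "norm (cnj z) = 1" using z by simp
    \<comment> \<open>This is the product of \<open>eq1\<close> at \<open>z\<close> and
      \<open>eq2\<close> at \<open>cnj z\<close>. The factors \<open>z\<close> and
      \<open>cnj z\<close> cancel; the two transfer functions are cancelled afterwards, since
      neither vanishes identically.\<close>
    have "(E z * (cnj z * tf b M e (cnj z))) * (E (cnj z) * (z * tf a M e z))
        = (of_real s * tf a M e z) * (of_real s * tf b M e (cnj z))"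
      using eq1[OF z] eq2[OF cz] by simp
    moreover have "(E z * (cnj z * tf b M e (cnj z))) * (E (cnj z) * (z * tf a M e z))
        = (z * cnj z) * (E z * E (cnj z) * tf a M e z * tf b M e (cnj z))"
      by (simp only: mult_ac)
    ultimately have "E z * E (cnj z) * tf a M e z * tf b M e (cnj z)
        = (of_real s * tf a M e z) * (of_real s * tf b M e (cnj z))"
      by (simp only: circle_mult_cnj[OF z] mult_1_left)
    then show ?thesis
      by (simp add: power2_eq_square left_diff_distrib mult_ac)
  qed
  moreover have rE: "circle_rational (\<lambda>z. E z * E (cnj z) - of_real (s\<^sup>2))"
    by (intro circle_rational_diff circle_rational_mult rat rat_cnj circle_rational_const)
  moreover obtain w where "norm w = 1" "tf b M e (cnj w) \<noteq> 0"
  proof -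
    obtain w where "norm w = 1" "tf b M e w \<noteq> 0" using nz(2) by blast
    then show thesis by (intro that[of "cnj w"]) simp_all
  qed
  ultimately have "(E z * E (cnj z) - of_real (s\<^sup>2)) * tf a M e z = 0" if "norm z = 1" for z
    using that rat rat_cnj
    by (intro circle_rational_mult_eq_0[where f = "\<lambda>z. (E z * E (cnj z) - of_real (s\<^sup>2)) * tf a M e z"
          and g = "\<lambda>z. tf b M e (cnj z)" and z = w] circle_rational_mult) auto
  moreover obtain w' where "norm w' = 1" "tf a M e w' \<noteq> 0" using nz(1) by blast
  ultimately have "E z * E (cnj z) - of_real (s\<^sup>2) = 0" if "norm z = 1" for z
    using that rat rE
    by (intro circle_rational_mult_eq_0[where f = "\<lambda>z. E z * E (cnj z) - of_real (s\<^sup>2)"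
          and g = "tf a M e" and z = w']) auto
  then show "norm z = 1 \<Longrightarrow> (tf x N y z - C) * (tf x N y (cnj z) - C) = of_real (s\<^sup>2)"
    by (simp add: E_def)
qed

subsection \<open>The best approximation\<close>

text \<open>A change of the state coordinates of \<open>A'\<close> alters neither its transfer
  function nor admissibility, but it does alter the formulas. They can therefore only hold in
  suitable coordinates, and the number of states is part of the conclusion. Vectors appear as
  one-column matrices because the pseudo-inverse of a row is a column.\<close>

theorem theorem3p4:
  fixes n k r j :: nat
    and A A' :: wfa
    and \<sigma> :: "nat \<Rightarrow> real"
    and \<Sigma> A11 A12 A22 R :: "real mat"
    and \<alpha>1 \<alpha>2 \<beta>1 \<beta>2 :: "real vec"
    and \<phi> \<psi> :: "complex \<Rightarrow> complex"
    and C :: complex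
  assumes sva: "sva_form n A"
    and conventions: "sva_conventions n A"
    and stable: "spectral_radius (cmat (trans_mat A)) < 1"
    and phi: "\<phi> = wfa_transfer A"
    and symbol: "is_symbol \<phi> (hankel A)"
    and sigma: "singular_numbers n (hankel A) \<sigma>"
    and mult: "0 < r" "k + r \<le> n" "\<forall>i<n. \<sigma> i = \<sigma> k \<longleftrightarrow> k \<le> i \<and> i < k + r"
    and Sigma: "\<Sigma> \<in> carrier_mat (n - r) (n - r)" "diagonal_mat \<Sigma>"
      "mset (diag_mat \<Sigma>) = image_mset \<sigma> (mset_set ({..<n} - {k..<k + r}))"
    and P: "gram n (forward_mat A) =
      four_block_mat \<Sigma> (0\<^sub>m (n - r) r) (0\<^sub>m r (n - r)) (\<sigma> k \<cdot>\<^sub>m 1\<^sub>m r)"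
    and Q: "gram n (backward_mat A) =
      four_block_mat \<Sigma> (0\<^sub>m (n - r) r) (0\<^sub>m r (n - r)) (\<sigma> k \<cdot>\<^sub>m 1\<^sub>m r)"
    and part_dims: "A11 \<in> carrier_mat (n - r) (n - r)" "A12 \<in> carrier_mat (n - r) r"
      "A22 \<in> carrier_mat r r"
      "\<alpha>1 \<in> carrier_vec (n - r)" "\<alpha>2 \<in> carrier_vec r"
      "\<beta>1 \<in> carrier_vec (n - r)" "\<beta>2 \<in> carrier_vec r"
    and part: "trans_mat A = four_block_mat A11 A12 (A12\<^sup>T) A22"
      "initial A = \<alpha>1 @\<^sub>v \<alpha>2" "final A = \<beta>1 @\<^sub>v \<beta>2"
    and R: "R = (\<sigma> k)\<^sup>2 \<cdot>\<^sub>m 1\<^sub>m (n - r) - \<Sigma> * \<Sigma>"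
    and adm: "admissible n A k j A'"
    and psi: "\<psi> = (\<lambda>z. wfa_transfer A' z + C)"
    and best: "\<psi> \<in> Hinf_k k" "Linf_norm (\<lambda>z. \<phi> z - \<psi> z) = ereal (\<sigma> k)"
  shows "j = n - r \<and>
    (\<exists>\<alpha>h Ah \<beta>h. change_of_basis A' (WFA \<alpha>h Ah \<beta>h) \<and>
      (\<alpha>2 \<noteq> 0\<^sub>v r \<longrightarrow>
         mat_of_col \<beta>h = - (Ah * A12 * pseudo_inverse (mat_of_row \<beta>2)) \<and>
         mat_of_col \<alpha>h = Ah\<^sup>T * R * A12 * pseudo_inverse (mat_of_row \<alpha>2) \<and>
         Ah * (A11 - A12 * pseudo_inverse (mat_of_row \<beta>2) * mat_of_row \<beta>1) = 1\<^sub>m (n - r)) \<and>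
      (\<alpha>2 = 0\<^sub>v r \<longrightarrow>
         mat_of_col \<beta>h = (1\<^sub>m (n - r) - Ah * A11) * pseudo_inverse (mat_of_row \<beta>1) \<and>
         mat_of_col \<alpha>h = - ((R - Ah\<^sup>T * R * A11) * pseudo_inverse (mat_of_row \<alpha>1)) \<and>
         Ah * A12 = 0\<^sub>m (n - r) r))"
proof -

  \<comment> \<open>Regularity and cyclicity of the two automata\<close>
  define p where "p = n - r"
  have n: "n = p + r"
    using mult(2) by (simp add: p_def)
  define M a b M' a' b' where defs: "M = trans_mat A" "a = initial A" "b = final A"
    "M' = trans_mat A'" "a' = initial A'" "b' = final A'"
  have A_eq: "A = WFA a M b" and A'_eq: "A' = WFA a' M' b'"
    by (simp_all add: defs)
  have minimal: "minimal_wfa n A"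
    using sva by (simp add: sva_form_def)
  then have wfa: "is_wfa n A"
    by (simp add: minimal_wfa_def)
  have M: "M \<in> carrier_mat n n" and a: "a \<in> carrier_vec n" and b: "b \<in> carrier_vec n"
    using wfa by (simp_all add: is_wfa_def defs)
  have wfa': "is_wfa j A'"
    using adm by (simp add: admissible_def)
  have M': "M' \<in> carrier_mat j j" and a': "a' \<in> carrier_vec j" and b': "b' \<in> carrier_vec j"
    using wfa' by (simp_all add: is_wfa_def defs)
  have A_sym: "trans_mat A = (trans_mat A)\<^sup>T"
    using conventions by (simp add: sva_conventions_def)
  then have MT: "M\<^sup>T = M"
    by (simp add: defs)
  have stableM: "spectral_radius (cmat M) < 1"
    using stable by (simp add: defs)
  have reg: "circle_regular M"
    by (rule stable_imp_circle_regular[OF M stableM])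
  have reg': "circle_regular M'"
    using adm by (auto simp: admissible_def circle_regular_def defs)
  have cyc: "cyclic n M\<^sup>T a" "cyclic n M\<^sup>T b"
    using reachable_imp_cyclic[OF wfa] observable_imp_cyclic[OF wfa] minimal MT
    by (simp_all add: minimal_wfa_def defs)

  \<comment> \<open>Singular numbers and the diagonal Gramian\<close>
  have \<sigma>_decr: "\<forall>i j. i \<le> j \<longrightarrow> j < n \<longrightarrow> \<sigma> j \<le> \<sigma> i" and \<sigma>_pos: "\<forall>i<n. 0 < \<sigma> i"
    using sigma by (auto simp: singular_numbers_def compact_svd_def)
  note card_k = card_singular_numbers_greater[OF \<sigma>_decr \<sigma>_pos mult Sigma(1,3)]
  have k: "k < n" "\<sigma> k > 0"
    using mult \<sigma>_pos by auto
  define s where "s = \<sigma> k"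
  define D where "D = four_block_mat \<Sigma> (0\<^sub>m p r) (0\<^sub>m r p) (s \<cdot>\<^sub>m 1\<^sub>m r)"
  have gramF: "gram n (forward_mat A) = D" and gramB: "gram n (backward_mat A) = D"
    using P Q by (simp_all add: D_def p_def s_def)
  have \<Sigma>: "\<Sigma> \<in> carrier_mat p p"
    using Sigma(1) by (simp add: p_def)
  have Dc: "D \<in> carrier_mat n n"
    unfolding D_def n using \<Sigma> by (intro four_block_carrier_mat) auto
  have D_diag: "D $$ (i, i) = (if i < p then \<Sigma> $$ (i, i) else s)" if "i < n" for i
    using that \<Sigma> by (auto simp: D_def n)
  have "{i. i < n \<and> D $$ (i, i) > s} = {i. i < n - r \<and> \<Sigma> $$ (i, i) > s}"
    using D_diag by (auto simp: n split: if_splits)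
  then have card: "k \<le> card {i. i < n \<and> gram n (forward_mat A) $$ (i, i) > s}"
    using card_k(1) by (simp add: gramF s_def)
  have best': "Linf_norm (\<lambda>z. \<phi> z - \<psi> z) = ereal s"
    using best(2) by (simp add: s_def)

  \<comment> \<open>The error automaton\<close>
  define x where "x = a @\<^sub>v (- a')"
  define y where "y = b @\<^sub>v b'"
  define N where "N = diag_block M M'"
  have err: "error_wfa A A' = WFA x N y"
    by (simp add: error_wfa_def x_def y_def N_def defs)
  have x: "x \<in> carrier_vec (n + j)" and y: "y \<in> carrier_vec (n + j)"
    using a a' b b' by (simp_all add: x_def y_def)
  have N: "N \<in> carrier_mat (n + j) (n + j)"
    unfolding N_def using M M' by (intro four_block_carrier_mat) auto
  have NT: "N\<^sup>T = diag_block M\<^sup>T M'\<^sup>T"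
    unfolding N_def by (rule transpose_diag_block[OF M M'])
  have regN: "circle_regular N"
    unfolding N_def by (rule circle_regular_diag_block[OF M reg M' reg'])
  have cycN: "cyclic (n + j) N\<^sup>T x" "cyclic (n + j) N y"
    using adm reachable_imp_cyclic[of "n + j" "WFA x N y"] observable_imp_cyclic[of "n + j" "WFA x N y"]
    by (simp_all add: admissible_def minimal_wfa_def err)
  have error: "\<phi> z - \<psi> z = tf x N y z - C" if z: "norm z = 1" for z
  proof -
    have "tf x N y z = tf a M b z + tf (- a') M' b' z"
      unfolding x_def y_def N_def using a' by (intro tf_diag_block[OF M reg M' reg' z a b _ b']) simp
    then show ?thesis
      unfolding phi psi A_eq A'_eq by (simp add: tf_uminus_left[OF M' reg' z a' b'])
  qed

  \<comment> \<open>The all-pass property of the error\<close>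
  have unit: "\<exists>z. norm z = 1 \<and> tf v M (unit_vec n i) z \<noteq> 0" if i: "i < n" and v: "v = a \<or> v = b" for i v
  proof (rule ccontr)
    assume "\<not> ?thesis"
    then have "\<And>z. norm z = 1 \<Longrightarrow> tf v M (unit_vec n i) z = 0" by blast
    \<comment> \<open>Since \<open>M\<close> is symmetric, both \<open>a\<close> and
      \<open>b\<close> are cyclic for \<open>M\<^sup>T\<close>; a state that one of them does not
      see is zero.\<close>
    then have "unit_vec n i = (0\<^sub>v n :: real vec)"
      using v cyc a b by (intro tf_eq_const_imp_eq_0[OF M reg _ _ unit_vec_carrier, of v]) auto
    then have "unit_vec n i $ i = (0 :: real)"
      using i by simp
    then show False
      using i by simp
  qed
  have ae: "AE z in circle. (tf x N y z - C) * (cnj z * tf b M (unit_vec n i) (cnj z)) = of_real s * tf a M (unit_vec n i) z"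
      "AE z in circle. (tf x N y z - C) * (cnj z * tf a M (unit_vec n i) (cnj z)) = of_real s * tf b M (unit_vec n i) z"
    if i: "p \<le> i" "i < n" for i
  proof -
    have gi: "gram n (forward_mat A) $$ (i, i) = s"
      using D_diag[OF i(2)] i by (simp add: gramF)
    note best_tf = best_approximation_tf[OF wfa A_sym stable sva symbol best(1) best' card i(2) gi]
    show "AE z in circle. (tf x N y z - C) * (cnj z * tf b M (unit_vec n i) (cnj z)) = of_real s * tf a M (unit_vec n i) z"
      using best_tf(1) AE_space by eventually_elim (simp add: error defs)
    show "AE z in circle. (tf x N y z - C) * (cnj z * tf a M (unit_vec n i) (cnj z)) = of_real s * tf b M (unit_vec n i) z"
      using best_tf(2) AE_space by eventually_elim (simp add: error defs)
  qed
  have all_pass: "C = of_real (Re C)"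
      "norm z = 1 \<Longrightarrow> (tf x N y z - C) * (cnj z * tf b M (unit_vec n i) (cnj z)) = of_real s * tf a M (unit_vec n i) z"
      "norm z = 1 \<Longrightarrow> (tf x N y z - C) * (tf x N y (cnj z) - C) = of_real (s\<^sup>2)"
    if i: "p \<le> i" "i < n" for i z
    by (rule error_all_pass[OF M reg unit_vec_carrier a b unit[OF i(2)] unit[OF i(2)] N regN x y ae[OF i]]; simp)+
  \<comment> \<open>As \<open>r > 0\<close>, position \<open>p\<close> exists and is the first that
    carries the value \<open>s\<close>; it serves as the representative.\<close>
  have p_lt: "p \<le> p" "p < n"
    using mult(1) by (simp_all add: n)
  define c where "c = Re C"
  have C: "C = of_real c"
    unfolding c_def by (rule all_pass(1)[OF p_lt])

  interpret E: allpass_system "n + j" N x y c s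
  proof
    fix z :: complex assume z: "norm z = 1"
    have "(tf x N y z - C) * (tf x N y (cnj z) - C) = of_real (s\<^sup>2)"
      by (rule all_pass(3)[OF p_lt z])
    then show "(tf x N y z - of_real c) * (tf x N y (cnj z) - of_real c) = of_real (s\<^sup>2)"
      by (simp add: C)
  qed (fact N regN x y cycN)+
  interpret F: allpass_system "n + j" "N\<^sup>T" y x c s
    by (rule E.transposed)

  \<comment> \<open>Blocks of \<open>P\<close> and \<open>Q\<close>\<close>
  have P_unit: "E.P (unit_vec n i @\<^sub>v 0\<^sub>v j) = s \<cdot>\<^sub>v (unit_vec n i @\<^sub>v 0\<^sub>v j)" if i: "p \<le> i" "i < n" for i
  \<comment> \<open>The Schmidt pair identity says that the error maps the function \<open>G\<close>
    of this state to \<open>s\<close> times its transfer function. Padding by zeros changes neither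
    function, and \<open>M\<^sup>T = M\<close> lets the same unit vector appear on both
    sides.\<close>
  proof (rule E.P_eqI)
    fix z :: complex assume z: "norm z = 1"
    then have cz: "norm (cnj z) = 1" by simp
    have M'T: "M'\<^sup>T \<in> carrier_mat j j" "circle_regular M'\<^sup>T"
      using M' circle_regular_transpose[OF M' reg'] by auto
    have "tf x N (unit_vec n i @\<^sub>v 0\<^sub>v j) z = tf a M (unit_vec n i) z"
      unfolding x_def N_def using a'
      by (subst tf_diag_block[OF M reg M' reg' z a unit_vec_carrier _ zero_carrier_vec])
        (simp_all add: tf_zero[OF M' reg' z])
    moreover have "tf y N\<^sup>T (unit_vec n i @\<^sub>v 0\<^sub>v j) (cnj z) = tf b M (unit_vec n i) (cnj z)"
      unfolding y_def NT MT
      by (subst tf_diag_block[OF M reg M'T cz b unit_vec_carrier b' zero_carrier_vec])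
        (simp add: tf_zero[OF M'T cz b'])
    moreover have "(tf x N y z - C) * (cnj z * tf b M (unit_vec n i) (cnj z)) = of_real s * tf a M (unit_vec n i) z"
      by (rule all_pass(2)[OF i z])
    ultimately show "tf x N (s \<cdot>\<^sub>v (unit_vec n i @\<^sub>v 0\<^sub>v j)) z
        = (tf x N y z - of_real c) * E.G (unit_vec n i @\<^sub>v 0\<^sub>v j) z"
      using tf_smult[OF N regN z x, of "unit_vec n i @\<^sub>v 0\<^sub>v j" s] by (simp add: E.G_def C)
  qed simp_all

  obtain P11 P12 Y P22 where splitP: "split_block E.Pmat n n = (P11, P12, Y, P22)"
    by (cases "split_block E.Pmat n n") auto
  have Pdim: "dim_row E.Pmat = n + j" "dim_col E.Pmat = n + j"
    using E.Pmat_carrier by auto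
  note Pblocks = split_block[OF splitP Pdim]
  obtain Q11 X Q21 Q22 where splitQ: "split_block F.Pmat n n = (Q11, X, Q21, Q22)"
    by (cases "split_block F.Pmat n n") auto
  have Qdim: "dim_row F.Pmat = n + j" "dim_col F.Pmat = n + j"
    using F.Pmat_carrier by auto
  note Qblocks = split_block[OF splitQ Qdim]
  have MTc: "M\<^sup>T \<in> carrier_mat n n" and M'Tc: "M'\<^sup>T \<in> carrier_mat j j"
    using M M' by simp_all
  have ma': "- a' \<in> carrier_vec j"
    using a' by simp
  have "four_block_mat P11 P12 Y P22
      = diag_block M M' * four_block_mat P11 P12 Y P22 * diag_block M\<^sup>T M'\<^sup>T + outer (b @\<^sub>v b') (b @\<^sub>v b')"
    unfolding Pblocks(5)[symmetric] NT[symmetric] N_def[symmetric] y_def[symmetric] by (rule E.Pmat_stein)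
  note steinP = stein_blocks(1,3)[OF M M' MTc M'Tc Pblocks(1-4) b b' this]
  have "four_block_mat Q11 X Q21 Q22
      = diag_block M\<^sup>T M'\<^sup>T * four_block_mat Q11 X Q21 Q22 * diag_block M M' + outer (a @\<^sub>v - a') (a @\<^sub>v - a')"
    using F.Pmat_stein
    unfolding Qblocks(5)[symmetric] NT[symmetric] N_def[symmetric] x_def[symmetric] transpose_transpose .
  note steinQ = stein_blocks(1,2)[OF MTc M'Tc M M' Qblocks(1-4) a ma' this]
  \<comment> \<open>The roles are crossed: \<open>P\<close>, driven by the final vector, contains
    the backward Gramian, and \<open>Q\<close> the forward one.\<close>
  have P11: "P11 = D"
  proof (rule eq_matI)
    fix i l assume "i < dim_row D" "l < dim_col D"
    then have il: "i < n" "l < n" using Dc by auto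
    have "(\<lambda>q. backward_mat A q $ i * backward_mat A q $ l) sums P11 $$ (i, l)"
      using stein_unique[OF M stableM Pblocks(1) b steinP(1) il] by (simp add: backward_mat_def defs del: index_mult_mat_vec)
    then show "P11 $$ (i, l) = D $$ (i, l)"
      unfolding gramB[symmetric] gram_def using il by (simp add: sums_iff)
  qed (use Dc Pblocks in auto)
  have Q11: "Q11 = D"
  proof (rule eq_matI)
    fix i l assume "i < dim_row D" "l < dim_col D"
    then have il: "i < n" "l < n" using Dc by auto
    have "Q11 = M * Q11 * M\<^sup>T + outer a a"
      using steinQ(1) by (simp only: MT)
    from stein_unique[OF M stableM Qblocks(1) a this il]
    have "(\<lambda>q. forward_mat A q $ i * forward_mat A q $ l) sums Q11 $$ (i, l)"
      by (simp add: forward_mat_symmetric[OF wfa A_sym] defs del: index_mult_mat_vec)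
    then show "Q11 $$ (i, l) = D $$ (i, l)"
      unfolding gramF[symmetric] gram_def using il by (simp add: sums_iff)
  qed (use Dc Qblocks in auto)

  have DDXY: "D * D + X * Y = s\<^sup>2 \<cdot>\<^sub>m 1\<^sub>m (p + r)"
  proof -
    have "F.Pmat * E.Pmat = s\<^sup>2 \<cdot>\<^sub>m 1\<^sub>m (n + j)"
      by (rule E.transposed_Pmat_Pmat)
    also have "s\<^sup>2 \<cdot>\<^sub>m 1\<^sub>m (n + j)
        = four_block_mat (s\<^sup>2 \<cdot>\<^sub>m 1\<^sub>m n) (0\<^sub>m n j) (0\<^sub>m j n) (s\<^sup>2 \<cdot>\<^sub>m 1\<^sub>m j)"
      by (intro eq_matI) auto
    finally have "four_block_mat (Q11 * P11 + X * Y) (Q11 * P12 + X * P22) (Q21 * P11 + Q22 * Y) (Q21 * P12 + Q22 * P22)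
        = four_block_mat (s\<^sup>2 \<cdot>\<^sub>m 1\<^sub>m n) (0\<^sub>m n j) (0\<^sub>m j n) (s\<^sup>2 \<cdot>\<^sub>m 1\<^sub>m j)"
      unfolding Pblocks(5) Qblocks(5) mult_four_block_mat[OF Qblocks(1-4) Pblocks(1-4)] .
    then have "Q11 * P11 + X * Y = s\<^sup>2 \<cdot>\<^sub>m 1\<^sub>m n"
      by (rule four_block_mat_inject(1)[where n = n and j = j, rotated -1]) (use Pblocks(1-4) Qblocks(1-4) in auto)
    then show ?thesis
      by (simp add: P11 Q11 n)
  qed
  have Y_zero: "Y $$ (q, i) = 0" if "q < j" "p \<le> i" "i < p + r" for q i
  proof -
    have i: "i < n" using that by (simp add: n)
    have u: "unit_vec n i @\<^sub>v 0\<^sub>v j \<in> carrier_vec (n + j)" by simp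
    have "E.Pmat $$ (n + q, i) = (E.Pmat *\<^sub>v unit_vec (n + j) i) $ (n + q)"
      using Pdim that i by (simp add: scalar_prod_right_unit)
    also have "unit_vec (n + j) i = unit_vec n i @\<^sub>v 0\<^sub>v j"
      using i by (intro eq_vecI) (auto simp: unit_vec_def)
    also have "E.Pmat *\<^sub>v (unit_vec n i @\<^sub>v 0\<^sub>v j) = s \<cdot>\<^sub>v (unit_vec n i @\<^sub>v 0\<^sub>v j)"
      unfolding E.Pmat_mult[OF u] by (rule P_unit[OF that(2) i])
    also have "(s \<cdot>\<^sub>v (unit_vec n i @\<^sub>v 0\<^sub>v j)) $ (n + q) = 0"
      using that by simp
    finally show ?thesis
      unfolding Pblocks(5) using Pblocks(1-4) that i by simp
  qed
  \<comment> \<open>Column \<open>p\<close> of \<open>Y\<close> is zero, so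
    \<open>tf_stein_orthogonal\<close> at this unit vector yields a vanishing product. Its second
    factor is not identically zero, hence \<open>tf w M' b'\<close> vanishes. Then the state
    \<open>0\<^sub>v n @\<^sub>v w\<close> of the transposed error automaton is invisible, and
    minimality makes it zero.\<close>
  have Y_inj: "w = 0\<^sub>v j" if w: "w \<in> carrier_vec j" "Y\<^sup>T *\<^sub>v w = 0\<^sub>v (p + r)" for w
  proof -
    have steinY: "Y = M' * Y * M + outer b' b"
      using steinP(2) by (simp only: MT)
    have Yu: "Y *\<^sub>v unit_vec n p = 0\<^sub>v j"
      using Pblocks(3) Y_zero p_lt by (intro eq_vecI) (auto simp: n scalar_prod_right_unit)
    have prod: "tf w M' b' z * (cnj z * tf b M (unit_vec n p) (cnj z)) = 0" if z: "norm z = 1" for z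
      using tf_stein_orthogonal[OF M stableM M' reg' Pblocks(3) b b' steinY w(1) w(2)[folded n] unit_vec_carrier z, of p]
      unfolding Yu tf_zero[OF M' reg' z w(1)] by (rule sym)
    obtain z0 where z0: "norm z0 = 1" "tf b M (unit_vec n p) z0 \<noteq> 0"
      using unit[OF p_lt(2) disjI2[OF refl]] by blast
    have zero: "tf w M' b' z = 0" if z: "norm z = 1" for z
    proof (rule circle_rational_mult_eq_0[OF tf_circle_rational[OF M' reg' w(1) b'] _ _ _ _ z])
      show "circle_rational (\<lambda>z. cnj z * tf b M (unit_vec n p) (cnj z))"
        by (intro circle_rational_mult circle_rational_cnj_arg[OF circle_rational_ident]
            circle_rational_cnj_arg[OF tf_circle_rational[OF M reg b unit_vec_carrier]])
      show "norm (cnj z0) = 1" "cnj (cnj z0) * tf b M (unit_vec n p) (cnj (cnj z0)) \<noteq> 0"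
        using z0 by auto
    qed (rule prod)
    have M'T: "M'\<^sup>T \<in> carrier_mat j j" "circle_regular M'\<^sup>T"
      using M' circle_regular_transpose[OF M' reg'] by auto
    have cyc': "cyclic (n + j) (N\<^sup>T)\<^sup>T y"
      using cycN(2) by simp
    have "0\<^sub>v n @\<^sub>v w = 0\<^sub>v (n + j)"
    proof (rule tf_eq_const_imp_eq_0[OF E.MT y cyc'])
      fix z :: complex assume z: "norm z = 1"
      have "tf y N\<^sup>T (0\<^sub>v n @\<^sub>v w) z = tf b M\<^sup>T (0\<^sub>v n) z + tf b' M'\<^sup>T w z"
        unfolding y_def NT using reg MT by (intro tf_diag_block[OF MTc _ M'T z b zero_carrier_vec b' w(1)]) simp
      also have "\<dots> = 0"
        using tf_zero[OF M reg z b] tf_transpose[OF M' reg' z w(1) b'] zero[OF z] by (simp add: MT)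
      finally show "tf y N\<^sup>T (0\<^sub>v n @\<^sub>v w) z = 0" .
    qed (use w in simp)
    then have "(0\<^sub>v n @\<^sub>v w) $ (n + i) = 0" if "i < j" for i
      using that by simp
    then show ?thesis
      using w(1) by (intro eq_vecI) auto
  qed

  \<comment> \<open>Invertibility of the off-diagonal block and the number of states\<close>
  have Sigma_sq: "(\<Sigma> $$ (i, i))\<^sup>2 \<noteq> s\<^sup>2" if "i < p" for i
    using card_k(2)[of i] that k(2) by (auto simp: p_def s_def power2_eq_iff)
  have R': "R = s\<^sup>2 \<cdot>\<^sub>m 1\<^sub>m p - \<Sigma> * \<Sigma>"
    using R by (simp add: p_def s_def)
  have Yc: "Y \<in> carrier_mat j (p + r)" and Xc: "X \<in> carrier_mat (p + r) j"
    using Pblocks(3) Qblocks(2) by (simp_all add: n)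
  define T where "T = mat j p (\<lambda>(q, i). Y $$ (q, i))"
  define X1 where "X1 = mat p j (\<lambda>(i, q). X $$ (i, q))"
  obtain S where S: "S \<in> carrier_mat p j" "T * S = 1\<^sub>m j" "S * T = 1\<^sub>m p" "X1 = R * S"
      and X_zero: "\<forall>i q. p \<le> i \<longrightarrow> i < p + r \<longrightarrow> q < j \<longrightarrow> X $$ (i, q) = 0"
    by (rule gramian_blocks[OF \<Sigma> Sigma(2) Sigma_sq R' D_def Yc Xc Y_zero Y_inj DDXY T_def X1_def])
      (assumption | rule that; assumption)+
  have T: "T \<in> carrier_mat j p"
    by (simp add: T_def)
  have j: "j = p"
    by (rule inverse_imp_same_dim[OF T S(1-3)])
  have Rc: "R \<in> carrier_mat p p"
    unfolding R' using \<Sigma> by (intro minus_carrier_mat mult_carrier_mat)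
  have \<Sigma>T: "\<Sigma>\<^sup>T = \<Sigma>"
  proof (rule eq_matI)
    fix i l assume "i < dim_row \<Sigma>" "l < dim_col \<Sigma>"
    then show "\<Sigma>\<^sup>T $$ (i, l) = \<Sigma> $$ (i, l)"
      using \<Sigma> Sigma(2) by (cases "i = l") (auto simp: diagonal_mat_def)
  qed (use \<Sigma> in auto)
  have RT: "R\<^sup>T = R"
  proof -
    have "(s\<^sup>2 \<cdot>\<^sub>m 1\<^sub>m p - Z)\<^sup>T = s\<^sup>2 \<cdot>\<^sub>m 1\<^sub>m p - Z\<^sup>T" if "Z \<in> carrier_mat p p" for Z
      using that by (intro eq_matI) auto
    from this[OF mult_carrier_mat[OF \<Sigma> \<Sigma>]] show ?thesis
      unfolding R' transpose_mult[OF \<Sigma> \<Sigma>] \<Sigma>T .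
  qed

  \<comment> \<open>Off-diagonal Stein equations in the new coordinates\<close>
  have A11: "A11 \<in> carrier_mat p p" and A12: "A12 \<in> carrier_mat p r"
    using part_dims by (simp_all add: p_def)
  have \<alpha>1: "\<alpha>1 \<in> carrier_vec p" and \<beta>1: "\<beta>1 \<in> carrier_vec p"
    using part_dims by (simp_all add: p_def)
  have M_part: "M = four_block_mat A11 A12 (A12\<^sup>T) A22" and a_part: "a = \<alpha>1 @\<^sub>v \<alpha>2" and b_part: "b = \<beta>1 @\<^sub>v \<beta>2"
    using part by (simp_all add: defs)
  have "Y = M' * Y * four_block_mat A11 A12 (A12\<^sup>T) A22 + outer b' (\<beta>1 @\<^sub>v \<beta>2)"
    using steinP(2) unfolding MT by (simp only: M_part b_part)
  note blockY = stein_first_block[OF A11 A12 part_dims(3) M' Yc \<beta>1 part_dims(7) b' this Y_zero T_def]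
  have "X\<^sup>T = M'\<^sup>T * X\<^sup>T * four_block_mat A11 A12 (A12\<^sup>T) A22 + outer (- a') (\<alpha>1 @\<^sub>v \<alpha>2)"
  proof -
    have Xn: "X \<in> carrier_mat n j" using Xc by (simp add: n)
    have MX: "M * X \<in> carrier_mat n j" and MXM: "M * X * M' \<in> carrier_mat n j"
      using M Xn M' by simp_all
    have "X\<^sup>T = (M * X * M' + outer a (- a'))\<^sup>T"
      using steinQ(2) unfolding MT by (rule arg_cong)
    also have "\<dots> = (M * X * M')\<^sup>T + outer (- a') a"
      unfolding transpose_add[OF MXM outer_carrier[OF a ma']] outer_transpose ..
    also have "(M * X * M')\<^sup>T = M'\<^sup>T * (X\<^sup>T * M)"
      unfolding transpose_mult[OF MX M'] transpose_mult[OF M Xn] MT ..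
    also have "\<dots> = M'\<^sup>T * X\<^sup>T * M"
      using Xn by (intro assoc_mult_mat[OF M'Tc _ M, symmetric]) simp
    finally show ?thesis
      by (simp only: M_part a_part)
  qed
  note steinXT = this
  have XTc: "X\<^sup>T \<in> carrier_mat j (p + r)"
    using Xc by simp
  have XT_zero: "X\<^sup>T $$ (q, i) = 0" if "q < j" "p \<le> i" "i < p + r" for q i
    using X_zero Xc that by simp
  have X1T: "X1\<^sup>T = mat j p (\<lambda>(q, i). X\<^sup>T $$ (q, i))"
    using Xc by (intro eq_matI) (auto simp: X1_def)
  note X1_eq = stein_first_block[OF A11 A12 part_dims(3) M'Tc XTc \<alpha>1 part_dims(5) ma' steinXT XT_zero X1T]

  \<comment> \<open>\<open>T\<close> maps the new coordinates to the old ones. In the new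
    coordinates the block \<open>T\<close> of \<open>P\<close> becomes the identity, and the
    transposed block \<open>X1\<close> of \<open>Q\<close> becomes \<open>R\<close>.\<close>
  define Ah \<alpha>h \<beta>h where h_defs: "Ah = S * M' * T" "\<alpha>h = T\<^sup>T *\<^sub>v a'" "\<beta>h = S *\<^sub>v b'"
  have Ah: "Ah \<in> carrier_mat p p"
    unfolding h_defs using S(1) M' T by simp
  have \<alpha>h: "\<alpha>h \<in> carrier_vec p" and \<beta>h: "\<beta>h \<in> carrier_vec p"
    unfolding h_defs using mult_mat_vec_carrier[OF _ a', of "T\<^sup>T" p] mult_mat_vec_carrier[OF S(1) b'] T
    by simp_all
  have Tt: "T\<^sup>T \<in> carrier_mat p j" and St: "S\<^sup>T \<in> carrier_mat j p"
    using T S(1) by simp_all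
  have AhT: "T\<^sup>T * M'\<^sup>T * S\<^sup>T = Ah\<^sup>T"
  proof -
    have SM: "S * M' \<in> carrier_mat p j" using S(1) M' by simp
    show ?thesis
      unfolding h_defs transpose_mult[OF SM T] transpose_mult[OF S(1) M']
      by (rule assoc_mult_mat[OF Tt M'Tc St])
  qed
  have TS: "T\<^sup>T * S\<^sup>T = 1\<^sub>m p"
    unfolding transpose_mult[OF S(1) T, symmetric] S(3) by (rule transpose_one)
  have T1: "T = T * 1\<^sub>m p"
    using right_mult_one_mat[OF T] by simp
  have Ah1: "Ah * 1\<^sub>m p = Ah"
    by (rule right_mult_one_mat[OF Ah])
  have \<beta>_eqs: "1\<^sub>m p = Ah * A11 + outer \<beta>h \<beta>1" "0\<^sub>m p r = Ah * A12 + outer \<beta>h \<beta>2"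
  proof -
    have "S * T = S * (M' * (T * 1\<^sub>m p) * A11 + outer b' \<beta>1)"
      unfolding T1[symmetric] by (rule arg_cong[OF blockY(1)])
    also have "\<dots> = Ah * 1\<^sub>m p * A11 + outer \<beta>h \<beta>1"
      unfolding h_defs by (rule change_of_basis_stein[OF M' S(1) T one_carrier_mat A11 b' \<beta>1])
    finally show "1\<^sub>m p = Ah * A11 + outer \<beta>h \<beta>1"
      unfolding S(3) Ah1 .
    have "S * 0\<^sub>m j r = S * (M' * (T * 1\<^sub>m p) * A12 + outer b' \<beta>2)"
      unfolding T1[symmetric] by (rule arg_cong[OF blockY(2)])
    also have "\<dots> = Ah * 1\<^sub>m p * A12 + outer \<beta>h \<beta>2"
      unfolding h_defs by (rule change_of_basis_stein[OF M' S(1) T one_carrier_mat A12 b' part_dims(7)])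
    finally show "0\<^sub>m p r = Ah * A12 + outer \<beta>h \<beta>2"
      unfolding Ah1 using S(1) by simp
  qed
  have neg: "T\<^sup>T *\<^sub>v (- a') = - \<alpha>h"
    unfolding h_defs using Tt a' by (intro eq_vecI) auto
  have X1t: "X1\<^sup>T = S\<^sup>T * R"
    unfolding S(4) transpose_mult[OF Rc S(1)] RT ..
  have \<alpha>_eqs: "R = Ah\<^sup>T * R * A11 + outer (- \<alpha>h) \<alpha>1" "0\<^sub>m p r = Ah\<^sup>T * R * A12 + outer (- \<alpha>h) \<alpha>2"
  proof -
    have "T\<^sup>T * (S\<^sup>T * R) = T\<^sup>T * (M'\<^sup>T * (S\<^sup>T * R) * A11 + outer (- a') \<alpha>1)"
      using X1_eq(1) unfolding X1t by (rule arg_cong)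
    also have "\<dots> = T\<^sup>T * M'\<^sup>T * S\<^sup>T * R * A11 + outer (T\<^sup>T *\<^sub>v (- a')) \<alpha>1"
      by (rule change_of_basis_stein[OF M'Tc Tt St Rc A11 ma' \<alpha>1])
    also have "T\<^sup>T * (S\<^sup>T * R) = R"
      unfolding assoc_mult_mat[OF Tt St Rc, symmetric] TS by (rule left_mult_one_mat[OF Rc])
    finally show "R = Ah\<^sup>T * R * A11 + outer (- \<alpha>h) \<alpha>1"
      unfolding AhT neg .
    have "T\<^sup>T * 0\<^sub>m j r = T\<^sup>T * (M'\<^sup>T * (S\<^sup>T * R) * A12 + outer (- a') \<alpha>2)"
      using X1_eq(2) unfolding X1t by (rule arg_cong)
    also have "\<dots> = T\<^sup>T * M'\<^sup>T * S\<^sup>T * R * A12 + outer (T\<^sup>T *\<^sub>v (- a')) \<alpha>2"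
      by (rule change_of_basis_stein[OF M'Tc Tt St Rc A12 ma' part_dims(5)])
    finally show "0\<^sub>m p r = Ah\<^sup>T * R * A12 + outer (- \<alpha>h) \<alpha>2"
      unfolding AhT neg using Tt by simp
  qed
  note formulas = realization_formulas[OF A11 A12 Ah Rc \<alpha>1 part_dims(5) \<beta>1 part_dims(7) \<alpha>h \<beta>h \<beta>_eqs \<alpha>_eqs]

  \<comment> \<open>The two cases\<close>
  have ab_index: "a $ i = 0 \<longleftrightarrow> b $ i = 0" if "i < n" for i
    using conventions that
    by (auto simp: sva_conventions_def nonzero_eigenvalues_def defs sgn_zero_iff)
  \<comment> \<open>The cases are distinguished by \<open>\<alpha>2\<close>, but the formulas also
    use the pseudo-inverse of \<open>\<beta>2\<close>. The signs in the convention are nonzero, so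
    both vectors vanish together.\<close>
  have zero2: "\<alpha>2 = 0\<^sub>v r \<longleftrightarrow> \<beta>2 = 0\<^sub>v r"
  proof -
    have "\<alpha>2 $ i = 0 \<longleftrightarrow> \<beta>2 $ i = 0" if "i < r" for i
      using ab_index[of "p + i"] that \<alpha>1 \<beta>1 part_dims(5,7) by (simp add: a_part b_part n)
    then show ?thesis
      using part_dims(5,7) by (auto intro!: eq_vecI)
  qed
  \<comment> \<open>A zero initial or final vector would have the zero transfer function for every
    state. Hence, if the second parts vanish, the first parts do not, as the formulas of the second
    case require.\<close>
  have nz: "v \<noteq> 0\<^sub>v n" if ab: "v = a \<or> v = b" for v
  proof
    assume v: "v = 0\<^sub>v n"
    obtain z where z: "norm z = 1" "tf v M (unit_vec n p) z \<noteq> 0"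
      using unit[OF p_lt(2) ab] by auto
    have "tf v M (unit_vec n p) z = tf (unit_vec n p) M\<^sup>T v z"
      using tf_transpose[OF M reg z(1), of v "unit_vec n p"] v by simp
    then show False
      using z tf_zero[OF M reg z(1), of "unit_vec n p"] by (simp add: v MT)
  qed
  have nz1: "\<alpha>1 \<noteq> 0\<^sub>v p" "\<beta>1 \<noteq> 0\<^sub>v p" if "\<alpha>2 = 0\<^sub>v r"
    using nz[of a] nz[of b] that zero2 by (auto simp: a_part b_part n)

  have basis: "change_of_basis A' (WFA \<alpha>h Ah \<beta>h)"
    unfolding change_of_basis_def
  proof (intro exI conjI)
    have T': "T \<in> carrier_mat p p" and S': "S \<in> carrier_mat p p" and "M' \<in> carrier_mat p p"
      using T S(1) M' by (simp_all add: j)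
    then show "similar_mat_wit (trans_mat (WFA \<alpha>h Ah \<beta>h)) (trans_mat A') S T"
      using S(2,3) Ah by (intro similar_mat_witI[of _ _ p]) (simp_all add: j defs h_defs)
  qed (simp_all add: h_defs defs)
  have case1: "mat_of_col \<beta>h = - (Ah * A12 * pseudo_inverse (mat_of_row \<beta>2)) \<and>
      mat_of_col \<alpha>h = Ah\<^sup>T * R * A12 * pseudo_inverse (mat_of_row \<alpha>2) \<and>
      Ah * (A11 - A12 * pseudo_inverse (mat_of_row \<beta>2) * mat_of_row \<beta>1) = 1\<^sub>m p" if nz2: "\<alpha>2 \<noteq> 0\<^sub>v r"
  proof (intro conjI)
    have "\<beta>2 \<noteq> 0\<^sub>v r"
      using nz2 zero2 by simp
    then show "mat_of_col \<beta>h = - (Ah * A12 * pseudo_inverse (mat_of_row \<beta>2))"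
      "Ah * (A11 - A12 * pseudo_inverse (mat_of_row \<beta>2) * mat_of_row \<beta>1) = 1\<^sub>m p"
      by (rule formulas(1), rule formulas(3))
  qed (rule formulas(2)[OF nz2])
  have case2: "mat_of_col \<beta>h = (1\<^sub>m p - Ah * A11) * pseudo_inverse (mat_of_row \<beta>1) \<and>
      mat_of_col \<alpha>h = - ((R - Ah\<^sup>T * R * A11) * pseudo_inverse (mat_of_row \<alpha>1)) \<and>
      Ah * A12 = 0\<^sub>m p r" if z2: "\<alpha>2 = 0\<^sub>v r"
    by (intro conjI formulas(4)[OF nz1(2)[OF z2]] formulas(5)[OF nz1(1)[OF z2]] formulas(6) zero2[THEN iffD1] z2)
  show ?thesis
    unfolding p_def[symmetric]
    by (rule conjI[OF j], rule exI[of _ \<alpha>h], rule exI[of _ Ah], rule exI[of _ \<beta>h],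
        rule conjI[OF basis], rule conjI; rule impI, erule case1 case2)
qed

end
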